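(* Let $A=\Lambda[x_1,\ldots,x_n]=\Lambda(R^n)$ be the $n$-th exterior algebra over a commutative unital ring $R$, and let $k\ge0$. If $R=\mathbb{Z}$, then $HH^k(A;A)\cong\mathbb{Z}^F\oplus\mathbb{Z}_2^{\,T}$, where $$F=2^{n-1}\binom{n+k-1}{k}+\begin{cases}1&k=0\text{ and }n\text{ odd}\\0&\text{otherwise}\end{cases}$$ and $$T=2^{n-1}\sum_{0\le i<k}(-1)^{k-1-i}\binom{n+i-1}{i}+\begin{cases}(-1)^k&n\text{ odd}\\0&n\text{ even.}\end{cases}$$ In particular, if $R=K$ is a field, then $$\dim_K HH^k(A;A)=\begin{cases}2^n\binom{n+k-1}{k}&\text{if }\operatorname{char}K=2,\\ 2^{n-1}\binom{n+k-1}{k}&\text{if }\operatorname{char}K\ne2\text{ and }(k\ge1\text{ or }n\text{ even}),\\ 2^{n-1}+1&\text{if }\operatorname{char}K\ne2\text{ and }(k=0\text{ and }n\text{ odd}).\end{cases}$$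
   Context: $A$ is the associative unital $R$-algebra with $R$-basis $x_\sigma=\bigwedge_{i\in\sigma}x_i$, $\sigma\subseteq\{1,\ldots,n\}$, $x_i^2=0$, $x_ix_j=-x_jx_i$, regarded as an ordinary (ungraded, no sign conventions) algebra. $HH^k(A;A)$ is its Hochschild cohomology: the degree-$k$ cohomology of $\operatorname{Hom}_{A^e}(B_\ast,A)$, where $A^e=A\otimes_RA^{\mathrm{op}}$ and $B_\ast$ is the bar resolution, $B_k=A^{\otimes k+2}$ ($k\ge0$, tensors over $R$) with $b_k(a_0\otimes\cdots\otimes a_{k+1})=\sum_{i=0}^k(-1)^ia_0\otimes\cdots\otimes a_ia_{i+1}\otimes\cdots\otimes a_{k+1}$. $\mathbb{Z}_2=\mathbb{Z}/2\mathbb{Z}$. The number $\binom{n+k-1}{k}$ is the number of $k$-element multisets of elements of $\{1,\ldots,n\}$.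
   Formalization: The term (-1)^k in T for n odd is included only for k ≥ 1, so T = 0 at k = 0; as printed T = 1 for k = 0 and n odd, which is false since HH^0 is the torsion-free center of A (n = 1 gives Z^2). Also n ≥ 1 is assumed, as 2^(n-1) requires. *)

theory Defs
  imports
    "HOL-Algebra.AbelCoset"
    "HOL-Algebra.Elementary_Groups"
    "HOL-Algebra.Product_Groups"
    "HOL-Library.Poly_Mapping"
    "Jordan_Normal_Form.VS_Connect"
begin

section \<open>The exterior algebra\<close>

text \<open>
  An element is given by its coefficients with respect to the basis \<open>x\<^sub>\<sigma>\<close>, where \<open>\<sigma>\<close> ranges
  over the subsets of the finite linearly ordered type \<open>'n\<close>; this type plays the role of
  \<open>{1, \<dots>, n}\<close>, with \<open>n = CARD('n)\<close>.
\<close>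

typedef ('r, 'n) exterior = "UNIV :: ('n set \<Rightarrow> 'r) set"
  morphisms ext_coeff Exterior
  by simp

setup_lifting type_definition_exterior

lemma exterior_eqI: "(\<And>\<sigma>. ext_coeff a \<sigma> = ext_coeff b \<sigma>) \<Longrightarrow> a = b"
  by (simp add: ext_coeff_inject[symmetric] fun_eq_iff)

text \<open>
  For disjoint \<open>\<sigma>\<close> and \<open>\<tau>\<close>, sorting the word \<open>x\<^sub>\<sigma> x\<^sub>\<tau>\<close> takes one transposition for every pair
  \<open>i \<in> \<sigma>\<close>, \<open>j \<in> \<tau>\<close> with \<open>i > j\<close>, so \<open>x\<^sub>\<sigma> x\<^sub>\<tau> = \<plusminus>x\<^bsub>\<sigma> \<union> \<tau>\<^esub>\<close> with the following sign.
\<close>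

definition shuffle_sign :: "'n::{finite,linorder} set \<Rightarrow> 'n set \<Rightarrow> 'r::comm_ring_1" where
  "shuffle_sign \<sigma> \<tau> = (- 1) ^ card {(i, j). i \<in> \<sigma> \<and> j \<in> \<tau> \<and> j < i}"

lemma shuffle_sign_empty [simp]: "shuffle_sign {} \<tau> = 1" "shuffle_sign \<sigma> {} = 1"
  by (simp_all add: shuffle_sign_def)

lemma shuffle_sign_Un_left:
  assumes "\<sigma> \<inter> \<mu> = {}"
  shows "shuffle_sign (\<sigma> \<union> \<mu>) \<nu> = (shuffle_sign \<sigma> \<nu> * shuffle_sign \<mu> \<nu> :: 'r::comm_ring_1)"
proof -
  have "{(i, j). i \<in> \<sigma> \<union> \<mu> \<and> j \<in> \<nu> \<and> j < i}
      = {(i, j). i \<in> \<sigma> \<and> j \<in> \<nu> \<and> j < i} \<union> {(i, j). i \<in> \<mu> \<and> j \<in> \<nu> \<and> j < i}" by auto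
  moreover have "card \<dots> = card {(i, j). i \<in> \<sigma> \<and> j \<in> \<nu> \<and> j < i} + card {(i, j). i \<in> \<mu> \<and> j \<in> \<nu> \<and> j < i}"
    using assms by (intro card_Un_disjoint) auto
  ultimately show ?thesis by (simp add: shuffle_sign_def power_add)
qed

lemma shuffle_sign_Un_right:
  assumes "\<mu> \<inter> \<nu> = {}"
  shows "shuffle_sign \<sigma> (\<mu> \<union> \<nu>) = (shuffle_sign \<sigma> \<mu> * shuffle_sign \<sigma> \<nu> :: 'r::comm_ring_1)"
proof -
  have "{(i, j). i \<in> \<sigma> \<and> j \<in> \<mu> \<union> \<nu> \<and> j < i}
      = {(i, j). i \<in> \<sigma> \<and> j \<in> \<mu> \<and> j < i} \<union> {(i, j). i \<in> \<sigma> \<and> j \<in> \<nu> \<and> j < i}" by auto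
  moreover have "card \<dots> = card {(i, j). i \<in> \<sigma> \<and> j \<in> \<mu> \<and> j < i} + card {(i, j). i \<in> \<sigma> \<and> j \<in> \<nu> \<and> j < i}"
    using assms by (intro card_Un_disjoint) auto
  ultimately show ?thesis by (simp add: shuffle_sign_def power_add)
qed

instantiation exterior :: (comm_ring_1, type) ab_group_add
begin
lift_definition zero_exterior :: "('a, 'b) exterior" is "\<lambda>\<sigma>. 0" .
lift_definition plus_exterior :: "('a, 'b) exterior \<Rightarrow> ('a, 'b) exterior \<Rightarrow> ('a, 'b) exterior"
  is "\<lambda>a b \<sigma>. a \<sigma> + b \<sigma>" .
lift_definition minus_exterior :: "('a, 'b) exterior \<Rightarrow> ('a, 'b) exterior \<Rightarrow> ('a, 'b) exterior"
  is "\<lambda>a b \<sigma>. a \<sigma> - b \<sigma>" .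
lift_definition uminus_exterior :: "('a, 'b) exterior \<Rightarrow> ('a, 'b) exterior"
  is "\<lambda>a \<sigma>. - a \<sigma>" .
instance
  by standard (transfer; simp add: fun_eq_iff algebra_simps)+
end

instantiation exterior :: (comm_ring_1, "{finite,linorder}") ring_1
begin
lift_definition one_exterior :: "('a, 'b) exterior" is "\<lambda>\<sigma>. if \<sigma> = {} then 1 else 0" .
lift_definition times_exterior :: "('a, 'b) exterior \<Rightarrow> ('a, 'b) exterior \<Rightarrow> ('a, 'b) exterior"
  is "\<lambda>a b \<rho>. \<Sum>\<sigma> | \<sigma> \<subseteq> \<rho>. shuffle_sign \<sigma> (\<rho> - \<sigma>) * (a \<sigma> * b (\<rho> - \<sigma>))" .
instance
proof
  fix a b c :: "('a, 'b) exterior"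
  show "a * b * c = a * (b * c)"
  proof (transfer, rule ext)
    fix a b c :: "'b set \<Rightarrow> 'a" and \<rho> :: "'b set"
    have "(\<Sum>\<tau> | \<tau> \<subseteq> \<rho>. shuffle_sign \<tau> (\<rho> - \<tau>) *
              ((\<Sum>\<sigma> | \<sigma> \<subseteq> \<tau>. shuffle_sign \<sigma> (\<tau> - \<sigma>) * (a \<sigma> * b (\<tau> - \<sigma>))) * c (\<rho> - \<tau>)))
        = (\<Sum>\<tau> | \<tau> \<subseteq> \<rho>. \<Sum>\<sigma> | \<sigma> \<subseteq> \<tau>.
             shuffle_sign \<tau> (\<rho> - \<tau>) * shuffle_sign \<sigma> (\<tau> - \<sigma>) * (a \<sigma> * b (\<tau> - \<sigma>) * c (\<rho> - \<tau>)))"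
      by (simp add: sum_distrib_left sum_distrib_right mult_ac)
    also have "\<dots> = (\<Sum>(\<tau>, \<sigma>) \<in> (SIGMA \<tau>:{\<tau>. \<tau> \<subseteq> \<rho>}. {\<sigma>. \<sigma> \<subseteq> \<tau>}).
             shuffle_sign \<tau> (\<rho> - \<tau>) * shuffle_sign \<sigma> (\<tau> - \<sigma>) * (a \<sigma> * b (\<tau> - \<sigma>) * c (\<rho> - \<tau>)))"
      by (subst sum.Sigma) auto
    also have "\<dots> = (\<Sum>(\<sigma>, \<mu>) \<in> (SIGMA \<sigma>:{\<sigma>. \<sigma> \<subseteq> \<rho>}. {\<mu>. \<mu> \<subseteq> \<rho> - \<sigma>}).
             shuffle_sign \<sigma> (\<rho> - \<sigma>) * shuffle_sign \<mu> (\<rho> - \<sigma> - \<mu>) * (a \<sigma> * b \<mu> * c (\<rho> - \<sigma> - \<mu>)))"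
    proof (rule sum.reindex_bij_witness[of _ "\<lambda>(\<sigma>, \<mu>). (\<sigma> \<union> \<mu>, \<sigma>)" "\<lambda>(\<tau>, \<sigma>). (\<sigma>, \<tau> - \<sigma>)"], goal_cases)
      case (5 p)
      then obtain \<tau> \<sigma> where p: "p = (\<tau>, \<sigma>)" "\<tau> \<subseteq> \<rho>" "\<sigma> \<subseteq> \<tau>" by auto
      define \<mu> where "\<mu> = \<tau> - \<sigma>"
      define \<nu> where "\<nu> = \<rho> - \<tau>"
      have eqs: "\<tau> = \<sigma> \<union> \<mu>" "\<rho> - \<sigma> = \<mu> \<union> \<nu>" "\<rho> - \<sigma> - \<mu> = \<nu>" "\<tau> - \<sigma> = \<mu>" "\<rho> - \<tau> = \<nu>"
        using p by (auto simp: \<mu>_def \<nu>_def)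
      have dis: "\<sigma> \<inter> \<mu> = {}" "\<mu> \<inter> \<nu> = {}" by (auto simp: \<mu>_def \<nu>_def)
      have *: "\<mu> \<union> \<nu> - \<mu> = \<nu>" using dis by auto
      have "shuffle_sign \<tau> \<nu> = (shuffle_sign \<sigma> \<nu> * shuffle_sign \<mu> \<nu> :: 'a)"
        unfolding eqs(1) by (rule shuffle_sign_Un_left[OF dis(1)])
      then show ?case
        unfolding p prod.case eqs(2-5) *
        by (simp only: shuffle_sign_Un_right[OF dis(2)] mult_ac)
    qed auto
    also have "\<dots> = (\<Sum>\<sigma> | \<sigma> \<subseteq> \<rho>. \<Sum>\<mu> | \<mu> \<subseteq> \<rho> - \<sigma>.
             shuffle_sign \<sigma> (\<rho> - \<sigma>) * shuffle_sign \<mu> (\<rho> - \<sigma> - \<mu>) * (a \<sigma> * b \<mu> * c (\<rho> - \<sigma> - \<mu>)))"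
      by (subst sum.Sigma) auto
    also have "\<dots> = (\<Sum>\<sigma> | \<sigma> \<subseteq> \<rho>. shuffle_sign \<sigma> (\<rho> - \<sigma>) *
              (a \<sigma> * (\<Sum>\<mu> | \<mu> \<subseteq> \<rho> - \<sigma>. shuffle_sign \<mu> (\<rho> - \<sigma> - \<mu>) * (b \<mu> * c (\<rho> - \<sigma> - \<mu>)))))"
      by (simp add: sum_distrib_left mult_ac)
    finally show "(\<Sum>\<tau> | \<tau> \<subseteq> \<rho>. shuffle_sign \<tau> (\<rho> - \<tau>) *
              ((\<Sum>\<sigma> | \<sigma> \<subseteq> \<tau>. shuffle_sign \<sigma> (\<tau> - \<sigma>) * (a \<sigma> * b (\<tau> - \<sigma>))) * c (\<rho> - \<tau>)))
        = (\<Sum>\<sigma> | \<sigma> \<subseteq> \<rho>. shuffle_sign \<sigma> (\<rho> - \<sigma>) *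
              (a \<sigma> * (\<Sum>\<mu> | \<mu> \<subseteq> \<rho> - \<sigma>. shuffle_sign \<mu> (\<rho> - \<sigma> - \<mu>) * (b \<mu> * c (\<rho> - \<sigma> - \<mu>)))))" .
  qed
  show "1 * a = a"
  proof (transfer, rule ext)
    fix a :: "'b set \<Rightarrow> 'a" and \<rho> :: "'b set"
    have "(\<Sum>\<sigma> | \<sigma> \<subseteq> \<rho>. shuffle_sign \<sigma> (\<rho> - \<sigma>) * ((if \<sigma> = {} then 1 else 0) * a (\<rho> - \<sigma>)))
        = (\<Sum>\<sigma>\<in>{{}}. shuffle_sign \<sigma> (\<rho> - \<sigma>) * ((if \<sigma> = {} then 1 else 0) * a (\<rho> - \<sigma>)))"
      by (rule sum.mono_neutral_right) auto
    then show "(\<Sum>\<sigma> | \<sigma> \<subseteq> \<rho>. shuffle_sign \<sigma> (\<rho> - \<sigma>) * ((if \<sigma> = {} then 1 else 0) * a (\<rho> - \<sigma>))) = a \<rho>"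
      by simp
  qed
  show "a * 1 = a"
  proof (transfer, rule ext)
    fix a :: "'b set \<Rightarrow> 'a" and \<rho> :: "'b set"
    have "(\<Sum>\<sigma> | \<sigma> \<subseteq> \<rho>. shuffle_sign \<sigma> (\<rho> - \<sigma>) * (a \<sigma> * (if \<rho> - \<sigma> = {} then 1 else 0)))
        = (\<Sum>\<sigma>\<in>{\<rho>}. shuffle_sign \<sigma> (\<rho> - \<sigma>) * (a \<sigma> * (if \<rho> - \<sigma> = {} then 1 else 0)))"
      by (rule sum.mono_neutral_right) auto
    then show "(\<Sum>\<sigma> | \<sigma> \<subseteq> \<rho>. shuffle_sign \<sigma> (\<rho> - \<sigma>) * (a \<sigma> * (if \<rho> - \<sigma> = {} then 1 else 0))) = a \<rho>"
      by simp
  qed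
  show "(a + b) * c = a * c + b * c"
    by transfer (simp add: fun_eq_iff algebra_simps sum.distrib)
  show "a * (b + c) = a * b + a * c"
    by transfer (simp add: fun_eq_iff algebra_simps sum.distrib)
  show "(0 :: ('a, 'b) exterior) \<noteq> 1"
    by transfer (auto simp: fun_eq_iff)
qed
end

lift_definition ext_scale :: "'r::comm_ring_1 \<Rightarrow> ('r, 'n) exterior \<Rightarrow> ('r, 'n) exterior"
  is "\<lambda>r a \<sigma>. r * a \<sigma>" .

interpretation ext: Modules.module ext_scale
  by unfold_locales (transfer; simp add: fun_eq_iff algebra_simps)+

lemma ext_scale_mult_left: "ext_scale r a * b = ext_scale r (a * b)"
  by transfer (simp add: fun_eq_iff sum_distrib_left mult_ac)

lemma ext_scale_mult_right: "a * ext_scale r b = ext_scale r (a * b)"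
  by transfer (simp add: fun_eq_iff sum_distrib_left mult_ac)

lift_definition ext_basis :: "'n set \<Rightarrow> ('r::comm_ring_1, 'n) exterior"
  is "\<lambda>\<sigma> \<tau>. if \<tau> = \<sigma> then 1 else 0" .

lemma ext_basis_mult:
  "ext_basis \<sigma> * ext_basis \<tau> =
     (if \<sigma> \<inter> \<tau> = {} then ext_scale (shuffle_sign \<sigma> \<tau>) (ext_basis (\<sigma> \<union> \<tau>)) else 0)"
proof (rule exterior_eqI)
  fix \<rho>
  have "ext_coeff (ext_basis \<sigma> * ext_basis \<tau>) \<rho> =
      (\<Sum>\<mu> | \<mu> \<subseteq> \<rho>. if \<mu> = \<sigma> \<and> \<rho> - \<sigma> = \<tau> then shuffle_sign \<sigma> \<tau> else 0)"
    by transfer (auto intro!: sum.cong)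
  also have "\<dots> = (if \<sigma> \<subseteq> \<rho> \<and> \<rho> - \<sigma> = \<tau> then shuffle_sign \<sigma> \<tau> else 0)"
    by (cases "\<rho> - \<sigma> = \<tau>") (auto simp: sum.delta' sum.delta)
  also have "\<dots> = ext_coeff (if \<sigma> \<inter> \<tau> = {} then ext_scale (shuffle_sign \<sigma> \<tau>) (ext_basis (\<sigma> \<union> \<tau>)) else 0) \<rho>"
    by (auto simp: ext_scale.rep_eq ext_basis.rep_eq zero_exterior.rep_eq)
  finally show "ext_coeff (ext_basis \<sigma> * ext_basis \<tau>) \<rho> = \<dots>" .
qed

lemma ext_expansion: "a = (\<Sum>\<sigma>\<in>UNIV. ext_scale (ext_coeff a \<sigma>) (ext_basis \<sigma>))"
  for a :: "('r::comm_ring_1, 'n::finite) exterior"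
proof (rule exterior_eqI)
  fix \<tau>
  have hom: "ext_coeff (sum f S) \<tau> = (\<Sum>\<sigma>\<in>S. ext_coeff (f \<sigma>) \<tau>)" if "finite S" for S
    and f :: "'n set \<Rightarrow> ('r, 'n) exterior"
    using that by induction (simp_all add: zero_exterior.rep_eq plus_exterior.rep_eq)
  show "ext_coeff a \<tau> = ext_coeff (\<Sum>\<sigma>\<in>UNIV. ext_scale (ext_coeff a \<sigma>) (ext_basis \<sigma>)) \<tau>"
    by (simp add: hom ext_scale.rep_eq ext_basis.rep_eq if_distrib[of "\<lambda>x. _ * x"] cong: if_cong)
qed

abbreviation ext_gen :: "'n \<Rightarrow> ('r::comm_ring_1, 'n) exterior" where
  "ext_gen i \<equiv> ext_basis {i}"

lemma ext_gen_square: "ext_gen i * ext_gen i = 0"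
  by (simp add: ext_basis_mult)

lemma ext_gen_anticommute: "ext_gen i * ext_gen j = - (ext_gen j * ext_gen i)"
proof -
  have *: "{(a, b). a \<in> {i} \<and> b \<in> {j} \<and> b < a} = (if j < i then {(i, j)} else {})" for i j :: 'b
    by auto
  show ?thesis
    by (cases i j rule: linorder_cases)
      (simp_all only: ext_basis_mult shuffle_sign_def *, auto simp: insert_commute)
qed

lemma ext_basis_eq_prod:
  "ext_basis \<sigma> = (prod_list (map ext_gen (sorted_list_of_set \<sigma>)) :: ('r::comm_ring_1, 'n::{finite,linorder}) exterior)"
proof -
  have "ext_basis (set xs) = (prod_list (map ext_gen xs) :: ('r, 'n) exterior)"
    if "sorted_wrt (<) xs" for xs :: "'n list"
    using that
  proof (induction xs)
    case Nil
    show ?case by (simp, transfer) (auto simp: fun_eq_iff)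
  next
    case (Cons x xs)
    have "{(i, j). i \<in> {x} \<and> j \<in> set xs \<and> j < i} = {}"
      using Cons.prems by auto
    then have "shuffle_sign {x} (set xs) = (1 :: 'r)"
      by (simp only: shuffle_sign_def) simp
    moreover have "{x} \<inter> set xs = {}" using Cons.prems by auto
    moreover have "ext_basis (set xs) = (prod_list (map ext_gen xs) :: ('r, 'n) exterior)"
      using Cons by simp
    ultimately show ?case
      using ext_basis_mult[of "{x}" "set xs", where ?'a = 'r] by simp
  qed
  from this[of "sorted_list_of_set \<sigma>"] show ?thesis by simp
qed


lifting_forget exterior.lifting


section \<open>Tensor powers\<close>

text \<open>
  All tensor powers over \<open>R\<close> of the exterior algebra \<open>A\<close> live in one type, the direct sum of the
  \<open>A\<^sup>\<otimes>\<^sup>m\<close>: the free \<open>R\<close>-module on finite lists over \<open>A\<close> (the list \<open>[a\<^sub>1, \<dots>, a\<^sub>m]\<close> stands for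
  \<open>a\<^sub>1 \<otimes> \<dots> \<otimes> a\<^sub>m\<close>) modulo the relations that make it linear in every entry. The relations do not
  mix lengths, and \<open>A\<^sup>\<otimes>\<^sup>m\<close> is the span of the lists of length \<open>m\<close>.
\<close>

definition free_scale :: "'r::comm_ring_1 \<Rightarrow> ('x \<Rightarrow>\<^sub>0 'r) \<Rightarrow> ('x \<Rightarrow>\<^sub>0 'r)" where
  "free_scale r = Poly_Mapping.map ((*) r)"

lemma lookup_free_scale [simp]: "Poly_Mapping.lookup (free_scale r p) x = r * Poly_Mapping.lookup p x"
  unfolding free_scale_def by transfer (simp add: when_def)

interpretation free: Modules.module free_scale
  by unfold_locales (simp_all add: poly_mapping_eq_iff fun_eq_iff lookup_add algebra_simps)

definition tensor_relators :: "(('r::comm_ring_1, 'n) exterior list \<Rightarrow>\<^sub>0 'r) set" where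
  "tensor_relators =
     {Poly_Mapping.single (as[j := a + b]) 1 - Poly_Mapping.single (as[j := a]) 1
        - Poly_Mapping.single (as[j := b]) 1 | as j a b. j < length as}
   \<union> {Poly_Mapping.single (as[j := ext_scale r a]) 1 - Poly_Mapping.single (as[j := a]) r
        | as j r a. j < length as}"

quotient_type (overloaded) ('r, 'n) tensor = "('r::comm_ring_1, 'n) exterior list \<Rightarrow>\<^sub>0 'r" /
  "\<lambda>p q. p - q \<in> free.span tensor_relators"
proof (rule equivpI)
  show "reflp (\<lambda>p q :: ('r, 'n) exterior list \<Rightarrow>\<^sub>0 'r. p - q \<in> free.span tensor_relators)"
    by (auto intro!: reflpI free.span_zero)
  show "symp (\<lambda>p q :: ('r, 'n) exterior list \<Rightarrow>\<^sub>0 'r. p - q \<in> free.span tensor_relators)"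
  proof (rule sympI)
    fix p q :: "('r, 'n) exterior list \<Rightarrow>\<^sub>0 'r"
    assume "p - q \<in> free.span tensor_relators"
    from free.span_neg[OF this] show "q - p \<in> free.span tensor_relators" by simp
  qed
  show "transp (\<lambda>p q :: ('r, 'n) exterior list \<Rightarrow>\<^sub>0 'r. p - q \<in> free.span tensor_relators)"
  proof (rule transpI)
    fix p q u :: "('r, 'n) exterior list \<Rightarrow>\<^sub>0 'r"
    assume "p - q \<in> free.span tensor_relators" "q - u \<in> free.span tensor_relators"
    from free.span_add[OF this] show "p - u \<in> free.span tensor_relators" by simp
  qed
qed

instantiation tensor :: (comm_ring_1, type) ab_group_add
begin
lift_definition zero_tensor :: "('a, 'b) tensor" is 0 .
lift_definition plus_tensor :: "('a, 'b) tensor \<Rightarrow> ('a, 'b) tensor \<Rightarrow> ('a, 'b) tensor" is "(+)"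
proof -
  fix p p' q q' :: "('a, 'b) exterior list \<Rightarrow>\<^sub>0 'a"
  assume "p - p' \<in> free.span tensor_relators" "q - q' \<in> free.span tensor_relators"
  from free.span_add[OF this] show "p + q - (p' + q') \<in> free.span tensor_relators"
    by (simp add: algebra_simps)
qed
lift_definition minus_tensor :: "('a, 'b) tensor \<Rightarrow> ('a, 'b) tensor \<Rightarrow> ('a, 'b) tensor" is "(-)"
proof -
  fix p p' q q' :: "('a, 'b) exterior list \<Rightarrow>\<^sub>0 'a"
  assume "p - p' \<in> free.span tensor_relators" "q - q' \<in> free.span tensor_relators"
  from free.span_diff[OF this] show "p - q - (p' - q') \<in> free.span tensor_relators"
    by (simp add: algebra_simps)
qed
lift_definition uminus_tensor :: "('a, 'b) tensor \<Rightarrow> ('a, 'b) tensor" is "uminus"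
proof -
  fix p p' :: "('a, 'b) exterior list \<Rightarrow>\<^sub>0 'a"
  assume "p - p' \<in> free.span tensor_relators"
  from free.span_neg[OF this] show "- p - - p' \<in> free.span tensor_relators"
    by simp
qed
instance
  by standard (transfer; simp add: free.span_zero algebra_simps)+
end

lift_definition tensor_scale :: "'r::comm_ring_1 \<Rightarrow> ('r, 'n) tensor \<Rightarrow> ('r, 'n) tensor"
  is free_scale
  by (simp add: free.span_scale flip: free.scale_right_diff_distrib)

interpretation tensor: Modules.module tensor_scale
  by unfold_locales (transfer; simp add: free.span_zero free.scale_right_distrib free.scale_left_distrib)+

lift_definition pure_tensor :: "('r::comm_ring_1, 'n) exterior list \<Rightarrow> ('r, 'n) tensor"
  is "\<lambda>as. Poly_Mapping.single as 1" .

definition tensor_power :: "nat \<Rightarrow> ('r::comm_ring_1, 'n) tensor set" where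
  "tensor_power m = tensor.span {pure_tensor as | as. length as = m}"

definition multilinear ::
  "('r::comm_ring_1 \<Rightarrow> 'm::ab_group_add \<Rightarrow> 'm) \<Rightarrow> (('r, 'n) exterior list \<Rightarrow> 'm) \<Rightarrow> bool" where
  "multilinear s f \<longleftrightarrow> (\<forall>as. \<forall>j < length as.
     (\<forall>a b. f (as[j := a + b]) = f (as[j := a]) + f (as[j := b])) \<and>
     (\<forall>r a. f (as[j := ext_scale r a]) = s r (f (as[j := a]))))"

definition free_lift ::
  "('r::comm_ring_1 \<Rightarrow> 'm::ab_group_add \<Rightarrow> 'm) \<Rightarrow> ('x \<Rightarrow> 'm) \<Rightarrow> ('x \<Rightarrow>\<^sub>0 'r) \<Rightarrow> 'm" where
  "free_lift s f p = (\<Sum>x \<in> Poly_Mapping.keys p. s (Poly_Mapping.lookup p x) (f x))"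

text \<open>
  The linear map on tensors induced by a multilinear map \<open>f\<close> into the module with scalar
  multiplication \<open>s\<close>; it does not depend on the representative, see \<open>tensor_lift_pure\<close> and
  \<open>module_hom_tensor_lift\<close> below.
\<close>

definition tensor_lift ::
  "('r::comm_ring_1 \<Rightarrow> 'm::ab_group_add \<Rightarrow> 'm) \<Rightarrow> (('r, 'n) exterior list \<Rightarrow> 'm) \<Rightarrow> ('r, 'n) tensor \<Rightarrow> 'm"
  where "tensor_lift s f t = free_lift s f (rep_tensor t)"

lemma pure_tensor_multilinear:
  "multilinear tensor_scale (pure_tensor :: ('r::comm_ring_1, 'n) exterior list \<Rightarrow> ('r, 'n) tensor)"
proof -
  have "Poly_Mapping.single (as[j := a + b]) 1
      - (Poly_Mapping.single (as[j := a]) 1 + Poly_Mapping.single (as[j := b]) 1)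
      \<in> free.span tensor_relators" if "j < length as"
    for as :: "('r, 'n) exterior list" and j a b
    using that unfolding tensor_relators_def diff_diff_eq by (intro free.span_base UnI1) auto
  moreover have "Poly_Mapping.single (as[j := ext_scale r a]) 1
      - free_scale r (Poly_Mapping.single (as[j := a]) 1) \<in> free.span tensor_relators" if "j < length as"
    for as :: "('r, 'n) exterior list" and j r a
  proof -
    have "free_scale r (Poly_Mapping.single (as[j := a]) 1) = Poly_Mapping.single (as[j := a]) r"
      by (simp add: poly_mapping_eq_iff fun_eq_iff lookup_single when_def)
    with that show ?thesis
      unfolding tensor_relators_def by (intro free.span_base UnI2) auto
  qed
  ultimately show ?thesis
    unfolding multilinear_def
    by (simp add: pure_tensor.abs_eq plus_tensor.abs_eq tensor_scale.abs_eq tensor.abs_eq_iff)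
qed

context
  fixes s :: "'r::comm_ring_1 \<Rightarrow> 'm::ab_group_add \<Rightarrow> 'm"
  assumes s: "Modules.module s"
begin

interpretation M: Modules.module s by (fact s)

lemma free_lift_superset:
  assumes "finite X" "Poly_Mapping.keys p \<subseteq> X"
  shows "free_lift s f p = (\<Sum>x\<in>X. s (Poly_Mapping.lookup p x) (f x))"
  unfolding free_lift_def using assms
  by (intro sum.mono_neutral_left) (auto simp: in_keys_iff)

lemma module_hom_free_lift: "Modules.module_hom free_scale s (free_lift s f)"
proof unfold_locales
  fix p q :: "'a \<Rightarrow>\<^sub>0 'r" and r :: 'r
  let ?X = "Poly_Mapping.keys p \<union> Poly_Mapping.keys q"
  have "Poly_Mapping.keys (p + q) \<subseteq> ?X" by (rule keys_add)
  then show "free_lift s f (p + q) = free_lift s f p + free_lift s f q"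
    by (simp add: free_lift_superset[of ?X] lookup_add M.scale_left_distrib sum.distrib)
  have "Poly_Mapping.keys (free_scale r p) \<subseteq> Poly_Mapping.keys p"
    by (auto simp: in_keys_iff)
  then show "free_lift s f (free_scale r p) = s r (free_lift s f p)"
    by (simp add: free_lift_superset[of "Poly_Mapping.keys p"] M.scale_sum_right)
qed

lemma free_lift_single: "free_lift s f (Poly_Mapping.single x r) = s r (f x)"
  by (cases "r = 0") (simp_all add: free_lift_def)

lemma free_lift_relators:
  assumes f: "multilinear s f" and p: "p \<in> free.span tensor_relators"
  shows "free_lift s f p = 0"
proof -
  interpret L: Modules.module_hom free_scale s "free_lift s f" by (rule module_hom_free_lift)
  from p show ?thesis
  proof (induction rule: free.span_induct_alt)
    case base
    then show ?case by (simp add: L.zero)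
  next
    case (step c x y)
    then have "free_lift s f x = 0"
      using f unfolding tensor_relators_def multilinear_def
      by (auto simp: L.diff free_lift_single)
    with step show ?case by (simp add: L.add L.scale)
  qed
qed

lemma tensor_lift_abs:
  assumes "multilinear s f"
  shows "tensor_lift s f (abs_tensor p) = free_lift s f p"
proof -
  interpret L: Modules.module_hom free_scale s "free_lift s f" by (rule module_hom_free_lift)
  have "rep_tensor (abs_tensor p) - p \<in> free.span tensor_relators"
    by (rule Quotient3_rep_abs[OF Quotient3_tensor]) (simp add: free.span_zero)
  from free_lift_relators[OF assms this] show ?thesis
    by (simp add: tensor_lift_def L.diff)
qed

lemma module_hom_tensor_lift:
  assumes "multilinear s f"
  shows "Modules.module_hom tensor_scale s (tensor_lift s f)"
proof unfold_locales
  interpret L: Modules.module_hom free_scale s "free_lift s f" by (rule module_hom_free_lift)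
  fix x y :: "('r, 'a) tensor" and r :: 'r
  obtain p q where "x = abs_tensor p" "y = abs_tensor q"
    by (metis Quotient3_abs_rep[OF Quotient3_tensor])
  then show "tensor_lift s f (x + y) = tensor_lift s f x + tensor_lift s f y"
    and "tensor_lift s f (tensor_scale r x) = s r (tensor_lift s f x)"
    by (simp_all add: plus_tensor.abs_eq tensor_scale.abs_eq tensor_lift_abs[OF assms] L.add L.scale)
qed

lemma tensor_lift_pure: "multilinear s f \<Longrightarrow> tensor_lift s f (pure_tensor as) = f as"
  by (simp add: pure_tensor.abs_eq tensor_lift_abs free_lift_single)

end


section \<open>The bar resolution\<close>

text \<open>
  The exterior algebra is treated as an ordinary algebra: no signs depending on degrees occur. A
  list of length \<open>k + 2\<close> gives the \<open>k + 1\<close> summands of \<open>b\<^sub>k\<close>.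
\<close>

definition contract :: "nat \<Rightarrow> ('r::comm_ring_1, 'n::{finite,linorder}) exterior list \<Rightarrow> ('r, 'n) exterior list" where
  "contract i as = take i as @ (as ! i * as ! Suc i) # drop (i + 2) as"

definition bar_differential ::
  "('r::comm_ring_1, 'n::{finite,linorder}) tensor \<Rightarrow> ('r, 'n) tensor" where
  "bar_differential = tensor_lift tensor_scale
     (\<lambda>as. \<Sum>i < length as - 1. tensor_scale ((- 1) ^ i) (pure_tensor (contract i as)))"

definition bar_module :: "nat \<Rightarrow> ('r::comm_ring_1, 'n) tensor set" where
  "bar_module k = tensor_power (k + 2)"

text \<open>
  The enveloping algebra \<open>A\<^sup>e = A \<otimes> A\<^sup>o\<^sup>p\<close> has \<open>tensor_power 2\<close> as its underlying module. It acts by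
  \<open>(a \<otimes> b) (a\<^sub>0 \<otimes> \<dots> \<otimes> a\<^sub>m) = a a\<^sub>0 \<otimes> \<dots> \<otimes> a\<^sub>m b\<close> on tensors and by \<open>(a \<otimes> b) x = a x b\<close> on \<open>A\<close>.
\<close>

definition left_mult ::
  "('r::comm_ring_1, 'n::{finite,linorder}) exterior \<Rightarrow> ('r, 'n) exterior list \<Rightarrow> ('r, 'n) exterior list"
  where "left_mult a as = as[0 := a * as ! 0]"

definition right_mult ::
  "('r::comm_ring_1, 'n::{finite,linorder}) exterior list \<Rightarrow> ('r, 'n) exterior \<Rightarrow> ('r, 'n) exterior list"
  where "right_mult as b = as[length as - 1 := as ! (length as - 1) * b]"

definition enveloping_act_tensor ::
  "('r::comm_ring_1, 'n::{finite,linorder}) tensor \<Rightarrow> ('r, 'n) tensor \<Rightarrow> ('r, 'n) tensor" where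
  "enveloping_act_tensor u t = tensor_lift tensor_scale
     (\<lambda>us. tensor_lift tensor_scale
        (\<lambda>as. if length us = 2 \<and> as \<noteq> [] then pure_tensor (left_mult (us ! 0) (right_mult as (us ! 1))) else 0) t) u"

definition enveloping_act ::
  "('r::comm_ring_1, 'n::{finite,linorder}) tensor \<Rightarrow> ('r, 'n) exterior \<Rightarrow> ('r, 'n) exterior" where
  "enveloping_act u x =
     tensor_lift ext_scale (\<lambda>us. if length us = 2 then us ! 0 * x * us ! 1 else 0) u"

lemma length_contract: "Suc i < length as \<Longrightarrow> length (contract i as) = length as - 1"
  by (simp add: contract_def)

lemma nth_contract:
  assumes "Suc i < length as" "m < length as - 1"
  shows "contract i as ! m =
    (if m < i then as ! m else if m = i then as ! i * as ! Suc i else as ! Suc m)"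
proof -
  consider "m < i" | "m = i" | d where "m = Suc (i + d)"
    by (metis less_imp_Suc_add linorder_neqE_nat)
  then show ?thesis
    using assms by cases (simp_all add: contract_def nth_append)
qed

lemma contract_update:
  assumes "j < length as" "Suc i < length as"
  shows "contract i (as[j := x]) =
    (if j < i then (contract i as)[j := x]
     else if j = i then (contract i as)[i := x * as ! Suc i]
     else if j = Suc i then (contract i as)[i := as ! i * x]
     else (contract i as)[j - 1 := x])"
proof (rule nth_equalityI, goal_cases)
  case 1
  show ?case using assms by (simp add: length_contract)
next
  case (2 m)
  then have m: "m < length as - 1" using assms by (simp add: length_contract)
  have "j = Suc m \<longleftrightarrow> j - 1 = m" if "Suc i < j" using that by linarith
  then show ?case using assms m
    by (simp add: nth_contract length_contract nth_list_update)
qed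

lemma multilinear_contract:
  "multilinear tensor_scale
     (\<lambda>as :: ('r::comm_ring_1, 'n::{finite,linorder}) exterior list.
        \<Sum>i < length as - 1. tensor_scale ((- 1) ^ i) (pure_tensor (contract i as)))"
proof -
  note add = pure_tensor_multilinear[unfolded multilinear_def, rule_format, THEN conjunct1, rule_format]
  note scale = pure_tensor_multilinear[unfolded multilinear_def, rule_format, THEN conjunct2, rule_format]
  have 1: "pure_tensor (contract i (as[j := a + b])) =
      pure_tensor (contract i (as[j := a])) + pure_tensor (contract i (as[j := b]))"
    if "j < length as" "i < length as - 1" for i j a b and as :: "('r, 'n) exterior list"
  proof -
    have "Suc i < length as" using that by simp
    then show ?thesis using that
      by (simp add: contract_update length_contract add distrib_left distrib_right)
  qed
  have 2: "pure_tensor (contract i (as[j := ext_scale r a])) =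
      tensor_scale r (pure_tensor (contract i (as[j := a])))"
    if "j < length as" "i < length as - 1" for i j r a and as :: "('r, 'n) exterior list"
  proof -
    have "Suc i < length as" using that by simp
    then show ?thesis using that
      by (simp add: contract_update length_contract scale ext_scale_mult_left ext_scale_mult_right)
  qed
  show ?thesis
    unfolding multilinear_def
    by (auto simp: 1 2 tensor.scale_right_distrib sum.distrib tensor.scale_sum_right mult.commute
        intro!: sum.cong)
qed

lemmas module_hom_bar_differential =
  module_hom_tensor_lift[OF tensor.module_axioms multilinear_contract, folded bar_differential_def]

lemma bar_differential_pure:
  "bar_differential (pure_tensor as) =
     (\<Sum>i < length as - 1. tensor_scale ((- 1) ^ i) (pure_tensor (contract i as)))"
  unfolding bar_differential_def
  by (rule tensor_lift_pure[OF tensor.module_axioms multilinear_contract])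

lemma length_left_right_mult [simp]:
  "length (left_mult a as) = length as" "length (right_mult as b) = length as"
  by (simp_all add: left_mult_def right_mult_def)

lemma nth_left_mult: "m < length as \<Longrightarrow> left_mult a as ! m = (if m = 0 then a else 1) * as ! m"
  by (cases "m = 0") (simp_all add: left_mult_def)

lemma nth_right_mult:
  "m < length as \<Longrightarrow> right_mult as b ! m = as ! m * (if m = length as - 1 then b else 1)"
  by (cases "m = length as - 1") (simp_all add: right_mult_def)

lemma multilinear_left_right_mult:
  fixes us :: "('r::comm_ring_1, 'n::{finite,linorder}) exterior list"
  shows "multilinear tensor_scale
     (\<lambda>as. if length us = 2 \<and> as \<noteq> [] then pure_tensor (left_mult (us ! 0) (right_mult as (us ! 1))) else 0)"
proof -
  note add = pure_tensor_multilinear[unfolded multilinear_def, rule_format, THEN conjunct1, rule_format]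
  note scale = pure_tensor_multilinear[unfolded multilinear_def, rule_format, THEN conjunct2, rule_format]
  have upd: "left_mult a (right_mult (as[j := x]) b) = (left_mult a (right_mult as b))
      [j := (if j = 0 then a else 1) * x * (if j = length as - 1 then b else 1)]"
    if "j < length as" for a b x j and as :: "('r, 'n) exterior list"
  proof (rule nth_equalityI, goal_cases)
    case (2 m)
    then show ?case
      by (cases "m = j") (simp_all only: nth_left_mult nth_right_mult nth_list_update_eq
          nth_list_update_neq length_left_right_mult length_list_update mult.assoc not_False_eq_True)
  qed simp
  show ?thesis
    unfolding multilinear_def
    by (auto simp: upd add scale distrib_left distrib_right ext_scale_mult_left ext_scale_mult_right)
qed

lemma multilinear_enveloping_act_tensor:
  fixes t :: "('r::comm_ring_1, 'n::{finite,linorder}) tensor"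
  shows "multilinear tensor_scale
     (\<lambda>us. tensor_lift tensor_scale
        (\<lambda>as. if length us = 2 \<and> as \<noteq> [] then pure_tensor (left_mult (us ! 0) (right_mult as (us ! 1))) else 0) t)"
  (is "multilinear _ (\<lambda>us. tensor_lift _ (?f us) t)")
proof -
  note add = pure_tensor_multilinear[unfolded multilinear_def, rule_format, THEN conjunct1, rule_format]
  note scale = pure_tensor_multilinear[unfolded multilinear_def, rule_format, THEN conjunct2, rule_format]
  have lift_add: "tensor_lift tensor_scale (\<lambda>as. f as + g as) t
      = tensor_lift tensor_scale f t + tensor_lift tensor_scale g t"
    for f g :: "('r, 'n) exterior list \<Rightarrow> ('r, 'n) tensor"
    by (simp add: tensor_lift_def free_lift_def tensor.scale_right_distrib sum.distrib)
  have lift_scale: "tensor_lift tensor_scale (\<lambda>as. tensor_scale r (f as)) t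
      = tensor_scale r (tensor_lift tensor_scale f t)"
    for r and f :: "('r, 'n) exterior list \<Rightarrow> ('r, 'n) tensor"
    by (simp add: tensor_lift_def free_lift_def tensor.scale_sum_right mult.commute)
  have left: "left_mult a (right_mult as b) = (right_mult as b)[0 := a * right_mult as b ! 0]"
    for a b and as :: "('r, 'n) exterior list"
    by (simp add: left_mult_def)
  have right: "left_mult a (right_mult as b)
      = (left_mult a as)[length as - 1 := left_mult a as ! (length as - 1) * b]"
    if "as \<noteq> []" for a b and as :: "('r, 'n) exterior list"
  proof -
    have "left_mult a (right_mult as b) = right_mult (left_mult a as) b"
      by (rule nth_equalityI) (simp_all add: nth_left_mult nth_right_mult mult.assoc)
    then show ?thesis by (simp add: right_mult_def)
  qed
  have left_add: "pure_tensor (left_mult (a + a') (right_mult as b))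
      = pure_tensor (left_mult a (right_mult as b)) + pure_tensor (left_mult a' (right_mult as b))"
    and left_scale: "pure_tensor (left_mult (ext_scale r a) (right_mult as b))
      = tensor_scale r (pure_tensor (left_mult a (right_mult as b)))"
    and right_add: "pure_tensor (left_mult a (right_mult as (b + b')))
      = pure_tensor (left_mult a (right_mult as b)) + pure_tensor (left_mult a (right_mult as b'))"
    and right_scale: "pure_tensor (left_mult a (right_mult as (ext_scale r b)))
      = tensor_scale r (pure_tensor (left_mult a (right_mult as b)))"
    if "as \<noteq> []" for a a' b b' r and as :: "('r, 'n) exterior list"
  proof -
    have l: "0 < length as" "length as - 1 < length as" using that by auto
    show "pure_tensor (left_mult (a + a') (right_mult as b))
      = pure_tensor (left_mult a (right_mult as b)) + pure_tensor (left_mult a' (right_mult as b))"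
      using l(1) by (simp add: left add distrib_right)
    show "pure_tensor (left_mult (ext_scale r a) (right_mult as b))
      = tensor_scale r (pure_tensor (left_mult a (right_mult as b)))"
      using l(1) by (simp add: left scale ext_scale_mult_left)
    show "pure_tensor (left_mult a (right_mult as (b + b')))
      = pure_tensor (left_mult a (right_mult as b)) + pure_tensor (left_mult a (right_mult as b'))"
      using l(2) by (simp only: right[OF that] length_left_right_mult add distrib_left)
    show "pure_tensor (left_mult a (right_mult as (ext_scale r b)))
      = tensor_scale r (pure_tensor (left_mult a (right_mult as b)))"
      using l(2) by (simp only: right[OF that] length_left_right_mult scale ext_scale_mult_right)
  qed
  have slot_add: "?f (us[j := a + b]) = (\<lambda>as. ?f (us[j := a]) as + ?f (us[j := b]) as)"
    and slot_scale: "?f (us[j := ext_scale r a]) = (\<lambda>as. tensor_scale r (?f (us[j := a]) as))"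
    if "j < length us" for us j a b r
    using that
    by (auto simp: fun_eq_iff less_2_cases_iff left_add left_scale right_add right_scale)
  show ?thesis
    unfolding multilinear_def
  proof (intro allI impI conjI)
    fix us :: "('r, 'n) exterior list" and j r a b
    assume j: "j < length us"
    show "tensor_lift tensor_scale (?f (us[j := a + b])) t =
        tensor_lift tensor_scale (?f (us[j := a])) t + tensor_lift tensor_scale (?f (us[j := b])) t"
      unfolding slot_add[OF j] by (rule lift_add)
    show "tensor_lift tensor_scale (?f (us[j := ext_scale r a])) t =
        tensor_scale r (tensor_lift tensor_scale (?f (us[j := a])) t)"
      unfolding slot_scale[OF j] by (rule lift_scale)
  qed
qed

lemma enveloping_act_tensor_pure:
  assumes "as \<noteq> []"
  shows "enveloping_act_tensor (pure_tensor [a, b]) (pure_tensor as) = pure_tensor (left_mult a (right_mult as b))"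
  unfolding enveloping_act_tensor_def
  by (subst tensor_lift_pure[OF tensor.module_axioms multilinear_enveloping_act_tensor],
      subst tensor_lift_pure[OF tensor.module_axioms multilinear_left_right_mult])
    (simp add: assms)

lemma multilinear_enveloping_act:
  "multilinear ext_scale (\<lambda>us. if length us = 2 then us ! 0 * x * us ! 1 else 0)"
  unfolding multilinear_def
  by (auto simp: less_2_cases_iff distrib_left distrib_right ext_scale_mult_left ext_scale_mult_right)

lemma enveloping_act_pure: "enveloping_act (pure_tensor [a, b]) x = a * x * b"
  unfolding enveloping_act_def
  by (subst tensor_lift_pure[OF ext.module_axioms multilinear_enveloping_act]) simp


section \<open>Hochschild cohomology\<close>

type_synonym ('r, 'n) cochain = "('r, 'n) tensor \<Rightarrow> ('r, 'n) exterior"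

text \<open>
  \<open>Hom\<^bsub>A\<^sup>e\<^esub>(B\<^sub>k, A)\<close>; since the functions of the type are total, elements are required to
  vanish outside \<open>B\<^sub>k\<close>.
\<close>

definition cochains ::
  "nat \<Rightarrow> ('r::comm_ring_1, 'n::{finite,linorder}) cochain set" where
  "cochains k = {f.
     (\<forall>t \<in> bar_module k. \<forall>t' \<in> bar_module k. f (t + t') = f t + f t') \<and>
     (\<forall>u \<in> tensor_power 2. \<forall>t \<in> bar_module k. f (enveloping_act_tensor u t) = enveloping_act u (f t)) \<and>
     (\<forall>t. t \<notin> bar_module k \<longrightarrow> f t = 0)}"

definition coboundary ::
  "nat \<Rightarrow> ('r::comm_ring_1, 'n::{finite,linorder}) cochain \<Rightarrow> ('r, 'n) cochain" where
  "coboundary k f = (\<lambda>t. if t \<in> bar_module (Suc k) then f (bar_differential t) else 0)"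

definition cocycles ::
  "nat \<Rightarrow> ('r::comm_ring_1, 'n::{finite,linorder}) cochain set" where
  "cocycles k = {f \<in> cochains k. coboundary k f = (\<lambda>t. 0)}"

fun coboundaries ::
  "nat \<Rightarrow> ('r::comm_ring_1, 'n::{finite,linorder}) cochain set" where
  "coboundaries 0 = {\<lambda>t. 0}"
| "coboundaries (Suc k) = coboundary k ` cochains k"

definition cocycle_module ::
  "nat \<Rightarrow> ('r, ('r::comm_ring_1, 'n::{finite,linorder}) cochain) module" where
  "cocycle_module k =
     \<lparr>carrier = cocycles k, mult = undefined, one = undefined,
      zero = (\<lambda>t. 0), add = (\<lambda>f g t. f t + g t), smult = (\<lambda>r f t. ext_scale r (f t))\<rparr>"

definition quotient_module :: "('r, 'm) module \<Rightarrow> 'm set \<Rightarrow> ('r, 'm set) module" where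
  "quotient_module M N =
     \<lparr>carrier = a_rcosets\<^bsub>M\<^esub> N, mult = undefined, one = undefined,
      zero = N, add = (<+>\<^bsub>M\<^esub>), smult = (\<lambda>r C. \<Union>x\<in>C. N +>\<^bsub>M\<^esub> (r \<odot>\<^bsub>M\<^esub> x))\<rparr>"

definition HH ::
  "nat \<Rightarrow> ('r, ('r::comm_ring_1, 'n::{finite,linorder}) cochain set) module" where
  "HH k = quotient_module (cocycle_module k) (coboundaries k)"

end

theory Submission
  imports Defs "HOL-Combinatorics.Multiset_Permutations"
begin

text \<open>
  A cochain is determined by its values on lists of basis elements \<open>x\<^sub>\<sigma>\<close>. On these lists there is an
  acyclic matching whose critical cells are the weakly decreasing lists of generators; since merging
  neighbours only lowers the sorted word of a list, a cochain can be prescribed on the critical cells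
  and its coboundary on the matched targets. Summing a cochain over all words with a given content
  \<open>\<alpha>\<close> is a chain map to the Koszul complex of functions from multisets of generators to the algebra,
  because \<open>x\<^sub>i x\<^sub>j\<close> cancels against \<open>x\<^sub>j x\<^sub>i\<close>; words that are not weakly decreasing
  are targets of the matching, so this map is a quasi-isomorphism.

  In the coordinates \<open>(\<alpha>, \<tau>)\<close> the Koszul differential vanishes where \<open>|\<alpha>| + |\<tau>|\<close> is even and is
  twice the wedge product with \<open>\<Sum>\<^sub>i y\<^sub>i x\<^sub>i\<close> where it is odd. The latter complex is exact except at
  \<open>({#}, UNIV)\<close>: pairs are matched by moving the smallest element of \<open>\<alpha> \<union> - \<tau>\<close> into or out of
  both \<open>\<alpha>\<close> and \<open>\<tau>\<close>. So the even pairs, and \<open>({#}, UNIV)\<close> if it is odd, each contribute a free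
  summand, and each odd upper pair contributes a summand killed by \<open>2\<close>.
\<close>

section \<open>Hochschild cochains on basis elements\<close>

lemma ext_basis_empty [simp]: "ext_basis {} = (1 :: ('r::comm_ring_1, 'n::{finite,linorder}) exterior)"
  by (rule exterior_eqI) (auto simp: ext_basis.rep_eq one_exterior.rep_eq)

text \<open>
  Minus all summands of the coboundary of \<open>g\<close> except the left multiplication; the recursion on the
  list produces the alternating signs.
\<close>

fun tail_diff :: "('n set list \<Rightarrow> ('r, 'n) exterior) \<Rightarrow> 'n set list \<Rightarrow> ('r::comm_ring_1, 'n::{finite,linorder}) exterior" where
  "tail_diff g [] = 0"
| "tail_diff g [\<sigma>] = g [] * ext_basis \<sigma>"
| "tail_diff g (\<sigma> # \<tau> # R) =
     (if \<sigma> \<inter> \<tau> = {} then ext_scale (shuffle_sign \<sigma> \<tau>) (g ((\<sigma> \<union> \<tau>) # R)) else 0)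
     - tail_diff (\<lambda>L. g (\<sigma> # L)) (\<tau> # R)"

fun basis_diff :: "('n set list \<Rightarrow> ('r, 'n) exterior) \<Rightarrow> 'n set list \<Rightarrow> ('r::comm_ring_1, 'n::{finite,linorder}) exterior" where
  "basis_diff g [] = 0"
| "basis_diff g (\<sigma> # R) = ext_basis \<sigma> * g R - tail_diff g (\<sigma> # R)"

lemma tail_diff_add: "tail_diff (\<lambda>L. g L + h L) L = tail_diff g L + tail_diff h L"
  by (induction g L arbitrary: h rule: tail_diff.induct)
    (simp_all add: distrib_right ext.scale_right_distrib)

lemma tail_diff_scale: "tail_diff (\<lambda>L. ext_scale r (g L)) L = ext_scale r (tail_diff g L)"
  by (induction g L rule: tail_diff.induct)
    (simp_all add: ext_scale_mult_left ext.scale_right_diff_distrib mult.commute)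

lemma tail_diff_zero [simp]: "tail_diff (\<lambda>L. 0) L = 0"
  using tail_diff_scale[of 0 "\<lambda>L. 0" L] by simp

lemma basis_diff_add: "basis_diff (\<lambda>L. g L + h L) L = basis_diff g L + basis_diff h L"
  by (cases L) (simp_all add: tail_diff_add distrib_left)

lemma basis_diff_zero [simp]: "basis_diff (\<lambda>L. 0) L = 0"
  by (cases L) simp_all

lemma basis_diff_diff: "basis_diff (\<lambda>L. g L - h L) L = basis_diff g L - basis_diff h L"
  using basis_diff_add[of "\<lambda>L. g L - h L" h L] by simp

lemma tail_diff_cong:
  assumes "\<And>N. Suc (length N) = length L \<Longrightarrow> g N = h N"
  shows "tail_diff g L = tail_diff h L"
  using assms
proof (induction g L arbitrary: h rule: tail_diff.induct)
  case (3 g \<sigma> \<tau> R)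
  have "tail_diff (\<lambda>L. g (\<sigma> # L)) (\<tau> # R) = tail_diff (\<lambda>L. h (\<sigma> # L)) (\<tau> # R)"
    by (rule 3(1)) (auto intro!: 3(2))
  then show ?case using 3(2) by simp
qed auto

lemma basis_diff_cong:
  assumes "\<And>N. Suc (length N) = length L \<Longrightarrow> g N = h N"
  shows "basis_diff g L = basis_diff h L"
proof (cases L)
  case (Cons \<sigma> R)
  with assms have "g R = h R" by simp
  moreover have "tail_diff g L = tail_diff h L" using assms by (rule tail_diff_cong)
  ultimately show ?thesis using Cons by simp
qed simp

section \<open>An acyclic matching\<close>

datatype cell_kind = Critical | Source | Target

fun odd_run :: "'n set list \<Rightarrow> bool" where
  "odd_run [] = False"
| "odd_run (\<sigma> # R) = (\<sigma> = {} \<and> \<not> odd_run R)"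

text \<open>
  The first argument of \<open>cell\<close> is the last entry of the weakly decreasing prefix of singletons read
  so far. The first set \<open>\<sigma>\<close> that does not extend this prefix decides: a source is matched with the
  target in which \<open>\<sigma>\<close> is split into its minimum and the rest, and a target arises in this way if the
  prefix ends below \<open>Min \<sigma>\<close>. A run of empty sets is a source or a target according to its parity.
\<close>

fun cell :: "'n::{finite,linorder} option \<Rightarrow> 'n set list \<Rightarrow> cell_kind" where
  "cell p [] = Critical"
| "cell p (\<sigma> # R) =
     (if \<sigma> = {} then (if odd_run R then Target else Source)
      else if (case p of None \<Rightarrow> False | Some i \<Rightarrow> i < Min \<sigma>) then Target
      else if \<sigma> = {Min \<sigma>} then cell (Some (Min \<sigma>)) R
      else Source)"

fun partner :: "'n::{finite,linorder} set list \<Rightarrow> 'n set list" where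
  "partner [] = []"
| "partner (\<sigma> # R) =
     (if \<sigma> = {} then {} # {} # R
      else if \<sigma> = {Min \<sigma>} then \<sigma> # partner R
      else {Min \<sigma>} # (\<sigma> - {Min \<sigma>}) # R)"

definition sorted_word :: "'n::{finite,linorder} set list \<Rightarrow> 'n list" where
  "sorted_word L = concat (map sorted_list_of_set L)"

lemma sorted_word_simps [simp]:
  "sorted_word [] = []"
  "sorted_word (\<sigma> # R) = sorted_list_of_set \<sigma> @ sorted_word R"
  by (simp_all add: sorted_word_def)

definition smaller_word :: "('n::{finite,linorder} set list \<times> 'n set list) set" where
  "smaller_word = inv_image (lenlex {(i, j). i < j}) sorted_word"

lemma wf_smaller_word: "wf smaller_word"
proof -
  have "wf {(i, j :: 'n::{finite,linorder}). i < j}"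
    by (rule wf_subset[OF wf_measure[of "\<lambda>i. card {..<i}"]]) (auto intro!: psubset_card_mono)
  then show ?thesis
    unfolding smaller_word_def by (intro wf_inv_image wf_lenlex)
qed

lemma smaller_word_Cons: "(\<sigma> # M, \<sigma> # N) \<in> smaller_word \<longleftrightarrow> (M, N) \<in> smaller_word"
  by (simp add: smaller_word_def irrefl_def)

lemma length_smaller_word: "length (sorted_word M) < length (sorted_word N) \<Longrightarrow> (M, N) \<in> smaller_word"
  by (simp add: smaller_word_def lenlex_conv)

lemma smaller_word_Min:
  assumes "\<sigma> \<noteq> {}" "\<tau> \<noteq> {}" "Min \<sigma> < Min \<tau>"
    and "length (sorted_word (\<sigma> # M)) = length (sorted_word (\<tau> # N))"
  shows "(\<sigma> # M, \<tau> # N) \<in> smaller_word"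
proof -
  have *: "sorted_list_of_set \<rho> = Min \<rho> # sorted_list_of_set (\<rho> - {Min \<rho>})" if "\<rho> \<noteq> {}" for \<rho> :: "'a set"
    using that by (intro sorted_list_of_set_nonempty) auto
  show ?thesis
    using assms *[OF assms(1)] *[OF assms(2)]
    by (simp add: smaller_word_def Cons_lenlex_iff)
qed

lemma length_partner: "cell p L = Source \<Longrightarrow> length (partner L) = Suc (length L)"
  by (induction L arbitrary: p) (auto split: if_splits)

lemma length_word_partner: "length (sorted_word (partner L)) = length (sorted_word L)"
proof (induction L)
  case (Cons \<sigma> R)
  have "card (\<sigma> - {Min \<sigma>}) + 1 = card \<sigma>" if "\<sigma> \<noteq> {}"
    using that Min_in[of \<sigma>] card_Diff_singleton[of "Min \<sigma>" \<sigma>] card_gt_0_iff[of \<sigma>] by auto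
  with Cons show ?case by auto
qed simp

lemma cell_partner: "cell p L = Source \<Longrightarrow> cell p (partner L) = Target"
proof (induction L arbitrary: p)
  case (Cons \<sigma> R)
  have "Min \<sigma> < Min (\<sigma> - {Min \<sigma>})" "\<sigma> - {Min \<sigma>} \<noteq> {}" if "\<sigma> \<noteq> {}" "\<sigma> \<noteq> {Min \<sigma>}"
  proof -
    show ne: "\<sigma> - {Min \<sigma>} \<noteq> {}" using that by auto
    have "Min (\<sigma> - {Min \<sigma>}) \<in> \<sigma> - {Min \<sigma>}" using ne by (intro Min_in) auto
    then show "Min \<sigma> < Min (\<sigma> - {Min \<sigma>})"
      using Min_le[of \<sigma> "Min (\<sigma> - {Min \<sigma>})"] by (auto simp: order_less_le)
  qed
  with Cons show ?case by (auto split: if_splits option.splits)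
qed simp

lemma Target_cases:
  assumes "cell p M = Target"
  shows "(\<exists>L. cell p L = Source \<and> M = partner L) \<or>
    (\<exists>i \<sigma> R. p = Some i \<and> M = \<sigma> # R \<and> \<sigma> \<noteq> {} \<and> i < Min \<sigma>)"
  using assms
proof (induction M arbitrary: p)
  case (Cons \<sigma> R)
  show ?case
  proof (cases "\<sigma> = {}")
    case True
    with Cons.prems have "odd_run R" by (auto split: if_splits)
    then obtain R' where "R = {} # R'" "\<not> odd_run R'" by (cases R) auto
    with True show ?thesis by (intro disjI1 exI[of _ "{} # R'"]) auto
  next
    case nonempty: False
    show ?thesis
    proof (cases "case p of None \<Rightarrow> False | Some i \<Rightarrow> i < Min \<sigma>")
      case True
      with nonempty show ?thesis by (auto split: option.splits)
    next
      case p: False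
      with nonempty Cons.prems have single: "\<sigma> = {Min \<sigma>}" and R: "cell (Some (Min \<sigma>)) R = Target"
        by (auto split: if_splits)
      from Cons.IH[OF R] show ?thesis
      proof (elim disjE exE conjE)
        fix L assume "cell (Some (Min \<sigma>)) L = Source" "R = partner L"
        with nonempty p single show ?thesis by (intro disjI1 exI[of _ "\<sigma> # L"]) auto
      next
        fix i \<tau> R' assume *: "Some (Min \<sigma>) = Some i" "R = \<tau> # R'" "\<tau> \<noteq> {}" "i < Min \<tau>"
        have fin: "finite \<tau>" by simp
        have Min: "Min (insert i \<tau>) = i" using * by (intro Min_eqI) (auto simp: Min_gr_iff[OF fin] less_imp_le)
        moreover have "insert i \<tau> - {i} = \<tau>" "insert i \<tau> \<noteq> {i}"
          using * fin Min_le[OF fin] by (auto simp: subset_singleton_iff)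
        moreover have \<sigma>: "\<sigma> = {i}" using * single by simp
        moreover have "\<not> (case p of None \<Rightarrow> False | Some j \<Rightarrow> j < i)" using p \<sigma> by (cases p) auto
        ultimately have "cell p (insert i \<tau> # R') = Source" "partner (insert i \<tau> # R') = \<sigma> # R"
          using *(2) by (cases p; simp del: Min_gr_iff Min_insert)+
        then show ?thesis by metis
      qed
    qed
  qed
qed simp

lemma Target_partner: "cell None M = Target \<Longrightarrow> \<exists>L. cell None L = Source \<and> M = partner L"
  using Target_cases[of None M] by simp

lemma tail_diff_no_odd_run:
  assumes "\<not> odd_run R" "\<And>N. \<not> odd_run N \<Longrightarrow> g N = 0"
  shows "tail_diff g R = 0"
proof (use assms in \<open>induction "length R" arbitrary: R g rule: less_induct\<close>)
  case less
  consider "R = []" | \<tau> R' where "R = \<tau> # R'" "\<tau> \<noteq> {}" | R' where "R = {} # {} # R'" "\<not> odd_run R'"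
    using less(2) by (cases R; cases "tl R") auto
  then show ?case
  proof cases
    case (2 \<tau> R')
    then have "(\<lambda>N. g (\<tau> # N)) = (\<lambda>N. 0)" using less(3) by auto
    with 2 less(3) show ?thesis by (cases R') auto
  next
    case (3 R')
    have "tail_diff (\<lambda>N. g ({} # {} # N)) R' = 0"
      using 3 by (intro less(1)) (auto intro: less(3))
    then show ?thesis using 3 by (cases R') auto
  qed simp
qed

text \<open>
  Every face of \<open>partner L\<close> other than \<open>L\<close> is not a source or has a smaller sorted word. If \<open>L\<close>
  contains a run of empty sets, then \<open>L\<close> occurs as a face several times, with alternating signs that
  add up to a unit.
\<close>

lemma tail_diff_partner:
  assumes "cell p L = Source" "hd L \<noteq> {}"
  shows "\<exists>\<epsilon>\<in>{1, - 1}. \<forall>g. (\<forall>N. cell p N \<noteq> Source \<or> (N, L) \<in> smaller_word \<longrightarrow> g N = 0) \<longrightarrow>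
    tail_diff g (partner L) = ext_scale \<epsilon> (g L :: ('r::comm_ring_1, 'n::{finite,linorder}) exterior)"
  using assms
proof (induction L arbitrary: p)
  case (Cons \<sigma> R)
  then have ne: "\<sigma> \<noteq> {}" by simp
  with Cons.prems have p: "\<not> (case p of None \<Rightarrow> False | Some i \<Rightarrow> i < Min \<sigma>)" by (auto split: if_splits)
  show ?case
  proof (cases "\<sigma> = {Min \<sigma>}")
    case True
    define i where "i = Min \<sigma>"
    have \<sigma>: "\<sigma> = {i}" using True by (simp add: i_def)
    have R: "cell (Some i) R = Source" using Cons.prems ne p True i_def by simp
    have cellR: "cell p (\<sigma> # N) = cell (Some i) N" for N using ne p True i_def by simp
    show ?thesis
    proof (cases "hd R = {}")
      case hd: True
      from R obtain R' where R': "R = {} # R'" using hd by (cases R) auto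
      with R have odd: "\<not> odd_run R'" by (auto split: if_splits)
      show ?thesis
      proof (intro bexI[of _ 1] allI impI)
        fix g :: "'n set list \<Rightarrow> ('r, 'n) exterior"
        assume g: "\<forall>N. cell p N \<noteq> Source \<or> (N, \<sigma> # R) \<in> smaller_word \<longrightarrow> g N = 0"
        have "tail_diff (\<lambda>N. g (\<sigma> # {} # {} # N)) R' = 0"
          by (rule tail_diff_no_odd_run[OF odd]) (use g cellR in auto)
        then have "tail_diff (\<lambda>N. g (\<sigma> # N)) ({} # R) = 0"
          by (cases R') (simp_all add: R')
        then show "tail_diff g (partner (\<sigma> # R)) = ext_scale 1 (g (\<sigma> # R))"
          by (simp add: \<sigma> R')
      qed simp
    next
      case hd: False
      from Cons.IH[OF R hd] obtain \<epsilon> :: 'r where \<epsilon>: "\<epsilon> \<in> {1, - 1}" and IH: "\<And>g :: 'n set list \<Rightarrow> ('r, 'n) exterior.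
        (\<forall>N. cell (Some i) N \<noteq> Source \<or> (N, R) \<in> smaller_word \<longrightarrow> g N = 0) \<Longrightarrow>
          tail_diff g (partner R) = ext_scale \<epsilon> (g R)" by blast
      show ?thesis
      proof (intro bexI[of _ "- \<epsilon>"] allI impI)
        fix g :: "'n set list \<Rightarrow> ('r, 'n) exterior"
        assume g: "\<forall>N. cell p N \<noteq> Source \<or> (N, \<sigma> # R) \<in> smaller_word \<longrightarrow> g N = 0"
        from R hd obtain \<tau> R1 where R1: "R = \<tau> # R1" "\<tau> \<noteq> {}" by (cases R) auto
        have "Min \<tau> \<le> i"
        proof (rule ccontr)
          assume "\<not> Min \<tau> \<le> i"
          then have "i < Min \<tau>" by (simp only: not_le)
          then have "cell (Some i) R = Target" using R1 by (simp del: Min_gr_iff)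
          with R show False by simp
        qed
        obtain R2 where R2: "partner R = {Min \<tau>} # R2"
          using R1 by (cases "\<tau> = {Min \<tau>}") auto
        have merge: "(if \<sigma> \<inter> {Min \<tau>} = {} then ext_scale (shuffle_sign \<sigma> {Min \<tau>}) (g ((\<sigma> \<union> {Min \<tau>}) # R2)) else 0) = 0"
        proof (cases "i = Min \<tau>")
          case False
          with \<open>Min \<tau> \<le> i\<close> have less: "Min \<tau> < i" by simp
          then have Min: "Min (\<sigma> \<union> {Min \<tau>}) = Min \<tau>" by (simp add: \<sigma> min_absorb1 min_absorb2 less_imp_le)
          have "length (sorted_word R) = Suc (length (sorted_word R2))"
            using length_word_partner[of R] R2 by simp
          then have "((\<sigma> \<union> {Min \<tau>}) # R2, \<sigma> # R) \<in> smaller_word"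
            using less Min \<sigma> by (intro smaller_word_Min) (auto simp: card_insert_if)
          with g show ?thesis by auto
        qed (simp add: \<sigma>)
        have "tail_diff (\<lambda>N. g (\<sigma> # N)) (partner R) = ext_scale \<epsilon> (g (\<sigma> # R))"
          by (rule IH) (use g cellR smaller_word_Cons in metis)
        then show "tail_diff g (partner (\<sigma> # R)) = ext_scale (- \<epsilon>) (g (\<sigma> # R))"
          using merge ne True by (simp add: R2)
      qed (use \<epsilon> in auto)
    qed
  next
    case False
    define i where "i = Min \<sigma>"
    define \<tau> where "\<tau> = \<sigma> - {i}"
    have i: "i \<in> \<sigma>" using ne by (simp add: i_def)
    have \<tau>: "\<tau> \<noteq> {}" using False ne by (auto simp: i_def \<tau>_def)
    have less: "i < Min \<tau>"
      using \<tau> ne by (subst Min_gr_iff) (auto simp: \<tau>_def i_def order_less_le)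
    have un: "{i} \<inter> \<tau> = {}" "{i} \<union> \<tau> = \<sigma>" using i by (auto simp: \<tau>_def)
    have "{(a, b). a \<in> {i} \<and> b \<in> \<tau> \<and> b < a} = {}"
      using less by (auto simp: Min_gr_iff[OF _ \<tau>])
    then have sgn: "shuffle_sign {i} \<tau> = (1 :: 'r)" by (simp only: shuffle_sign_def) simp
    have pi: "\<not> (case p of None \<Rightarrow> False | Some j \<Rightarrow> j < i)" unfolding i_def by (rule p)
    show ?thesis
    proof (intro bexI[of _ 1] allI impI)
      fix g :: "'n set list \<Rightarrow> ('r, 'n) exterior"
      assume g: "\<forall>N. cell p N \<noteq> Source \<or> (N, \<sigma> # R) \<in> smaller_word \<longrightarrow> g N = 0"
      have g\<tau>: "(\<lambda>N. g ({i} # \<tau> # N)) = (\<lambda>N. 0)"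
        using g \<tau> less pi by auto
      have "tail_diff (\<lambda>N. g ({i} # N)) (\<tau> # R) = 0"
      proof (cases R)
        case Nil
        have "g [{i}] = 0" using g pi by auto
        with Nil show ?thesis by simp
      next
        case (Cons \<rho> R')
        have "g ({i} # (\<tau> \<union> \<rho>) # R') = 0" if "\<tau> \<inter> \<rho> = {}"
        proof (cases "\<rho> = {} \<or> i < Min \<rho>")
          case True
          then have "i < Min (\<tau> \<union> \<rho>)" using less \<tau> by (cases "\<rho> = {}") (auto simp: Min_Un simp del: Min_gr_iff)
          then show ?thesis using g \<tau> pi by auto
        next
          case False
          then have "Min \<rho> < Min \<tau>" using less by (metis not_le le_less_trans)
          then have Min_less: "Min (\<tau> \<union> \<rho>) < Min \<tau>"
            using \<tau> False by (subst Min_Un) (simp_all add: min_less_iff_disj del: Min_gr_iff Min_less_iff)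
          have "sorted_list_of_set \<sigma> = i # sorted_list_of_set \<tau>"
            unfolding i_def \<tau>_def by (intro sorted_list_of_set_nonempty) (use ne in auto)
          moreover have "((\<tau> \<union> \<rho>) # R', \<tau> # R) \<in> smaller_word"
            using \<tau> Min_less that Cons by (intro smaller_word_Min) (auto simp: card_Un_disjoint)
          ultimately have "({i} # (\<tau> \<union> \<rho>) # R', \<sigma> # R) \<in> smaller_word"
            by (simp add: smaller_word_def Cons_lenlex_iff)
          then show ?thesis using g by blast
        qed
        with Cons g\<tau> show ?thesis by simp
      qed
      then show "tail_diff g (partner (\<sigma> # R)) = ext_scale 1 (g (\<sigma> # R))"
        using ne False un sgn by (simp add: i_def \<tau>_def)
    qed simp
  qed
qed simp

lemma basis_diff_partner:
  assumes L: "cell None L = Source"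
  shows "\<exists>\<epsilon>\<in>{1, - 1}. \<forall>g. (\<forall>N. cell None N \<noteq> Source \<or> (N, L) \<in> smaller_word \<longrightarrow> g N = 0) \<longrightarrow>
    basis_diff g (partner L) = ext_scale \<epsilon> (g L :: ('r::comm_ring_1, 'n::{finite,linorder}) exterior)"
proof (cases "hd L = {}")
  case True
  with L obtain R where R: "L = {} # R" "\<not> odd_run R" by (cases L) (auto split: if_splits)
  have "tail_diff g ({} # {} # R) = 0"
    if g: "\<forall>N. cell None N \<noteq> Source \<or> (N, L) \<in> smaller_word \<longrightarrow> g N = 0" for g :: "'n set list \<Rightarrow> ('r, 'n) exterior"
  proof -
    have "tail_diff (\<lambda>N. g ({} # {} # N)) R = 0"
      by (rule tail_diff_no_odd_run[OF R(2)]) (use g in simp)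
    then show ?thesis by (cases R) simp_all
  qed
  with R show ?thesis by (intro bexI[of _ 1]) (auto)
next
  case False
  from tail_diff_partner[OF L False] obtain \<epsilon> :: 'r where \<epsilon>: "\<epsilon> \<in> {1, - 1}"
    and tail: "\<And>g :: 'n set list \<Rightarrow> ('r, 'n) exterior.
      (\<forall>N. cell None N \<noteq> Source \<or> (N, L) \<in> smaller_word \<longrightarrow> g N = 0) \<Longrightarrow>
        tail_diff g (partner L) = ext_scale \<epsilon> (g L)" by blast
  show ?thesis
  proof (intro bexI[of _ "- \<epsilon>"] allI impI)
    fix g :: "'n set list \<Rightarrow> ('r, 'n) exterior"
    assume g: "\<forall>N. cell None N \<noteq> Source \<or> (N, L) \<in> smaller_word \<longrightarrow> g N = 0"
    obtain i R where R: "partner L = {i} # R"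
      using L False by (cases L) (auto, metis)
    have "length (sorted_word R) < length (sorted_word L)"
      using length_word_partner[of L] R by simp
    then have "g R = 0" using g length_smaller_word by blast
    with tail[OF g] show "basis_diff g (partner L) = ext_scale (- \<epsilon>) (g L)"
      by (simp add: R)
  qed (use \<epsilon> in auto)
qed

lemma basis_cochain_zero:
  fixes f :: "'n::{finite,linorder} set list \<Rightarrow> ('r::comm_ring_1, 'n) exterior"
  assumes "\<And>L. cell None L \<noteq> Source \<Longrightarrow> f L = 0" "\<And>M. cell None M = Target \<Longrightarrow> basis_diff f M = 0"
  shows "f = (\<lambda>L. 0)"
proof
  fix L
  show "f L = 0"
  proof (induction L rule: wf_induct_rule[OF wf_smaller_word])
    case (1 L)
    show ?case
    proof (cases "cell None L = Source")
      case True
      from basis_diff_partner[OF True] obtain \<epsilon> :: 'r where \<epsilon>: "\<epsilon> \<in> {1, - 1}"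
        "basis_diff f (partner L) = ext_scale \<epsilon> (f L)" using 1 assms(1) by metis
      with assms(2)[OF cell_partner[OF True]] show ?thesis by auto
    qed (rule assms(1))
  qed
qed

lemma basis_cochain_exists:
  fixes c u :: "'n::{finite,linorder} set list \<Rightarrow> ('r::comm_ring_1, 'n) exterior"
  shows "\<exists>g. (\<forall>L. length L \<noteq> k \<longrightarrow> g L = 0) \<and>
    (\<forall>L. length L = k \<longrightarrow> cell None L = Critical \<longrightarrow> g L = c L) \<and>
    (\<forall>L. cell None L = Target \<longrightarrow> g L = 0) \<and>
    (\<forall>M. length M = Suc k \<longrightarrow> cell None M = Target \<longrightarrow> basis_diff g M = u M)"
proof -
  define \<epsilon> :: "'n set list \<Rightarrow> 'r" where "\<epsilon> L = (SOME \<epsilon>. \<epsilon> \<in> {1, - 1} \<and>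
    (\<forall>g. (\<forall>N. cell None N \<noteq> Source \<or> (N, L) \<in> smaller_word \<longrightarrow> g N = 0) \<longrightarrow>
    basis_diff g (partner L) = ext_scale \<epsilon> (g L :: ('r, 'n) exterior)))" for L
  have \<epsilon>: "\<epsilon> L \<in> {1, - 1} \<and> (\<forall>g. (\<forall>N. cell None N \<noteq> Source \<or> (N, L) \<in> smaller_word \<longrightarrow> g N = 0) \<longrightarrow>
    basis_diff g (partner L) = ext_scale (\<epsilon> L) (g L :: ('r, 'n) exterior))" if "cell None L = Source" for L
    unfolding \<epsilon>_def by (rule someI_ex) (use basis_diff_partner[OF that] in blast)
  define known where "known \<phi> L N = (if cell None N = Source then if (N, L) \<in> smaller_word then \<phi> N else 0
    else if cell None N = Critical \<and> length N = k then c N else 0)" for \<phi> L N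
  define F where "F \<phi> L = (if length L = k then ext_scale (\<epsilon> L) (u (partner L) - basis_diff (known \<phi> L) (partner L)) else 0)" for \<phi> L
  define h where "h = wfrec smaller_word F"
  have h: "h L = F h L" for L
  proof -
    have "known (cut h smaller_word L) L = known h L"
      by (auto simp: known_def cut_def)
    then show ?thesis
      unfolding h_def by (subst wfrec[OF wf_smaller_word]) (simp add: F_def)
  qed
  define g where "g N = (if length N \<noteq> k then 0 else if cell None N = Source then h N
    else if cell None N = Critical then c N else 0)" for N
  have h0: "h N = 0" if "length N \<noteq> k" for N using that h[of N] by (simp add: F_def)
  have diff: "basis_diff g (partner L) = u (partner L)" if L: "cell None L = Source" "length L = k" for L
  proof -
    define r where "r N = g N - known h L N" for N
    have "\<forall>N. cell None N \<noteq> Source \<or> (N, L) \<in> smaller_word \<longrightarrow> r N = 0"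
      using h0 by (auto simp: r_def g_def known_def)
    with \<epsilon>[OF L(1)] have 1: "basis_diff r (partner L) = ext_scale (\<epsilon> L) (r L)" by blast
    have irr: "(L, L) \<notin> smaller_word" using wf_smaller_word by (rule wf_not_refl)
    have "r L = h L" using L irr by (simp add: r_def g_def known_def)
    also have "\<dots> = ext_scale (\<epsilon> L) (u (partner L) - basis_diff (known h L) (partner L))"
      using h[of L] L by (simp add: F_def)
    finally have "basis_diff r (partner L) = u (partner L) - basis_diff (known h L) (partner L)"
      using \<epsilon>[OF L(1)] 1 by auto
    moreover have "basis_diff g (partner L) = basis_diff (\<lambda>N. r N + known h L N) (partner L)"
      by (simp add: r_def)
    ultimately show ?thesis by (simp add: basis_diff_add)
  qed
  have "basis_diff g M = u M" if M: "length M = Suc k" "cell None M = Target" for M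
  proof -
    obtain L where L: "cell None L = Source" "M = partner L" using Target_partner[OF M(2)] by blast
    with M length_partner[OF L(1)] diff[OF L(1)] show ?thesis by simp
  qed
  then show ?thesis by (intro exI[of _ g]) (auto simp: g_def)
qed

section \<open>Cochains are determined on basis elements\<close>

fun bar_sum :: "('a::ring_1 list \<Rightarrow> 'm::ab_group_add) \<Rightarrow> 'a list \<Rightarrow> 'm" where
  "bar_sum F [] = 0"
| "bar_sum F [a] = 0"
| "bar_sum F (a # b # R) = F ((a * b) # R) - bar_sum (\<lambda>as. F (a # as)) (b # R)"

lemma bar_sum_cong:
  assumes "\<And>N. Suc (length N) = length as \<Longrightarrow> F N = G N"
  shows "bar_sum F as = bar_sum G as"
  using assms
proof (induction F as arbitrary: G rule: bar_sum.induct)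
  case (3 F a b R)
  have "bar_sum (\<lambda>as. F (a # as)) (b # R) = bar_sum (\<lambda>as. G (a # as)) (b # R)"
    by (rule 3(1)) (auto intro!: 3(2))
  then show ?case using 3(2) by simp
qed auto

lemma bar_sum_diff: "bar_sum (\<lambda>as. F as - G as) as = bar_sum F as - bar_sum G as"
  by (induction F as arbitrary: G rule: bar_sum.induct) simp_all

lemma bar_sum_left_mult:
  "bar_sum (\<lambda>N. F ((a * hd N) # tl N)) (b # R) = bar_sum F ((a * b) # R)"
  by (cases R) (simp_all add: mult.assoc)

lemma bar_sum_bar_sum:
  fixes F :: "'a::ring_1 list \<Rightarrow> 'm::ab_group_add"
  shows "bar_sum (bar_sum F) as = 0"
proof (induction F as rule: bar_sum.induct)
  case (3 F a b R)
  show ?case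
  proof (cases "R = []")
    case False
    have "bar_sum (\<lambda>as. bar_sum F (a # as)) (b # R) =
        bar_sum (\<lambda>N. F ((a * hd N) # tl N) - bar_sum (\<lambda>as. F (a # as)) N) (b # R)"
    proof (rule bar_sum_cong)
      fix N :: "'a list" assume "Suc (length N) = length (b # R)"
      with False obtain n N' where "N = n # N'" by (cases N) auto
      then show "bar_sum F (a # N) = F ((a * hd N) # tl N) - bar_sum (\<lambda>as. F (a # as)) N" by simp
    qed
    also have "\<dots> = bar_sum F ((a * b) # R)"
      by (simp only: bar_sum_diff bar_sum_left_mult 3) simp
    finally show ?thesis by simp
  qed simp
qed simp_all

lemma bar_sum_hom:
  assumes "\<And>x y. x \<in> S \<Longrightarrow> y \<in> S \<Longrightarrow> x - y \<in> S \<and> h (x - y) = h x - h y" "0 \<in> S" "h 0 = 0"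
    and "\<And>N. Suc (length N) = length as \<Longrightarrow> F N \<in> S"
  shows "bar_sum F as \<in> S \<and> h (bar_sum F as) = bar_sum (\<lambda>N. h (F N)) as"
  using assms(4)
proof (induction F as rule: bar_sum.induct)
  case (3 F a b R)
  then have "F ((a * b) # R) \<in> S" by simp
  with 3 assms(1) show ?case by simp
qed (simp_all add: assms)

lemma bar_differential_pure_sum: "bar_differential (pure_tensor as) = bar_sum pure_tensor as"
proof -
  have "(\<Sum>i < length as - 1. tensor_scale ((- 1) ^ i) (F (contract i as))) = bar_sum F as"
    for F :: "('r::comm_ring_1, 'n::{finite,linorder}) exterior list \<Rightarrow> ('r, 'n) tensor" and as
  proof (induction F as rule: bar_sum.induct)
    case (3 F a b R)
    have "contract (Suc i) (a # b # R) = a # contract i (b # R)" for i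
      by (simp add: contract_def)
    moreover have "contract 0 (a # b # R) = (a * b) # R" by (simp add: contract_def)
    ultimately show ?case using 3 by (simp add: sum.lessThan_Suc_shift sum_negf del: sum.lessThan_Suc)
  qed simp_all
  then show ?thesis by (simp add: bar_differential_pure)
qed

lemma pure_tensor_in_bar_module: "length as = k + 2 \<Longrightarrow> pure_tensor as \<in> bar_module k"
  unfolding bar_module_def tensor_power_def by (intro tensor.span_base) auto

lemma bar_module_subspace: "tensor.subspace (bar_module k)"
  unfolding bar_module_def tensor_power_def by (rule tensor.subspace_span)

lemmas bar_module_0 = tensor.subspace_0[OF bar_module_subspace]
  and bar_module_add = tensor.subspace_add[OF bar_module_subspace]
  and bar_module_diff = tensor.subspace_diff[OF bar_module_subspace]
  and bar_module_scale = tensor.subspace_scale[OF bar_module_subspace]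

lemma bar_module_induct [consumes 1, case_names zero step]:
  assumes "t \<in> bar_module k" "P 0"
    and "\<And>r as t. length as = k + 2 \<Longrightarrow> t \<in> bar_module k \<Longrightarrow> P t \<Longrightarrow> P (tensor_scale r (pure_tensor as) + t)"
  shows "P t"
proof -
  have "P t \<and> t \<in> bar_module k"
    using assms(1)[unfolded bar_module_def tensor_power_def]
  proof (induction rule: tensor.span_induct_alt)
    case (step r x t)
    then obtain as where "x = pure_tensor as" "length as = k + 2" by auto
    with step assms(3) show ?case
      by (auto intro!: bar_module_add bar_module_scale pure_tensor_in_bar_module)
  qed (simp add: assms bar_module_0)
  then show ?thesis ..
qed

lemmas bar_differential_linear =
  module_hom.add[OF module_hom_bar_differential] module_hom.scale[OF module_hom_bar_differential]
  module_hom.zero[OF module_hom_bar_differential] module_hom.diff[OF module_hom_bar_differential]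

lemma bar_differential_in_bar_module:
  assumes "t \<in> bar_module (Suc k)"
  shows "bar_differential t \<in> bar_module k"
  using assms
proof (induction rule: bar_module_induct)
  case (step r as t)
  have "bar_sum pure_tensor as \<in> bar_module k \<and> id (bar_sum pure_tensor as) = bar_sum (\<lambda>N. id (pure_tensor N)) as"
    using step(1) by (intro bar_sum_hom) (auto intro!: bar_module_diff bar_module_0 pure_tensor_in_bar_module)
  with step show ?case
    by (auto simp: bar_differential_linear bar_differential_pure_sum intro!: bar_module_add bar_module_scale)
qed (simp add: bar_differential_linear bar_module_0)

lemma bar_differential_bar_differential:
  assumes "t \<in> bar_module k"
  shows "bar_differential (bar_differential t) = 0"
  using assms
proof (induction rule: bar_module_induct)
  case (step r as t)
  have "bar_differential (bar_sum pure_tensor as) = bar_sum (\<lambda>N. bar_differential (pure_tensor N)) as"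
    using bar_sum_hom[of UNIV bar_differential as pure_tensor] by (simp add: bar_differential_linear)
  then have "bar_differential (bar_differential (pure_tensor as)) = 0"
    by (simp add: bar_differential_pure_sum bar_sum_bar_sum)
  with step show ?case by (simp add: bar_differential_linear)
qed (simp add: bar_differential_linear)

lemmas enveloping_act_tensor_linear_left =
  module_hom.add[OF module_hom_tensor_lift[OF tensor.module_axioms multilinear_enveloping_act_tensor],
      folded enveloping_act_tensor_def]
  module_hom.scale[OF module_hom_tensor_lift[OF tensor.module_axioms multilinear_enveloping_act_tensor],
      folded enveloping_act_tensor_def]
  module_hom.zero[OF module_hom_tensor_lift[OF tensor.module_axioms multilinear_enveloping_act_tensor],
      folded enveloping_act_tensor_def]

lemmas enveloping_act_linear_left =
  module_hom.add[OF module_hom_tensor_lift[OF ext.module_axioms multilinear_enveloping_act],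
      folded enveloping_act_def]
  module_hom.scale[OF module_hom_tensor_lift[OF ext.module_axioms multilinear_enveloping_act],
      folded enveloping_act_def]
  module_hom.zero[OF module_hom_tensor_lift[OF ext.module_axioms multilinear_enveloping_act],
      folded enveloping_act_def]

lemma enveloping_act_tensor_linear_right:
  "enveloping_act_tensor u (t + t') = enveloping_act_tensor u t + enveloping_act_tensor u t'"
  "enveloping_act_tensor u (tensor_scale r t) = tensor_scale r (enveloping_act_tensor u t)"
  "enveloping_act_tensor u 0 = 0"
proof -
  note hom = module_hom_tensor_lift[OF tensor.module_axioms multilinear_left_right_mult]
  show "enveloping_act_tensor u (t + t') = enveloping_act_tensor u t + enveloping_act_tensor u t'"
    "enveloping_act_tensor u (tensor_scale r t) = tensor_scale r (enveloping_act_tensor u t)"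
    "enveloping_act_tensor u 0 = 0"
    unfolding enveloping_act_tensor_def
    by (simp_all add: tensor_lift_def[of tensor_scale _ u] free_lift_def module_hom.add[OF hom]
        module_hom.scale[OF hom] module_hom.zero[OF hom] tensor.scale_right_distrib sum.distrib
        tensor.scale_sum_right mult.commute)
qed

lemma enveloping_act_linear_right:
  "enveloping_act u (x + y) = enveloping_act u x + enveloping_act u y"
  "enveloping_act u (ext_scale r x) = ext_scale r (enveloping_act u x)"
  "enveloping_act u 0 = 0"
proof -
  let ?f = "\<lambda>x us. if length us = 2 then us ! 0 * x * us ! 1 else 0"
  have "?f (x + y) us = ?f x us + ?f y us" "?f (ext_scale r x) us = ext_scale r (?f x us)" "?f 0 us = 0" for us
    by (simp_all add: distrib_left distrib_right ext_scale_mult_left ext_scale_mult_right)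
  then show "enveloping_act u (x + y) = enveloping_act u x + enveloping_act u y"
    "enveloping_act u (ext_scale r x) = ext_scale r (enveloping_act u x)"
    "enveloping_act u 0 = 0"
    by (simp_all only: enveloping_act_def tensor_lift_def free_lift_def ext.scale_right_distrib
        sum.distrib ext.scale_sum_right ext.scale_scale mult.commute[of r] ext.scale_zero_right sum.neutral_const)
qed

lemma enveloping_act_tensor_in_bar_module:
  assumes "u \<in> tensor_power 2" "t \<in> bar_module k"
  shows "enveloping_act_tensor u t \<in> bar_module k"
  using assms(1)[unfolded tensor_power_def]
proof (induction rule: tensor.span_induct_alt)
  case (step c x y)
  then obtain a b where x: "x = pure_tensor [a, b]"
    by (auto simp: length_Suc_conv numeral_2_eq_2)
  have "enveloping_act_tensor x t \<in> bar_module k"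
    using assms(2)
  proof (induction rule: bar_module_induct)
    case (step r as t)
    then show ?case
      unfolding x enveloping_act_tensor_linear_right
      by (subst enveloping_act_tensor_pure)
        (auto intro!: bar_module_add bar_module_scale pure_tensor_in_bar_module)
  qed (simp add: enveloping_act_tensor_linear_right bar_module_0)
  with step(2) show ?case
    by (simp add: enveloping_act_tensor_linear_left bar_module_add bar_module_scale)
qed (simp add: enveloping_act_tensor_linear_left bar_module_0)

lemma cochains_iff:
  fixes f :: "('r::comm_ring_1, 'n::{finite,linorder}) cochain"
  shows "f \<in> cochains k \<longleftrightarrow>
    (\<forall>t\<in>bar_module k. \<forall>t'\<in>bar_module k. f (t + t') = f t + f t') \<and>
    (\<forall>r. \<forall>t\<in>bar_module k. f (tensor_scale r t) = ext_scale r (f t)) \<and>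
    (\<forall>a b as. length as = k + 2 \<longrightarrow>
       f (pure_tensor (left_mult a (right_mult as b))) = a * f (pure_tensor as) * b) \<and>
    (\<forall>t. t \<notin> bar_module k \<longrightarrow> f t = 0)"
  (is "_ \<longleftrightarrow> ?add \<and> ?scale \<and> ?mult \<and> ?zero")
proof (intro iffI conjI)
  assume f: "f \<in> cochains k"
  then show ?add ?zero by (auto simp: cochains_def)
  have pure: "pure_tensor [a, b] \<in> tensor_power 2" for a b :: "('r, 'n) exterior"
    unfolding tensor_power_def by (intro tensor.span_base) auto
  have act: "f (enveloping_act_tensor (pure_tensor [a, b]) t) = a * f t * b" if "t \<in> bar_module k" for a b t
    using f pure that by (auto simp: cochains_def enveloping_act_pure)
  show ?mult
  proof (intro allI impI)
    fix a b and as :: "('r, 'n) exterior list" assume as: "length as = k + 2"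
    then have "as \<noteq> []" by auto
    with act[OF pure_tensor_in_bar_module[OF as]]
    show "f (pure_tensor (left_mult a (right_mult as b))) = a * f (pure_tensor as) * b"
      by (simp add: enveloping_act_tensor_pure)
  qed
  show ?scale
  proof (intro allI ballI)
    fix r and t :: "('r, 'n) tensor" assume t: "t \<in> bar_module k"
    then have "enveloping_act_tensor (pure_tensor [ext_scale r 1, 1]) t = tensor_scale r t"
    proof (induction rule: bar_module_induct)
      case (step r' as t)
      then have "as \<noteq> []" by auto
      moreover have "left_mult (ext_scale r 1) (right_mult as 1) = as[0 := ext_scale r (as ! 0)]"
        using \<open>as \<noteq> []\<close> by (simp add: left_mult_def right_mult_def ext_scale_mult_left)
      ultimately have "enveloping_act_tensor (pure_tensor [ext_scale r 1, 1]) (pure_tensor as) = tensor_scale r (pure_tensor as)"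
        using pure_tensor_multilinear[unfolded multilinear_def, rule_format, of 0 as, THEN conjunct2, rule_format, of r "as ! 0"]
        by (simp add: enveloping_act_tensor_pure)
      with step show ?case
        by (simp add: enveloping_act_tensor_linear_right tensor.scale_right_distrib mult.commute)
    qed (simp add: enveloping_act_tensor_linear_right)
    with act[OF t, of "ext_scale r 1" 1] show "f (tensor_scale r t) = ext_scale r (f t)"
      by (simp add: ext_scale_mult_left)
  qed
next
  assume f: "?add \<and> ?scale \<and> ?mult \<and> ?zero"
  then have f0: "f 0 = 0" using bar_module_0[of k] by (metis add_cancel_right_right)
  have "f (enveloping_act_tensor u t) = enveloping_act u (f t) \<and> u \<in> tensor_power 2"
    if "u \<in> tensor_power 2" and t: "t \<in> bar_module k" for u t
    using that(1)[unfolded tensor_power_def]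
  proof (induction rule: tensor.span_induct_alt)
    case base
    show ?case
      by (simp add: enveloping_act_tensor_linear_left enveloping_act_linear_left f0 tensor_power_def tensor.span_zero)
  next
    case (step c x y)
    then obtain a b where x: "x = pure_tensor [a, b]"
      by (auto simp: length_Suc_conv numeral_2_eq_2)
    have xy: "x \<in> tensor_power 2" "y \<in> tensor_power 2"
      using step(1,2) by (simp_all add: tensor_power_def tensor.span_base)
    have "f (enveloping_act_tensor x t) = enveloping_act x (f t)"
      using t
    proof (induction rule: bar_module_induct)
      case (step r as t)
      then have "as \<noteq> []" by auto
      then have as: "f (enveloping_act_tensor x (pure_tensor as)) = enveloping_act x (f (pure_tensor as))"
        using f step(1) by (simp add: x enveloping_act_tensor_pure enveloping_act_pure)
      have "enveloping_act_tensor x (pure_tensor as) \<in> bar_module k" "enveloping_act_tensor x t \<in> bar_module k"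
        using step xy by (auto intro!: enveloping_act_tensor_in_bar_module pure_tensor_in_bar_module)
      then show ?case
        using f step as pure_tensor_in_bar_module[OF step(1)]
        by (simp add: enveloping_act_tensor_linear_right enveloping_act_linear_right bar_module_scale)
    qed (simp add: enveloping_act_tensor_linear_right enveloping_act_linear_right f0)
    moreover have "enveloping_act_tensor x t \<in> bar_module k" "enveloping_act_tensor y t \<in> bar_module k"
      using t xy by (auto intro!: enveloping_act_tensor_in_bar_module)
    moreover have "tensor_scale c x + y \<in> tensor_power 2"
      using xy unfolding tensor_power_def by (intro tensor.span_add tensor.span_scale)
    ultimately show ?case
      using f step by (simp add: enveloping_act_tensor_linear_left enveloping_act_linear_left bar_module_scale)
  qed
  with f show "f \<in> cochains k" by (simp add: cochains_def)
qed

lemma multilinear_Cons: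
  fixes f :: "('r::comm_ring_1, 'n) exterior list \<Rightarrow> 'm::ab_group_add"
  assumes "multilinear s f"
  shows "multilinear s (\<lambda>as. f (a # as))"
  unfolding multilinear_def
proof (intro allI impI)
  fix as :: "('r, 'n) exterior list" and j assume "j < length as"
  then show "(\<forall>x y. f (a # as[j := x + y]) = f (a # as[j := x]) + f (a # as[j := y])) \<and>
      (\<forall>r x. f (a # as[j := ext_scale r x]) = s r (f (a # as[j := x])))"
    using assms[unfolded multilinear_def, rule_format, of "Suc j" "a # as"] by simp
qed

lemma multilinear_head:
  assumes "multilinear s f"
  shows "f ((a + b) # as) = f (a # as) + f (b # as)" "f (ext_scale r a # as) = s r (f (a # as))"
  using assms[unfolded multilinear_def, rule_format, of 0 "a # as"] by simp_all

lemma multilinear_head_0: "multilinear s f \<Longrightarrow> f (0 # as) = (0 :: 'm::ab_group_add)"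
  using multilinear_head(1)[of s f 0 0 as] by simp

lemma multilinear_eq_0:
  fixes f :: "('r::comm_ring_1, 'n::finite) exterior list \<Rightarrow> 'm::ab_group_add"
  assumes "Modules.module s" "multilinear s f" "\<And>L. length L = length as \<Longrightarrow> f (map ext_basis L) = 0"
  shows "f as = 0"
  using assms(2,3)
proof (induction as arbitrary: f)
  case Nil
  from Nil(2)[of "[]"] show ?case by simp
next
  case (Cons a as)
  interpret Modules.module s by (rule assms(1))
  have sum: "f ((\<Sum>\<sigma>\<in>S. ext_scale (c \<sigma>) (ext_basis \<sigma>)) # as) = (\<Sum>\<sigma>\<in>S. s (c \<sigma>) (f (ext_basis \<sigma> # as)))"
    if "finite S" for S and c :: "'n set \<Rightarrow> 'r"
    using that by induction
      (simp_all add: multilinear_head[OF Cons.prems(1)] multilinear_head_0[OF Cons.prems(1)])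
  have "f (ext_basis \<sigma> # as) = 0" for \<sigma>
  proof (rule Cons.IH[OF multilinear_Cons[OF Cons.prems(1)]])
    fix L :: "'n set list" assume "length L = length as"
    then show "f (ext_basis \<sigma> # map ext_basis L) = 0" using Cons.prems(2)[of "\<sigma> # L"] by simp
  qed
  with sum[of UNIV "ext_coeff a"] show ?case by (simp flip: ext_expansion)
qed

fun basis_extend :: "('n::finite set list \<Rightarrow> ('r, 'n) exterior) \<Rightarrow> ('r::comm_ring_1, 'n) exterior list \<Rightarrow> ('r, 'n) exterior" where
  "basis_extend g [] = g []"
| "basis_extend g (a # as) = (\<Sum>\<sigma>\<in>UNIV. ext_scale (ext_coeff a \<sigma>) (basis_extend (\<lambda>L. g (\<sigma> # L)) as))"

lemma multilinear_basis_extend: "multilinear ext_scale (basis_extend g)"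
  unfolding multilinear_def
proof (intro allI impI)
  fix as :: "('a, 'b) exterior list" and j assume "j < length as"
  then show "(\<forall>x y. basis_extend g (as[j := x + y]) = basis_extend g (as[j := x]) + basis_extend g (as[j := y])) \<and>
      (\<forall>r x. basis_extend g (as[j := ext_scale r x]) = ext_scale r (basis_extend g (as[j := x])))"
  proof (induction as arbitrary: g j)
    case (Cons a as)
    then show ?case
      by (cases j) (simp_all add: plus_exterior.rep_eq ext_scale.rep_eq ext.scale_left_distrib
          ext.scale_right_distrib sum.distrib ext.scale_sum_right mult.commute)
  qed simp
qed

lemma basis_extend_basis: "basis_extend g (map ext_basis L) = g L"
proof (induction L arbitrary: g)
  case (Cons \<sigma> L)
  have "ext_scale (ext_coeff (ext_basis \<sigma>) \<tau>) (g (\<tau> # L)) = (if \<tau> = \<sigma> then g (\<sigma> # L) else 0)" for \<tau>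
    by (simp add: ext_basis.rep_eq)
  with Cons show ?case by simp
qed simp

definition on_basis :: "nat \<Rightarrow> ('r::comm_ring_1, 'n::{finite,linorder}) cochain \<Rightarrow> 'n set list \<Rightarrow> ('r, 'n) exterior" where
  "on_basis k f L = (if length L = k then f (pure_tensor (1 # map ext_basis L @ [1])) else 0)"

lemma multilinear_cochain:
  assumes "f \<in> cochains k"
  shows "multilinear ext_scale (\<lambda>as. if length as = k + 2 then f (pure_tensor as) else 0)"
  unfolding multilinear_def
proof (intro allI impI)
  fix as :: "('a, 'b) exterior list" and j assume "j < length as"
  note pure = pure_tensor_multilinear[unfolded multilinear_def, rule_format, OF this]
  let ?f = "\<lambda>as. if length as = k + 2 then f (pure_tensor as) else 0"
  show "(\<forall>x y. ?f (as[j := x + y]) = ?f (as[j := x]) + ?f (as[j := y])) \<and>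
      (\<forall>r x. ?f (as[j := ext_scale r x]) = ext_scale r (?f (as[j := x])))"
    using assms by (simp add: pure cochains_iff pure_tensor_in_bar_module)
qed

lemma cochain_0:
  assumes "f \<in> cochains k"
  shows "f 0 = 0"
proof -
  have "f (0 + 0) = f 0 + f 0"
    using assms bar_module_0 unfolding cochains_iff by blast
  then show ?thesis by simp
qed

lemma cochain_diff:
  assumes "f \<in> cochains k" "t \<in> bar_module k" "t' \<in> bar_module k"
  shows "f (t - t') = f t - f t'"
proof -
  have "f ((t - t') + t') = f (t - t') + f t'"
    using assms bar_module_diff unfolding cochains_iff by blast
  then show ?thesis by simp
qed

lemma cochain_pure_mult:
  assumes "f \<in> cochains k" "length as = k"
  shows "f (pure_tensor (a # as @ [b])) = a * f (pure_tensor (1 # as @ [1])) * b"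
proof -
  have "left_mult a (right_mult (1 # as @ [1]) b) = a # as @ [b]"
    by (simp add: left_mult_def right_mult_def nth_append list_update_append)
  moreover have "f (pure_tensor (left_mult a (right_mult (1 # as @ [1]) b))) = a * f (pure_tensor (1 # as @ [1])) * b"
    using assms by (simp add: cochains_iff)
  ultimately show ?thesis by simp
qed

lemma cochain_eq_0:
  assumes f: "f \<in> cochains k" and "on_basis k f = (\<lambda>L. 0)"
  shows "f = (\<lambda>t. 0)"
proof
  fix t
  have pure: "f (pure_tensor as) = 0" if as: "length as = k + 2" for as
  proof -
    have "(if length as = k + 2 then f (pure_tensor as) else 0) = 0"
    proof (rule multilinear_eq_0[OF ext.module_axioms multilinear_cochain[OF f]])
      fix L :: "'b set list" assume L: "length L = length as"
      with as obtain \<sigma> M \<tau> where M: "L = \<sigma> # M @ [\<tau>]"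
        by (metis Suc_length_conv add_2_eq_Suc' length_Suc_conv_rev)
      then have "length M = k" using L as by simp
      then show "(if length (map ext_basis L :: ('a, 'b) exterior list) = k + 2 then f (pure_tensor (map ext_basis L)) else 0) = 0"
        using fun_cong[OF assms(2), of M] cochain_pure_mult[OF f, of "map ext_basis M" "ext_basis \<sigma>" "ext_basis \<tau>"]
        by (simp add: M on_basis_def)
    qed
    with as show ?thesis by simp
  qed
  have "f t = 0" if "t \<in> bar_module k" for t
    using that
  proof (induction rule: bar_module_induct)
    case (step r as t)
    then show ?case
      using f pure by (auto simp: cochains_iff bar_module_scale pure_tensor_in_bar_module)
  qed (simp add: cochain_0[OF f])
  then show "f t = 0" using f by (cases "t \<in> bar_module k") (auto simp: cochains_iff)
qed

lemma on_basis_surj: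
  fixes g :: "'n::{finite,linorder} set list \<Rightarrow> ('r::comm_ring_1, 'n) exterior"
  assumes g: "\<And>L. length L \<noteq> k \<Longrightarrow> g L = 0"
  shows "\<exists>f\<in>cochains k. on_basis k f = g"
proof -
  define G where "G as = (if length as = k + 2 then hd as * basis_extend g (butlast (tl as)) * last as else 0)" for as
  have "multilinear ext_scale G"
    unfolding multilinear_def
  proof (intro allI impI)
    fix as :: "('r, 'n) exterior list" and j assume j: "j < length as"
    note ext = multilinear_basis_extend[of g, unfolded multilinear_def, rule_format]
    show "(\<forall>x y. G (as[j := x + y]) = G (as[j := x]) + G (as[j := y])) \<and>
        (\<forall>r x. G (as[j := ext_scale r x]) = ext_scale r (G (as[j := x])))"
    proof (cases "length as = k + 2")
      case True
      then obtain x M y where as: "as = x # M @ [y]"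
        by (metis Suc_length_conv add_2_eq_Suc' length_Suc_conv_rev)
      with True have M: "length M = k" by simp
      then have G: "G (x # N @ [y]) = x * basis_extend g N * y" if "length N = length M" for x N y
        using that by (simp add: G_def)
      consider "j = 0" | "j = Suc k" | i where "j = Suc i" "i < k" using True j by (cases j) force+
      then show ?thesis
        by cases (simp_all add: as M G ext list_update_append distrib_left distrib_right
            ext_scale_mult_left ext_scale_mult_right)
    qed (simp add: G_def)
  qed
  note hom = module_hom_tensor_lift[OF ext.module_axioms this]
    and pure = tensor_lift_pure[OF ext.module_axioms this]
  define f where "f t = (if t \<in> bar_module k then tensor_lift ext_scale G t else 0)" for t
  have "f \<in> cochains k"
    unfolding cochains_iff
  proof (intro conjI ballI allI impI)
    fix a b and as :: "('r, 'n) exterior list" assume as: "length as = k + 2"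
    then obtain x M y where M: "as = x # M @ [y]"
      by (metis Suc_length_conv add_2_eq_Suc' length_Suc_conv_rev)
    have "left_mult a (right_mult as b) = (a * x) # M @ [y * b]"
      by (simp add: M left_mult_def right_mult_def nth_append list_update_append)
    then show "f (pure_tensor (left_mult a (right_mult as b))) = a * f (pure_tensor as) * b"
      using as by (simp add: M f_def pure pure_tensor_in_bar_module G_def mult.assoc)
  qed (simp_all add: f_def bar_module_add bar_module_scale module_hom.add[OF hom] module_hom.scale[OF hom])
  moreover have "on_basis k f = g"
    using g by (auto simp: fun_eq_iff on_basis_def f_def pure pure_tensor_in_bar_module G_def basis_extend_basis)
  ultimately show ?thesis by blast
qed

lemma bar_sum_left_right_mult:
  assumes "2 \<le> length as"
  shows "bar_sum F (left_mult a (right_mult as b)) = bar_sum (\<lambda>N. F (left_mult a (right_mult N b))) as"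
proof -
  have left: "bar_sum G (left_mult a bs) = bar_sum (\<lambda>N. G (left_mult a N)) bs" if "2 \<le> length bs"
    for G :: "('a, 'b) exterior list \<Rightarrow> 'c" and bs
  proof -
    from that obtain x y R where "bs = x # y # R" by (cases bs; cases "tl bs") auto
    then show ?thesis by (simp add: left_mult_def mult.assoc)
  qed
  have right: "bar_sum G (right_mult (bs @ [y]) b) = bar_sum (\<lambda>N. G (right_mult N b)) (bs @ [y])" if "bs \<noteq> []"
    for G :: "('a, 'b) exterior list \<Rightarrow> 'c" and bs y
    using that
  proof (induction bs arbitrary: G rule: induct_list012)
    case (2 x)
    show ?case by (simp add: right_mult_def mult.assoc)
  next
    case (3 x z R)
    have "bar_sum (\<lambda>as. G (x # as)) (right_mult ((z # R) @ [y]) b)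
        = bar_sum (\<lambda>N. G (right_mult (x # N) b)) ((z # R) @ [y])"
      unfolding 3(2)[of "\<lambda>as. G (x # as)", simplified, unfolded append_Cons[symmetric]]
      by (rule bar_sum_cong) (auto simp: right_mult_def neq_Nil_conv)
    then show ?case by (simp add: right_mult_def nth_append list_update_append)
  qed simp
  obtain bs y where "as = bs @ [y]"
    using assms by (cases as rule: rev_cases) auto
  moreover from this assms have "bs \<noteq> []" by auto
  ultimately show ?thesis
    using left[of "right_mult as b" F] right[of bs "\<lambda>N. F (left_mult a N)" y] assms by simp
qed

lemma coboundary_pure:
  assumes f: "f \<in> cochains k" and as: "length as = Suc k + 2"
  shows "coboundary k f (pure_tensor as) = bar_sum (\<lambda>N. f (pure_tensor N)) as"
proof -
  have "f (bar_sum pure_tensor as) = bar_sum (\<lambda>N. f (pure_tensor N)) as"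
    using as bar_sum_hom[of "bar_module k" f as pure_tensor]
    by (auto simp: bar_module_diff cochain_diff[OF f] bar_module_0 cochain_0[OF f] pure_tensor_in_bar_module)
  with as show ?thesis
    by (simp add: coboundary_def pure_tensor_in_bar_module bar_differential_pure_sum)
qed

lemma coboundary_in_cochains:
  assumes f: "f \<in> cochains k"
  shows "coboundary k f \<in> cochains (Suc k)"
  unfolding cochains_iff
proof (intro conjI ballI allI impI)
  fix a b and as :: "('a, 'b) exterior list" assume as: "length as = Suc k + 2"
  let ?F = "\<lambda>N. f (pure_tensor N)"
  have "coboundary k f (pure_tensor (left_mult a (right_mult as b))) = bar_sum (\<lambda>N. ?F (left_mult a (right_mult N b))) as"
    using as by (simp only: coboundary_pure[OF f] length_left_right_mult bar_sum_left_right_mult)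
  also have "\<dots> = bar_sum (\<lambda>N. a * ?F N * b) as"
    using as f by (intro bar_sum_cong) (auto simp: cochains_iff)
  also have "\<dots> = a * bar_sum ?F as * b"
    using bar_sum_hom[of UNIV "\<lambda>x. a * x * b" as ?F] by (simp add: algebra_simps)
  finally show "coboundary k f (pure_tensor (left_mult a (right_mult as b))) = a * coboundary k f (pure_tensor as) * b"
    using as by (simp only: coboundary_pure[OF f])
qed (use f in \<open>simp_all add: coboundary_def bar_module_add bar_module_scale bar_differential_linear
      bar_differential_in_bar_module cochains_iff\<close>)

lemma coboundary_coboundary: "f \<in> cochains k \<Longrightarrow> coboundary (Suc k) (coboundary k f) = (\<lambda>t. 0)"
  by (auto simp: fun_eq_iff coboundary_def bar_differential_in_bar_module bar_differential_bar_differential cochain_0)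

lemma on_basis_coboundary:
  assumes f: "f \<in> cochains k"
  shows "on_basis (Suc k) (coboundary k f) = basis_diff (on_basis k f)"
proof
  fix L :: "'b set list"
  have tail: "bar_sum H (map ext_basis L @ [1]) = tail_diff g L"
    if "multilinear ext_scale H" "\<And>L a. H (map ext_basis L @ [a]) = g L * a" "L \<noteq> []"
    for H :: "('a, 'b) exterior list \<Rightarrow> ('a, 'b) exterior" and g L
    using that
  proof (induction g L arbitrary: H rule: tail_diff.induct)
    case (2 g \<sigma>)
    from 2(2)[of "[]"] show ?case by simp
  next
    case (3 g \<sigma> \<tau> R)
    have "bar_sum (\<lambda>as. H (ext_basis \<sigma> # as)) (map ext_basis (\<tau> # R) @ [1]) = tail_diff (\<lambda>L. g (\<sigma> # L)) (\<tau> # R)"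
      using 3(3)[of "\<sigma> # _"] by (intro 3(1) multilinear_Cons 3(2)) simp_all
    moreover have "H ((ext_basis \<sigma> * ext_basis \<tau>) # map ext_basis R @ [1]) =
        (if \<sigma> \<inter> \<tau> = {} then ext_scale (shuffle_sign \<sigma> \<tau>) (g ((\<sigma> \<union> \<tau>) # R)) else 0)"
      using 3(3)[of "(\<sigma> \<union> \<tau>) # R" 1]
      by (simp add: ext_basis_mult multilinear_head[OF 3(2)] multilinear_head_0[OF 3(2)])
    ultimately show ?case by simp
  qed simp
  show "on_basis (Suc k) (coboundary k f) L = basis_diff (on_basis k f) L"
  proof (cases "length L = Suc k")
    case True
    then obtain \<sigma> R where L: "L = \<sigma> # R" by (cases L) auto
    define F where "F as = (if length as = k + 2 then f (pure_tensor as) else 0)" for as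
    have F: "multilinear ext_scale F" unfolding F_def by (rule multilinear_cochain[OF f])
    have F1: "F (1 # map ext_basis M @ [a]) = on_basis k f M * a" for M a
      using cochain_pure_mult[OF f, of "map ext_basis M" 1 a] by (simp add: F_def on_basis_def)
    have "on_basis (Suc k) (coboundary k f) L = bar_sum F (1 # map ext_basis L @ [1])"
    proof -
      have "on_basis (Suc k) (coboundary k f) L = bar_sum (\<lambda>N. f (pure_tensor N)) (1 # map ext_basis L @ [1])"
        using True coboundary_pure[OF f, of "1 # map ext_basis L @ [1]"] by (simp add: on_basis_def)
      also have "\<dots> = bar_sum F (1 # map ext_basis L @ [1])"
        using True by (intro bar_sum_cong) (simp add: F_def)
      finally show ?thesis .
    qed
    also have "\<dots> = F (ext_basis \<sigma> # map ext_basis R @ [1]) - bar_sum (\<lambda>as. F (1 # as)) (map ext_basis L @ [1])"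
      by (simp add: L)
    also have "bar_sum (\<lambda>as. F (1 # as)) (map ext_basis L @ [1]) = tail_diff (on_basis k f) L"
      by (intro tail multilinear_Cons F F1) (simp add: L)
    also have "F (ext_basis \<sigma> # map ext_basis R @ [1]) = ext_basis \<sigma> * on_basis k f R"
      using True cochain_pure_mult[OF f, of "map ext_basis R" "ext_basis \<sigma>" 1] by (simp add: L F_def on_basis_def)
    finally show ?thesis by (simp add: L)
  next
    case False
    then have "basis_diff (on_basis k f) L = basis_diff (\<lambda>L. 0) L"
      by (intro basis_diff_cong) (auto simp: on_basis_def)
    with False show ?thesis by (simp add: on_basis_def)
  qed
qed

section \<open>Comparison with the Koszul complex\<close>

definition symmetrize :: "('n set list \<Rightarrow> ('r, 'n) exterior) \<Rightarrow> 'n multiset \<Rightarrow> ('r::comm_ring_1, 'n) exterior" where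
  "symmetrize g \<alpha> = (\<Sum>w\<in>permutations_of_multiset \<alpha>. g (map (\<lambda>i. {i}) w))"

definition koszul_diff :: "('n multiset \<Rightarrow> ('r, 'n) exterior) \<Rightarrow> 'n multiset \<Rightarrow> ('r::comm_ring_1, 'n::{finite,linorder}) exterior" where
  "koszul_diff c \<alpha> = (\<Sum>i\<in>set_mset \<alpha>. ext_gen i * c (\<alpha> - {#i#}) + (- 1) ^ size \<alpha> * (c (\<alpha> - {#i#}) * ext_gen i))"

lemma symmetrize_add: "symmetrize (\<lambda>L. g L + h L) \<alpha> = symmetrize g \<alpha> + symmetrize h \<alpha>"
  by (simp add: symmetrize_def sum.distrib)

lemma symmetrize_diff: "symmetrize (\<lambda>L. g L - h L) \<alpha> = symmetrize g \<alpha> - symmetrize h \<alpha>"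
  by (simp add: symmetrize_def sum_subtractf)

lemma symmetrize_scale: "symmetrize (\<lambda>L. ext_scale r (g L)) \<alpha> = ext_scale r (symmetrize g \<alpha>)"
  by (simp add: symmetrize_def ext.scale_sum_right)

lemma symmetrize_off_degree: "(\<And>L. length L \<noteq> k \<Longrightarrow> g L = 0) \<Longrightarrow> size \<alpha> \<noteq> k \<Longrightarrow> symmetrize g \<alpha> = 0"
  unfolding symmetrize_def by (rule sum.neutral) (auto simp: permutations_of_multiset_def)

lemma koszul_diff_off_degree: "(\<And>\<alpha>. size \<alpha> \<noteq> k \<Longrightarrow> c \<alpha> = 0) \<Longrightarrow> size \<alpha> \<noteq> Suc k \<Longrightarrow> koszul_diff c \<alpha> = 0"
  unfolding koszul_diff_def by (rule sum.neutral) (auto dest!: multi_member_split)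

lemma sum_permutations_of_multiset:
  assumes "\<alpha> \<noteq> {#}"
  shows "(\<Sum>w\<in>permutations_of_multiset \<alpha>. h w) =
    (\<Sum>i\<in>set_mset \<alpha>. \<Sum>w\<in>permutations_of_multiset (\<alpha> - {#i#}). h (i # w))"
proof -
  have "(\<Sum>w\<in>permutations_of_multiset \<alpha>. h w) = (\<Sum>i\<in>set_mset \<alpha>. sum h ((#) i ` permutations_of_multiset (\<alpha> - {#i#})))"
    unfolding permutations_of_multiset_nonempty[OF assms] by (rule sum.UNION_disjoint) auto
  also have "\<dots> = (\<Sum>i\<in>set_mset \<alpha>. \<Sum>w\<in>permutations_of_multiset (\<alpha> - {#i#}). h (i # w))"
    by (rule sum.cong[OF refl], subst sum.reindex) auto
  finally show ?thesis .
qed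

lemma symmetrize_nonempty:
  "\<alpha> \<noteq> {#} \<Longrightarrow> symmetrize g \<alpha> = (\<Sum>i\<in>set_mset \<alpha>. symmetrize (\<lambda>L. g ({i} # L)) (\<alpha> - {#i#}))"
  by (simp add: symmetrize_def sum_permutations_of_multiset)

lemma sum_pairs_swap:
  "(\<Sum>i\<in>set_mset \<alpha>. \<Sum>j\<in>set_mset (\<alpha> - {#i#}). F i j) = (\<Sum>i\<in>set_mset \<alpha>. \<Sum>j\<in>set_mset (\<alpha> - {#i#}). F j i)"
proof -
  have "set_mset (\<alpha> - {#i#}) = {j \<in> set_mset \<alpha>. {#i, j#} \<subseteq># \<alpha>}" if "i \<in># \<alpha>" for i
  proof -
    from that obtain A where "\<alpha> = add_mset i A" by (blast dest: multi_member_split)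
    then show ?thesis by auto
  qed
  moreover have "set_mset (\<alpha> - {#i#}) = {j \<in> set_mset \<alpha>. {#j, i#} \<subseteq># \<alpha>}" if "i \<in># \<alpha>" for i
    using calculation[OF that] by (simp add: add_mset_commute)
  ultimately show ?thesis
    using sum.swap_restrict[of "set_mset \<alpha>" "set_mset \<alpha>" F "\<lambda>i j. {#i, j#} \<subseteq># \<alpha>"] by simp
qed

lemma sum_pairs_alternating:
  fixes F :: "'n::linorder \<Rightarrow> 'n \<Rightarrow> 'm::ab_group_add"
  assumes "\<And>i j. F i j = - F j i" "\<And>i. F i i = 0"
  shows "(\<Sum>i\<in>set_mset \<alpha>. \<Sum>j\<in>set_mset (\<alpha> - {#i#}). F i j) = 0"
proof -
  let ?G = "\<lambda>i j. if i < j then F i j else 0"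
  have "F i j = ?G i j - ?G j i" for i j
    using assms(1)[of i j] assms(2)[of i] by (cases i j rule: linorder_cases) auto
  then have "(\<Sum>i\<in>set_mset \<alpha>. \<Sum>j\<in>set_mset (\<alpha> - {#i#}). F i j) =
      (\<Sum>i\<in>set_mset \<alpha>. \<Sum>j\<in>set_mset (\<alpha> - {#i#}). ?G i j) - (\<Sum>i\<in>set_mset \<alpha>. \<Sum>j\<in>set_mset (\<alpha> - {#i#}). ?G j i)"
    unfolding sum_subtractf[symmetric] by (intro sum.cong refl)
  then show ?thesis by (simp only: sum_pairs_swap[of ?G]) simp
qed

lemma shuffle_sign_gens:
  assumes "i \<noteq> j"
  shows "shuffle_sign {i} {j} = (- shuffle_sign {j} {i} :: 'r::comm_ring_1)"
proof -
  have "{(a, b). a \<in> {i} \<and> b \<in> {j} \<and> b < a} = (if j < i then {(i, j)} else {})" for i j :: 'a by auto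
  with assms show ?thesis by (cases i j rule: linorder_cases) (simp_all only: shuffle_sign_def, auto)
qed

lemma sum_tail_diff:
  fixes g :: "'n::{finite,linorder} set list \<Rightarrow> ('r::comm_ring_1, 'n) exterior"
  assumes "\<alpha> \<noteq> {#}"
  shows "(\<Sum>w\<in>permutations_of_multiset \<alpha>. tail_diff g (map (\<lambda>i. {i}) w)) =
    - ((- 1) ^ size \<alpha> * (\<Sum>i\<in>set_mset \<alpha>. symmetrize g (\<alpha> - {#i#}) * ext_gen i))"
  using assms
proof (induction "size \<alpha>" arbitrary: \<alpha> g)
  case (Suc m)
  show ?case
  proof (cases "m = 0")
    case True
    then obtain i where "\<alpha> = {#i#}" using Suc(2) size_1_singleton_mset by (metis One_nat_def)
    then show ?thesis by (simp add: symmetrize_def)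
  next
    case False
    have ne: "\<alpha> - {#i#} \<noteq> {#}" if "i \<in># \<alpha>" for i
      using that False Suc(2) by (auto dest!: multi_member_split)
    have size: "size \<alpha> = Suc (size (\<alpha> - {#i#}))" "m = size (\<alpha> - {#i#})" if "i \<in># \<alpha>" for i
      using that Suc(2) by (auto dest!: multi_member_split)
    let ?M = "\<lambda>i j. \<Sum>w\<in>permutations_of_multiset (\<alpha> - {#i#} - {#j#}).
      if {i} \<inter> {j} = {} then ext_scale (shuffle_sign {i} {j}) (g (({i} \<union> {j}) # map (\<lambda>i. {i}) w)) else 0"
    have M: "?M i j = - ?M j i" for i j
    proof (cases "i = j")
      case False
      have "\<alpha> - {#i#} - {#j#} = \<alpha> - {#j#} - {#i#}" by (simp add: add_mset_commute)
      with False show ?thesis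
        by (simp add: shuffle_sign_gens[OF False] insert_commute sum_negf)
    qed simp
    have "(\<Sum>w\<in>permutations_of_multiset \<alpha>. tail_diff g (map (\<lambda>i. {i}) w)) =
      (\<Sum>i\<in>set_mset \<alpha>. \<Sum>w\<in>permutations_of_multiset (\<alpha> - {#i#}). tail_diff g ({i} # map (\<lambda>i. {i}) w))"
      by (simp add: sum_permutations_of_multiset[OF Suc(3)])
    also have "\<dots> = (\<Sum>i\<in>set_mset \<alpha>. \<Sum>j\<in>set_mset (\<alpha> - {#i#}). ?M i j)
        - (\<Sum>i\<in>set_mset \<alpha>. \<Sum>w\<in>permutations_of_multiset (\<alpha> - {#i#}). tail_diff (\<lambda>L. g ({i} # L)) (map (\<lambda>i. {i}) w))"
      unfolding sum_subtractf[symmetric]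
      by (intro sum.cong refl) (simp add: sum_permutations_of_multiset ne sum_subtractf)
    also have "(\<Sum>i\<in>set_mset \<alpha>. \<Sum>j\<in>set_mset (\<alpha> - {#i#}). ?M i j) = 0"
      by (intro sum_pairs_alternating M) simp
    also have "(\<Sum>i\<in>set_mset \<alpha>. \<Sum>w\<in>permutations_of_multiset (\<alpha> - {#i#}). tail_diff (\<lambda>L. g ({i} # L)) (map (\<lambda>i. {i}) w))
        = (\<Sum>i\<in>set_mset \<alpha>. - ((- 1) ^ m * (\<Sum>j\<in>set_mset (\<alpha> - {#i#}).
            symmetrize (\<lambda>L. g ({i} # L)) (\<alpha> - {#i#} - {#j#}) * ext_gen j)))"
      using size(2) by (intro sum.cong refl) (simp add: Suc(1) ne)
    also have "\<dots> = - ((- 1) ^ m * (\<Sum>i\<in>set_mset \<alpha>. \<Sum>j\<in>set_mset (\<alpha> - {#i#}).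
            symmetrize (\<lambda>L. g ({i} # L)) (\<alpha> - {#i#} - {#j#}) * ext_gen j))"
      by (simp add: sum_negf sum_distrib_left)
    also have "(\<Sum>i\<in>set_mset \<alpha>. \<Sum>j\<in>set_mset (\<alpha> - {#i#}).
            symmetrize (\<lambda>L. g ({i} # L)) (\<alpha> - {#i#} - {#j#}) * ext_gen j)
        = (\<Sum>j\<in>set_mset \<alpha>. \<Sum>i\<in>set_mset (\<alpha> - {#j#}).
            symmetrize (\<lambda>L. g ({i} # L)) (\<alpha> - {#i#} - {#j#}) * ext_gen j)"
      by (rule sum_pairs_swap)
    also have "\<dots> = (\<Sum>j\<in>set_mset \<alpha>. symmetrize g (\<alpha> - {#j#}) * ext_gen j)"
    proof (intro sum.cong refl)
      fix j assume "j \<in># \<alpha>"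
      have "\<alpha> - {#i#} - {#j#} = \<alpha> - {#j#} - {#i#}" for i by (simp add: add_mset_commute)
      then show "(\<Sum>i\<in>set_mset (\<alpha> - {#j#}). symmetrize (\<lambda>L. g ({i} # L)) (\<alpha> - {#i#} - {#j#}) * ext_gen j)
          = symmetrize g (\<alpha> - {#j#}) * ext_gen j"
        by (simp add: symmetrize_nonempty[OF ne[OF \<open>j \<in># \<alpha>\<close>]] sum_distrib_right)
    qed
    finally show ?thesis by (simp add: Suc(2)[symmetric])
  qed
qed simp

lemma symmetrize_basis_diff: "symmetrize (basis_diff g) \<alpha> = koszul_diff (symmetrize g) \<alpha>"
proof (cases "\<alpha> = {#}")
  case True
  then show ?thesis by (simp add: symmetrize_def koszul_diff_def)
next
  case False
  have "symmetrize (basis_diff g) \<alpha> = (\<Sum>i\<in>set_mset \<alpha>. ext_gen i * symmetrize g (\<alpha> - {#i#}))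
      - (\<Sum>w\<in>permutations_of_multiset \<alpha>. tail_diff g (map (\<lambda>i. {i}) w))"
    by (simp add: symmetrize_def sum_permutations_of_multiset[OF False] sum_subtractf sum_distrib_left)
  then show ?thesis
    by (simp add: sum_tail_diff[OF False] koszul_diff_def sum.distrib sum_distrib_left)
qed

lemma cell_singletons:
  "cell p (map (\<lambda>i. {i}) w) = (if sorted_wrt (\<ge>) ((case p of None \<Rightarrow> [] | Some i \<Rightarrow> [i]) @ w) then Critical else Target)"
proof (induction w arbitrary: p)
  case (Cons j w)
  show ?case
    by (cases p) (auto simp: Cons not_less intro: order_trans)
qed (auto split: option.splits)

lemma Critical_singletons: "cell p L = Critical \<Longrightarrow> \<exists>w. L = map (\<lambda>i. {i}) w"
proof (induction L arbitrary: p)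
  case (Cons \<sigma> L)
  then have \<sigma>: "\<sigma> = {Min \<sigma>}" and "cell (Some (Min \<sigma>)) L = Critical" by (auto split: if_splits)
  with Cons.IH obtain w where "L = map (\<lambda>i. {i}) w" by blast
  with \<sigma> show ?case by (intro exI[of _ "Min \<sigma> # w"]) simp
qed simp

lemma symmetrize_Critical:
  assumes "\<And>L. cell None L = Target \<Longrightarrow> g L = 0"
  shows "symmetrize g \<alpha> = g (map (\<lambda>i. {i}) (rev (sorted_list_of_multiset \<alpha>)))"
proof -
  let ?w = "rev (sorted_list_of_multiset \<alpha>)"
  have "g (map (\<lambda>i. {i}) w) = 0" if "mset w = \<alpha>" "w \<noteq> ?w" for w
  proof -
    have "\<not> sorted (rev w)"
    proof
      assume "sorted (rev w)"
      then have "rev w = sorted_list_of_multiset \<alpha>"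
        using that(1) by (metis mset_rev sorted_list_of_multiset_mset sorted_sort_id)
      with that(2) show False by (metis rev_rev_ident)
    qed
    then have "\<not> sorted_wrt (\<ge>) w" by (simp add: sorted_wrt_rev)
    then show ?thesis by (intro assms) (simp add: cell_singletons)
  qed
  then have "symmetrize g \<alpha> = (\<Sum>w\<in>{?w}. g (map (\<lambda>i. {i}) w))"
    unfolding symmetrize_def by (intro sum.mono_neutral_right finite_permutations_of_multiset) (auto simp: permutations_of_multiset_def)
  then show ?thesis by simp
qed

lemma Critical_eq:
  assumes "cell None L = Critical"
  shows "\<exists>\<alpha>. L = map (\<lambda>i. {i}) (rev (sorted_list_of_multiset \<alpha>)) \<and> size \<alpha> = length L"
proof -
  obtain w where w: "L = map (\<lambda>i. {i}) w" using Critical_singletons[OF assms] by blast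
  with assms have "sorted_wrt (\<ge>) w" by (simp add: cell_singletons split: if_splits)
  then have "sorted (rev w)" by (simp add: sorted_wrt_rev)
  then have "sorted_list_of_multiset (mset w) = rev w"
    by (metis mset_rev sorted_list_of_multiset_mset sorted_sort_id)
  with w show ?thesis by (intro exI[of _ "mset w"]) simp
qed

lemma basis_diff_basis_diff:
  assumes "\<And>L. length L \<noteq> k \<Longrightarrow> g L = 0"
  shows "basis_diff (basis_diff g) = (\<lambda>L. 0)"
proof -
  obtain f where f: "f \<in> cochains k" "g = on_basis k f" using on_basis_surj[of k g] assms by blast
  then have "basis_diff (basis_diff g) = on_basis (Suc (Suc k)) (coboundary (Suc k) (coboundary k f))"
    by (simp add: on_basis_coboundary coboundary_in_cochains)
  also have "\<dots> = (\<lambda>L. 0)"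
    by (simp add: coboundary_coboundary[OF f(1)] on_basis_def fun_eq_iff)
  finally show ?thesis .
qed

lemma basis_diff_off_degree: "(\<And>L. length L \<noteq> k \<Longrightarrow> g L = 0) \<Longrightarrow> length L \<noteq> Suc k \<Longrightarrow> basis_diff g L = 0"
  using basis_diff_cong[of L g "\<lambda>L. 0"] by auto

lemma basis_cochain_eq_0:
  fixes g :: "'n::{finite,linorder} set list \<Rightarrow> ('r::comm_ring_1, 'n) exterior"
  assumes "\<And>L. cell None L = Target \<Longrightarrow> g L = 0" "symmetrize g = (\<lambda>\<alpha>. 0)"
    "\<And>L. cell None L = Target \<Longrightarrow> basis_diff g L = 0"
  shows "g = (\<lambda>L. 0)"
proof (rule basis_cochain_zero)
  fix L :: "'n set list" assume "cell None L \<noteq> Source"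
  then consider "cell None L = Target" | "cell None L = Critical" by (cases "cell None L") auto
  then show "g L = 0"
  proof cases
    case 2
    then obtain \<alpha> where "L = map (\<lambda>i. {i}) (rev (sorted_list_of_multiset \<alpha>))" using Critical_eq by blast
    with symmetrize_Critical[of g \<alpha>] assms(1,2) show ?thesis by simp
  qed (rule assms(1))
qed (rule assms(3))

lemma symmetrize_exists:
  fixes c :: "'n::{finite,linorder} multiset \<Rightarrow> ('r::comm_ring_1, 'n) exterior"
  assumes c: "\<And>\<alpha>. size \<alpha> \<noteq> k \<Longrightarrow> c \<alpha> = 0"
  shows "\<exists>g. (\<forall>L. length L \<noteq> k \<longrightarrow> g L = 0) \<and> symmetrize g = c \<and>
    (\<forall>L. cell None L = Target \<longrightarrow> g L = 0) \<and>
    (\<forall>L. length L = Suc k \<longrightarrow> cell None L = Target \<longrightarrow> basis_diff g L = u L)"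
proof -
  obtain g where g: "\<forall>L. length L \<noteq> k \<longrightarrow> g L = 0"
    "\<forall>L. length L = k \<longrightarrow> cell None L = Critical \<longrightarrow> g L = c (mset (map Min L))"
    "\<forall>L. cell None L = Target \<longrightarrow> g L = 0"
    "\<forall>L. length L = Suc k \<longrightarrow> cell None L = Target \<longrightarrow> basis_diff g L = u L"
    using basis_cochain_exists[of k "\<lambda>L. c (mset (map Min L))" u] by blast
  have "symmetrize g \<alpha> = c \<alpha>" for \<alpha>
  proof (cases "size \<alpha> = k")
    case True
    let ?L = "map (\<lambda>i. {i}) (rev (sorted_list_of_multiset \<alpha>))"
    have "length ?L = k" using True by (metis length_map length_rev mset_sorted_list_of_multiset size_mset)
    moreover have "cell None ?L = Critical"
      by (simp add: cell_singletons sorted_wrt_rev sorted_sorted_list_of_multiset)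
    ultimately have "g ?L = c (mset (map Min ?L))" using g(2) by blast
    also have "map Min ?L = rev (sorted_list_of_multiset \<alpha>)" by (simp add: comp_def)
    finally show ?thesis using symmetrize_Critical[of g \<alpha>] g(3) by simp
  qed (use c g(1) symmetrize_off_degree in metis)
  with g show ?thesis by (intro exI[of _ g]) auto
qed

lemma koszul_cocycle_lift:
  assumes c: "\<And>\<alpha>. size \<alpha> \<noteq> k \<Longrightarrow> c \<alpha> = 0" and "koszul_diff c = (\<lambda>\<alpha>. 0)"
  shows "\<exists>g. (\<forall>L. length L \<noteq> k \<longrightarrow> g L = 0) \<and> symmetrize g = c \<and> basis_diff g = (\<lambda>L. 0)"
proof -
  obtain g where g: "\<And>L. length L \<noteq> k \<Longrightarrow> g L = 0" "symmetrize g = c"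
    "\<And>L. length L = Suc k \<Longrightarrow> cell None L = Target \<Longrightarrow> basis_diff g L = 0"
    using symmetrize_exists[of k c "\<lambda>L. 0"] c by blast
  have "basis_diff g = (\<lambda>L. 0)"
  proof (rule basis_cochain_eq_0)
    show "basis_diff g L = 0" if "cell None L = Target" for L
      using that g(3) basis_diff_off_degree[of k g L] g(1) by (cases "length L = Suc k") auto
    show "symmetrize (basis_diff g) = (\<lambda>\<alpha>. 0)"
      using assms(2) by (simp add: fun_eq_iff symmetrize_basis_diff g(2))
    show "basis_diff (basis_diff g) L = 0" for L
      using fun_cong[OF basis_diff_basis_diff[of k g]] g(1) by simp
  qed
  with g show ?thesis by blast
qed

lemma koszul_coboundary_lift:
  fixes g :: "'n::{finite,linorder} set list \<Rightarrow> ('r::comm_ring_1, 'n) exterior"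
  assumes g: "\<And>L. length L \<noteq> Suc k \<Longrightarrow> g L = 0" "basis_diff g = (\<lambda>L. 0)"
    and c: "\<And>\<alpha>. size \<alpha> \<noteq> k \<Longrightarrow> c \<alpha> = 0" "symmetrize g = koszul_diff c"
  shows "\<exists>h. (\<forall>L. length L \<noteq> k \<longrightarrow> h L = 0) \<and> g = basis_diff h"
proof -
  obtain e where e: "\<And>L. length L \<noteq> k \<Longrightarrow> e L = 0" "symmetrize e = c"
    using symmetrize_exists[of k c] c(1) by blast
  obtain h where h: "\<And>L. length L \<noteq> k \<Longrightarrow> h L = 0" "symmetrize h = (\<lambda>\<alpha>. 0)"
    "\<And>L. length L = Suc k \<Longrightarrow> cell None L = Target \<Longrightarrow> basis_diff h L = g L - basis_diff e L"
    using symmetrize_exists[of k "\<lambda>\<alpha>. 0 :: ('r, 'n) exterior" "\<lambda>L. g L - basis_diff e L"] by blast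
  define d where "d L = e L + h L" for L
  have d: "length L \<noteq> k \<Longrightarrow> d L = 0" for L using e h by (simp add: d_def)
  have symd: "symmetrize d = c"
    unfolding d_def using e(2) h(2) by (simp add: fun_eq_iff symmetrize_add)
  have diffd: "basis_diff d L = basis_diff e L + basis_diff h L" for L
    unfolding d_def by (rule basis_diff_add)
  have "(\<lambda>L. g L - basis_diff d L) = (\<lambda>L. 0)"
  proof (rule basis_cochain_eq_0)
    show "g L - basis_diff d L = 0" if "cell None L = Target" for L
    proof (cases "length L = Suc k")
      case True
      from h(3)[OF True that] show ?thesis by (simp add: diffd)
    next
      case False
      from g(1)[OF False] basis_diff_off_degree[of k d L] d False show ?thesis by simp
    qed
    show "symmetrize (\<lambda>L. g L - basis_diff d L) = (\<lambda>\<alpha>. 0)"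
      by (rule ext) (simp only: symmetrize_diff symmetrize_basis_diff symd c(2) diff_self)
    have "basis_diff (basis_diff d) = (\<lambda>L. 0)"
      by (rule basis_diff_basis_diff[of k d]) (rule d)
    then show "basis_diff (\<lambda>L. g L - basis_diff d L) L = 0" for L
      by (simp only: basis_diff_diff g(2) diff_self)
  qed
  then have "g L - basis_diff d L = 0" for L by (rule fun_cong)
  then have "g = basis_diff d" by (intro ext) simp
  with d show ?thesis by blast
qed

definition symbol :: "nat \<Rightarrow> ('r::comm_ring_1, 'n::{finite,linorder}) cochain \<Rightarrow> 'n multiset \<Rightarrow> ('r, 'n) exterior" where
  "symbol k f = symmetrize (on_basis k f)"

lemma symbol_linear:
  "symbol k (\<lambda>t. f t + f' t) \<alpha> = symbol k f \<alpha> + symbol k f' \<alpha>"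
  "symbol k (\<lambda>t. ext_scale r (f t)) \<alpha> = ext_scale r (symbol k f \<alpha>)"
proof -
  have "on_basis k (\<lambda>t. f t + f' t) = (\<lambda>L. on_basis k f L + on_basis k f' L)"
    "on_basis k (\<lambda>t. ext_scale r (f t)) = (\<lambda>L. ext_scale r (on_basis k f L))"
    by (rule ext, simp add: on_basis_def)+
  then show "symbol k (\<lambda>t. f t + f' t) \<alpha> = symbol k f \<alpha> + symbol k f' \<alpha>"
    "symbol k (\<lambda>t. ext_scale r (f t)) \<alpha> = ext_scale r (symbol k f \<alpha>)"
    by (simp_all add: symbol_def symmetrize_add symmetrize_scale)
qed

lemma symbol_off_degree: "size \<alpha> \<noteq> k \<Longrightarrow> symbol k f \<alpha> = 0"
  unfolding symbol_def by (rule symmetrize_off_degree[of k]) (auto simp: on_basis_def)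

lemma koszul_diff_symbol: "f \<in> cochains k \<Longrightarrow> koszul_diff (symbol k f) = symbol (Suc k) (coboundary k f)"
  unfolding symbol_def on_basis_coboundary by (rule ext) (rule symmetrize_basis_diff[symmetric])

lemma on_basis_inject:
  assumes "f \<in> cochains k" "g \<in> cochains k" "on_basis k f = on_basis k g"
  shows "f = g"
proof -
  have "(\<lambda>t. f t - g t) \<in> cochains k"
    using assms(1,2) by (auto simp: cochains_iff ext.scale_right_diff_distrib algebra_simps)
  moreover have "on_basis k (\<lambda>t. f t - g t) = (\<lambda>L. 0)"
    using assms(3) by (auto simp: fun_eq_iff on_basis_def split: if_splits)
  ultimately have "(\<lambda>t. f t - g t) = (\<lambda>t. 0)" by (rule cochain_eq_0)
  then show ?thesis by (simp add: fun_eq_iff)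
qed

lemma symbol_cocycle:
  assumes "f \<in> cocycles k"
  shows "koszul_diff (symbol k f) = (\<lambda>\<alpha>. 0)"
proof -
  have "koszul_diff (symbol k f) = symbol (Suc k) (\<lambda>t. 0)"
    using assms by (simp add: cocycles_def koszul_diff_symbol)
  then show ?thesis by (simp add: symbol_def symmetrize_def on_basis_def fun_eq_iff)
qed

lemma symbol_surj:
  assumes "\<And>\<alpha>. size \<alpha> \<noteq> k \<Longrightarrow> c \<alpha> = 0" "koszul_diff c = (\<lambda>\<alpha>. 0)"
  shows "\<exists>f\<in>cocycles k. symbol k f = c"
proof -
  obtain g where g: "\<And>L. length L \<noteq> k \<Longrightarrow> g L = 0" "symmetrize g = c" "basis_diff g = (\<lambda>L. 0)"
    using koszul_cocycle_lift[of k c] assms by blast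
  obtain f where f: "f \<in> cochains k" "on_basis k f = g" using on_basis_surj[of k g] g(1) by blast
  have "coboundary k f = (\<lambda>t. 0)"
    by (rule cochain_eq_0[OF coboundary_in_cochains[OF f(1)]]) (simp add: on_basis_coboundary f g(3))
  with f g show ?thesis by (auto simp: cocycles_def symbol_def)
qed

lemma zero_in_cocycles: "(\<lambda>t. 0) \<in> cocycles k"
  by (simp add: cocycles_def cochains_iff coboundary_def fun_eq_iff)

lemma coboundaries_subset_cocycles: "coboundaries k \<subseteq> cocycles k"
  using zero_in_cocycles[of 0]
  by (cases k) (auto simp: cocycles_def coboundary_in_cochains coboundary_coboundary)

lemma coboundaries_iff_symbol:
  assumes f: "f \<in> cocycles k"
  shows "f \<in> coboundaries k \<longleftrightarrow> (\<exists>c. (\<forall>\<alpha>. Suc (size \<alpha>) \<noteq> k \<longrightarrow> c \<alpha> = 0) \<and> symbol k f = koszul_diff c)"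
proof (cases k)
  case 0
  have 1: "koszul_diff c = (\<lambda>\<alpha>. 0)" if "\<forall>\<alpha>. c \<alpha> = 0" for c :: "'b multiset \<Rightarrow> ('a, 'b) exterior"
    using that by (simp add: koszul_diff_def fun_eq_iff)
  have 2: "f = (\<lambda>t. 0)" if "symbol 0 f = (\<lambda>\<alpha>. 0)"
  proof (rule cochain_eq_0)
    have "symbol 0 f {#} = on_basis 0 f []" by (simp add: symbol_def symmetrize_def)
    with that show "on_basis 0 f = (\<lambda>L. 0)" by (auto simp: fun_eq_iff on_basis_def)
  qed (use f 0 in \<open>simp add: cocycles_def\<close>)
  have 3: "symbol 0 (\<lambda>t. 0) = (\<lambda>\<alpha>. 0 :: ('a, 'b) exterior)"
    by (simp add: symbol_def symmetrize_def on_basis_def fun_eq_iff)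
  show ?thesis
  proof
    assume "f \<in> coboundaries k"
    then have "f = (\<lambda>t. 0)" using 0 by simp
    then show "\<exists>c. (\<forall>\<alpha>. Suc (size \<alpha>) \<noteq> k \<longrightarrow> c \<alpha> = 0) \<and> symbol k f = koszul_diff c"
      using 0 1[of "\<lambda>\<alpha>. 0"] 3 by (intro exI[of _ "\<lambda>\<alpha>. 0"]) simp
  next
    assume "\<exists>c. (\<forall>\<alpha>. Suc (size \<alpha>) \<noteq> k \<longrightarrow> c \<alpha> = 0) \<and> symbol k f = koszul_diff c"
    then have "symbol 0 f = (\<lambda>\<alpha>. 0)" using 0 1 by auto
    from 2[OF this] show "f \<in> coboundaries k" using 0 by simp
  qed
next
  case (Suc m)
  show ?thesis
  proof
    assume "f \<in> coboundaries k"
    then obtain e where "e \<in> cochains m" "f = coboundary m e" using Suc by auto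
    then show "\<exists>c. (\<forall>\<alpha>. Suc (size \<alpha>) \<noteq> k \<longrightarrow> c \<alpha> = 0) \<and> symbol k f = koszul_diff c"
      using Suc by (intro exI[of _ "symbol m e"]) (simp add: koszul_diff_symbol symbol_off_degree)
  next
    assume "\<exists>c. (\<forall>\<alpha>. Suc (size \<alpha>) \<noteq> k \<longrightarrow> c \<alpha> = 0) \<and> symbol k f = koszul_diff c"
    then obtain c where c: "\<And>\<alpha>. size \<alpha> \<noteq> m \<Longrightarrow> c \<alpha> = 0" "symbol k f = koszul_diff c"
      using Suc by auto
    have "basis_diff (on_basis k f) = on_basis (Suc k) (\<lambda>t. 0)"
      using f on_basis_coboundary[of f k] by (simp add: cocycles_def)
    then have "\<exists>h. (\<forall>L. length L \<noteq> m \<longrightarrow> h L = 0) \<and> on_basis k f = basis_diff h"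
      using c Suc by (intro koszul_coboundary_lift[where c = c]) (auto simp: on_basis_def symbol_def)
    then obtain h where h: "\<And>L. length L \<noteq> m \<Longrightarrow> h L = 0" "on_basis k f = basis_diff h" by blast
    obtain e where e: "e \<in> cochains m" "on_basis m e = h" using on_basis_surj[of m h] h(1) by blast
    have "f = coboundary m e"
    proof (rule on_basis_inject)
      show "on_basis k f = on_basis k (coboundary m e)" using e h(2) Suc by (simp add: on_basis_coboundary)
    qed (use f e Suc in \<open>auto simp: cocycles_def intro: coboundary_in_cochains\<close>)
    with e Suc show "f \<in> coboundaries k" by simp
  qed
qed

section \<open>The cohomology of the Koszul complex\<close>

definition wedge_diff :: "('n::{finite,linorder} multiset \<Rightarrow> 'n set \<Rightarrow> 'r) \<Rightarrow> 'n multiset \<Rightarrow> 'n set \<Rightarrow> 'r::comm_ring_1" where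
  "wedge_diff c \<alpha> \<tau> = (\<Sum>i\<in>set_mset \<alpha> \<inter> \<tau>. shuffle_sign {i} (\<tau> - {i}) * c (\<alpha> - {#i#}) (\<tau> - {i}))"

lemma shuffle_sign_square_left: "shuffle_sign \<sigma> \<tau> * (shuffle_sign \<sigma> \<tau> * x) = (x :: 'r::comm_ring_1)"
  by (simp add: shuffle_sign_def)

lemma shuffle_sign_gen_commute:
  assumes "i \<notin> \<nu>"
  shows "shuffle_sign \<nu> {i} = ((- 1) ^ card \<nu> * shuffle_sign {i} \<nu> :: 'r::comm_ring_1)"
proof -
  have "{(a, b). a \<in> \<nu> \<and> b \<in> {i} \<and> b < a} = (\<lambda>a. (a, i)) ` {a \<in> \<nu>. i < a}"
    "{(a, b). a \<in> {i} \<and> b \<in> \<nu> \<and> b < a} = Pair i ` {a \<in> \<nu>. a < i}" by auto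
  then have signs: "shuffle_sign \<nu> {i} = ((- 1) ^ card {a \<in> \<nu>. i < a} :: 'r)"
    "shuffle_sign {i} \<nu> = ((- 1) ^ card {a \<in> \<nu>. a < i} :: 'r)"
    by (simp_all only: shuffle_sign_def) (simp_all add: card_image inj_on_def)
  have "{a \<in> \<nu>. i < a} \<union> {a \<in> \<nu>. a < i} = \<nu>" using assms by (auto simp: not_less_iff_gr_or_eq)
  moreover have "card ({a \<in> \<nu>. i < a} \<union> {a \<in> \<nu>. a < i}) = card {a \<in> \<nu>. i < a} + card {a \<in> \<nu>. a < i}"
    by (intro card_Un_disjoint) auto
  ultimately have "card \<nu> = card {a \<in> \<nu>. i < a} + card {a \<in> \<nu>. a < i}" by simp
  then show ?thesis
    unfolding signs by (simp add: power_add mult.assoc)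
qed

lemma ext_coeff_gen_mult:
  "ext_coeff (ext_gen i * a) \<tau> = (if i \<in> \<tau> then shuffle_sign {i} (\<tau> - {i}) * ext_coeff a (\<tau> - {i}) else 0)"
proof -
  have "ext_coeff (ext_gen i * a) \<tau> = (\<Sum>\<sigma>\<in>{\<sigma>. \<sigma> \<subseteq> \<tau>}. if \<sigma> = {i} then shuffle_sign {i} (\<tau> - {i}) * ext_coeff a (\<tau> - {i}) else 0)"
    unfolding times_exterior.rep_eq by (rule sum.cong) (auto simp: ext_basis.rep_eq)
  then show ?thesis by simp
qed

lemma ext_coeff_mult_gen:
  "ext_coeff (a * ext_gen i) \<tau> = (if i \<in> \<tau> then shuffle_sign (\<tau> - {i}) {i} * ext_coeff a (\<tau> - {i}) else 0)"
proof -
  have "\<tau> - \<sigma> = {i} \<longleftrightarrow> \<sigma> = \<tau> - {i} \<and> i \<in> \<tau>" if "\<sigma> \<subseteq> \<tau>" for \<sigma>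
    using that by auto
  then have "ext_coeff (a * ext_gen i) \<tau> = (\<Sum>\<sigma>\<in>{\<sigma>. \<sigma> \<subseteq> \<tau>}. if \<sigma> = \<tau> - {i} then
      if i \<in> \<tau> then shuffle_sign (\<tau> - {i}) {i} * ext_coeff a (\<tau> - {i}) else 0 else 0)"
    unfolding times_exterior.rep_eq by (intro sum.cong refl) (auto simp: ext_basis.rep_eq double_diff)
  then show ?thesis by simp
qed

lemma ext_coeff_sum: "ext_coeff (\<Sum>i\<in>S. f i) \<tau> = (\<Sum>i\<in>S. ext_coeff (f i) \<tau>)"
  by (induction S rule: infinite_finite_induct) (simp_all add: zero_exterior.rep_eq plus_exterior.rep_eq)

lemma ext_coeff_koszul_diff:
  fixes c :: "'n::{finite,linorder} multiset \<Rightarrow> ('r::comm_ring_1, 'n) exterior"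
  shows "ext_coeff (koszul_diff c \<alpha>) \<tau> =
    (if odd (size \<alpha> + card \<tau>) then 2 else 0) * wedge_diff (\<lambda>\<beta>. ext_coeff (c \<beta>)) \<alpha> \<tau>"
proof -
  have power: "(- 1) ^ m * a = (if even m then a else - a)" for m and a :: "('r, 'n) exterior" by simp
  have "ext_coeff (koszul_diff c \<alpha>) \<tau> =
      (\<Sum>i\<in>set_mset \<alpha>. if i \<in> \<tau> then (if odd (size \<alpha> + card \<tau>) then 2 else 0) *
        (shuffle_sign {i} (\<tau> - {i}) * ext_coeff (c (\<alpha> - {#i#})) (\<tau> - {i})) else 0)"
    unfolding koszul_diff_def ext_coeff_sum power
  proof (intro sum.cong refl)
    fix i
    show "ext_coeff (ext_gen i * c (\<alpha> - {#i#}) + (if even (size \<alpha>) then c (\<alpha> - {#i#}) * ext_gen i else - (c (\<alpha> - {#i#}) * ext_gen i))) \<tau> =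
      (if i \<in> \<tau> then (if odd (size \<alpha> + card \<tau>) then 2 else 0) *
        (shuffle_sign {i} (\<tau> - {i}) * ext_coeff (c (\<alpha> - {#i#})) (\<tau> - {i})) else 0)"
    proof (cases "i \<in> \<tau>")
      case True
      then obtain \<nu> where "\<tau> = insert i \<nu>" "i \<notin> \<nu>" by (rule mk_disjoint_insert[elim_format]) blast
      then show ?thesis
        by (auto simp: plus_exterior.rep_eq uminus_exterior.rep_eq ext_coeff_gen_mult ext_coeff_mult_gen shuffle_sign_gen_commute)
    qed (simp add: plus_exterior.rep_eq uminus_exterior.rep_eq ext_coeff_gen_mult ext_coeff_mult_gen)
  qed
  also have "\<dots> = (\<Sum>i\<in>set_mset \<alpha> \<inter> \<tau>. (if odd (size \<alpha> + card \<tau>) then 2 else 0) *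
        (shuffle_sign {i} (\<tau> - {i}) * ext_coeff (c (\<alpha> - {#i#})) (\<tau> - {i})))"
    by (simp add: sum.inter_restrict)
  finally show ?thesis by (simp add: wedge_diff_def sum_distrib_left)
qed

lemma koszul_diff_zero: "koszul_diff (\<lambda>\<alpha>. 0) = (\<lambda>\<alpha>. 0)"
  by (rule ext) (simp add: koszul_diff_def)

lemma koszul_diff_koszul_diff:
  assumes "\<And>\<alpha>. size \<alpha> \<noteq> k \<Longrightarrow> c \<alpha> = 0"
  shows "koszul_diff (koszul_diff c) = (\<lambda>\<alpha>. 0)"
proof -
  obtain g where g: "\<And>L. length L \<noteq> k \<Longrightarrow> g L = 0" "symmetrize g = c"
    using symmetrize_exists[of k c] assms by blast
  have "koszul_diff (koszul_diff c) \<alpha> = symmetrize (basis_diff (basis_diff g)) \<alpha>" for \<alpha>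
    unfolding symmetrize_basis_diff g(2)[symmetric] by (simp only: symmetrize_basis_diff[abs_def])
  moreover have "basis_diff (basis_diff g) = (\<lambda>L. 0)" by (rule basis_diff_basis_diff[of k g]) (rule g(1))
  ultimately show ?thesis by (simp add: symmetrize_def fun_eq_iff)
qed

definition pivot :: "'n multiset \<Rightarrow> 'n::{finite,linorder} set \<Rightarrow> 'n" where
  "pivot \<alpha> \<tau> = Min (set_mset \<alpha> \<union> - \<tau>)"

definition lower :: "'n multiset \<Rightarrow> 'n::{finite,linorder} set \<Rightarrow> bool" where
  "lower \<alpha> \<tau> \<longleftrightarrow> \<not> (\<alpha> = {#} \<and> \<tau> = UNIV) \<and> pivot \<alpha> \<tau> \<notin> \<tau>"

definition upper :: "'n multiset \<Rightarrow> 'n::{finite,linorder} set \<Rightarrow> bool" where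
  "upper \<alpha> \<tau> \<longleftrightarrow> \<not> (\<alpha> = {#} \<and> \<tau> = UNIV) \<and> pivot \<alpha> \<tau> \<in> \<tau>"

lemma pivot_cases: "(\<alpha> = {#} \<and> \<tau> = UNIV) \<or> lower \<alpha> \<tau> \<or> upper \<alpha> \<tau>"
  by (auto simp: lower_def upper_def)

lemma pivot_mem:
  assumes "\<not> (\<alpha> = {#} \<and> \<tau> = UNIV)"
  shows "pivot \<alpha> \<tau> \<in> set_mset \<alpha> \<union> - \<tau>"
  unfolding pivot_def using assms by (intro Min_in) auto

lemma pivot_eqI:
  assumes "m \<in> set_mset \<alpha> \<union> - \<tau>" "\<And>i. i \<in> set_mset \<alpha> \<union> - \<tau> \<Longrightarrow> m \<le> i"
  shows "pivot \<alpha> \<tau> = m"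
  unfolding pivot_def using assms by (intro Min_eqI) auto

lemma pivot_le: "i \<in> set_mset \<alpha> \<union> - \<tau> \<Longrightarrow> pivot \<alpha> \<tau> \<le> i"
  unfolding pivot_def by (intro Min_le) auto

lemma upper_pivot:
  assumes "upper \<alpha> \<tau>"
  shows "pivot \<alpha> \<tau> \<in># \<alpha>" "pivot \<alpha> \<tau> \<in> \<tau>"
  using assms pivot_mem[of \<alpha> \<tau>] by (auto simp: upper_def)

lemma upper_remove:
  assumes "upper \<alpha> \<tau>" "i \<in># \<alpha>" "i \<in> \<tau>" "i \<noteq> pivot \<alpha> \<tau>"
  shows "upper (\<alpha> - {#i#}) (\<tau> - {i})"
proof -
  note m = upper_pivot[OF assms(1)]
  have m': "pivot \<alpha> \<tau> \<in># \<alpha> - {#i#}" using m(1) assms(4) by (simp add: in_diff_count)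
  moreover have "pivot (\<alpha> - {#i#}) (\<tau> - {i}) = pivot \<alpha> \<tau>"
    using m' assms(2) by (intro pivot_eqI) (auto intro!: pivot_le dest: in_diffD)
  ultimately show ?thesis using m assms by (auto simp: upper_def)
qed

lemma upper_to_lower:
  assumes "upper \<alpha> \<tau>"
  shows "lower (\<alpha> - {#pivot \<alpha> \<tau>#}) (\<tau> - {pivot \<alpha> \<tau>})"
    "pivot (\<alpha> - {#pivot \<alpha> \<tau>#}) (\<tau> - {pivot \<alpha> \<tau>}) = pivot \<alpha> \<tau>"
proof -
  note m = upper_pivot[OF assms]
  show *: "pivot (\<alpha> - {#pivot \<alpha> \<tau>#}) (\<tau> - {pivot \<alpha> \<tau>}) = pivot \<alpha> \<tau>"
  proof (intro pivot_eqI)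
    fix i assume "i \<in> set_mset (\<alpha> - {#pivot \<alpha> \<tau>#}) \<union> - (\<tau> - {pivot \<alpha> \<tau>})"
    then show "pivot \<alpha> \<tau> \<le> i"
      by (cases "i = pivot \<alpha> \<tau>") (auto intro!: pivot_le dest: in_diffD)
  qed auto
  then show "lower (\<alpha> - {#pivot \<alpha> \<tau>#}) (\<tau> - {pivot \<alpha> \<tau>})"
    by (auto simp: lower_def)
qed

lemma lower_to_upper:
  assumes "lower \<alpha> \<tau>"
  shows "upper (add_mset (pivot \<alpha> \<tau>) \<alpha>) (insert (pivot \<alpha> \<tau>) \<tau>)"
    "pivot (add_mset (pivot \<alpha> \<tau>) \<alpha>) (insert (pivot \<alpha> \<tau>) \<tau>) = pivot \<alpha> \<tau>"
proof -
  show *: "pivot (add_mset (pivot \<alpha> \<tau>) \<alpha>) (insert (pivot \<alpha> \<tau>) \<tau>) = pivot \<alpha> \<tau>"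
  proof (intro pivot_eqI)
    fix i assume "i \<in> set_mset (add_mset (pivot \<alpha> \<tau>) \<alpha>) \<union> - insert (pivot \<alpha> \<tau>) \<tau>"
    then show "pivot \<alpha> \<tau> \<le> i"
      by (cases "i = pivot \<alpha> \<tau>") (auto intro!: pivot_le)
  qed auto
  then show "upper (add_mset (pivot \<alpha> \<tau>) \<alpha>) (insert (pivot \<alpha> \<tau>) \<tau>)"
    by (simp add: upper_def)
qed

lemma wedge_diff_upper:
  assumes "upper \<alpha> \<tau>"
    and "\<And>\<beta> \<rho>. upper \<beta> \<rho> \<Longrightarrow> Suc (size \<beta>) = size \<alpha> \<Longrightarrow> even (size \<beta> + card \<rho>) = even (size \<alpha> + card \<tau>) \<Longrightarrow> c \<beta> \<rho> = 0"
  shows "wedge_diff c \<alpha> \<tau> =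
    shuffle_sign {pivot \<alpha> \<tau>} (\<tau> - {pivot \<alpha> \<tau>}) * c (\<alpha> - {#pivot \<alpha> \<tau>#}) (\<tau> - {pivot \<alpha> \<tau>})"
proof -
  note m = upper_pivot[OF assms(1)]
  have "c (\<alpha> - {#i#}) (\<tau> - {i}) = 0" if i: "i \<in># \<alpha>" "i \<in> \<tau>" "i \<noteq> pivot \<alpha> \<tau>" for i
  proof (rule assms(2))
    show "upper (\<alpha> - {#i#}) (\<tau> - {i})" by (rule upper_remove) (use assms i in auto)
    show 1: "Suc (size (\<alpha> - {#i#})) = size \<alpha>" using i(1) by (simp add: size_Suc_Diff1)
    have 2: "Suc (card (\<tau> - {i})) = card \<tau>" using i(2) by (intro card_Suc_Diff1) auto
    show "even (size (\<alpha> - {#i#}) + card (\<tau> - {i})) = even (size \<alpha> + card \<tau>)"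
      unfolding 1[symmetric] 2[symmetric] by simp
  qed
  then have "wedge_diff c \<alpha> \<tau> = (\<Sum>i\<in>{pivot \<alpha> \<tau>}. shuffle_sign {i} (\<tau> - {i}) * c (\<alpha> - {#i#}) (\<tau> - {i}))"
    unfolding wedge_diff_def by (intro sum.mono_neutral_right) (use m in auto)
  then show ?thesis by simp
qed

lemma wedge_diff_solve:
  fixes v :: "'n::{finite,linorder} multiset \<Rightarrow> 'n set \<Rightarrow> 'r::comm_ring_1"
  shows "\<exists>e. (\<forall>\<alpha>. Suc (size \<alpha>) \<noteq> k \<longrightarrow> e \<alpha> = 0) \<and>
    (\<forall>\<alpha> \<tau>. size \<alpha> = k \<longrightarrow> upper \<alpha> \<tau> \<longrightarrow> wedge_diff (\<lambda>\<beta>. ext_coeff (e \<beta>)) \<alpha> \<tau> = v \<alpha> \<tau>)"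
proof -
  define w where "w \<beta> \<sigma> = (if Suc (size \<beta>) = k \<and> lower \<beta> \<sigma>
    then shuffle_sign {pivot \<beta> \<sigma>} \<sigma> * v (add_mset (pivot \<beta> \<sigma>) \<beta>) (insert (pivot \<beta> \<sigma>) \<sigma>) else 0)" for \<beta> \<sigma>
  define e where "e \<beta> = Exterior (w \<beta>)" for \<beta>
  have e: "ext_coeff (e \<beta>) = w \<beta>" for \<beta> by (simp add: e_def Exterior_inverse)
  have "wedge_diff w \<alpha> \<tau> = v \<alpha> \<tau>" if "size \<alpha> = k" "upper \<alpha> \<tau>" for \<alpha> \<tau>
  proof -
    note m = upper_pivot[OF that(2)]
    have "wedge_diff w \<alpha> \<tau> = shuffle_sign {pivot \<alpha> \<tau>} (\<tau> - {pivot \<alpha> \<tau>}) * w (\<alpha> - {#pivot \<alpha> \<tau>#}) (\<tau> - {pivot \<alpha> \<tau>})"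
      by (rule wedge_diff_upper[OF that(2)]) (auto simp: w_def upper_def lower_def)
    also have "w (\<alpha> - {#pivot \<alpha> \<tau>#}) (\<tau> - {pivot \<alpha> \<tau>}) = shuffle_sign {pivot \<alpha> \<tau>} (\<tau> - {pivot \<alpha> \<tau>}) * v \<alpha> \<tau>"
    proof -
      have "Suc (size (\<alpha> - {#pivot \<alpha> \<tau>#})) = k" using m(1) that(1) by (simp add: size_Suc_Diff1)
      then show ?thesis using m upper_to_lower[OF that(2)] by (simp add: w_def insert_absorb)
    qed
    finally show ?thesis by (simp add: shuffle_sign_square_left)
  qed
  then show ?thesis
    by (intro exI[of _ e]) (auto simp: e intro!: exterior_eqI simp: w_def zero_exterior.rep_eq)
qed

lemma koszul_cocycle_odd_eq_0:
  fixes c :: "'n::{finite,linorder} multiset \<Rightarrow> ('r::idom, 'n) exterior"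
  assumes two_neq_0: "(2 :: 'r) \<noteq> 0" and c: "koszul_diff c = (\<lambda>\<alpha>. 0)"
    and trivial: "odd (card (UNIV :: 'n set)) \<Longrightarrow> ext_coeff (c {#}) UNIV = 0"
    and upper: "\<And>\<alpha> \<tau>. upper \<alpha> \<tau> \<Longrightarrow> odd (size \<alpha> + card \<tau>) \<Longrightarrow> ext_coeff (c \<alpha>) \<tau> = 0"
    and odd_pair: "odd (size \<alpha> + card \<tau>)"
  shows "ext_coeff (c \<alpha>) \<tau> = 0"
  using pivot_cases[of \<alpha> \<tau>]
proof (elim disjE)
  assume low: "lower \<alpha> \<tau>"
  let ?m = "pivot \<alpha> \<tau>"
  let ?\<alpha> = "add_mset ?m \<alpha>" and ?\<tau> = "insert ?m \<tau>"
  have m: "?m \<notin> \<tau>" using low by (simp add: lower_def)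
  have odd: "odd (size ?\<alpha> + card ?\<tau>)" using odd_pair m by simp
  have "2 * wedge_diff (\<lambda>\<beta>. ext_coeff (c \<beta>)) ?\<alpha> ?\<tau> = ext_coeff (koszul_diff c ?\<alpha>) ?\<tau>"
    using odd by (simp only: ext_coeff_koszul_diff if_True not_False_eq_True)
  then have "2 * wedge_diff (\<lambda>\<beta>. ext_coeff (c \<beta>)) ?\<alpha> ?\<tau> = 0"
    unfolding c by (simp add: zero_exterior.rep_eq)
  then have "wedge_diff (\<lambda>\<beta>. ext_coeff (c \<beta>)) ?\<alpha> ?\<tau> = 0" using two_neq_0 by simp
  moreover have "wedge_diff (\<lambda>\<beta>. ext_coeff (c \<beta>)) ?\<alpha> ?\<tau> = shuffle_sign {?m} \<tau> * ext_coeff (c \<alpha>) \<tau>"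
    using wedge_diff_upper[OF lower_to_upper(1)[OF low], of "\<lambda>\<beta>. ext_coeff (c \<beta>)"] upper odd m
    by (simp add: lower_to_upper(2)[OF low])
  ultimately have "shuffle_sign {?m} \<tau> * (shuffle_sign {?m} \<tau> * ext_coeff (c \<alpha>) \<tau>) = 0" by simp
  then show ?thesis by (simp only: shuffle_sign_square_left)
qed (use assms in auto)

lemma koszul_cocycle_exists:
  fixes v :: "'n::{finite,linorder} multiset \<Rightarrow> 'n set \<Rightarrow> 'r::idom"
  assumes two_neq_0: "(2 :: 'r) \<noteq> 0"
  shows "\<exists>c. (\<forall>\<alpha>. size \<alpha> \<noteq> k \<longrightarrow> c \<alpha> = 0) \<and> koszul_diff c = (\<lambda>\<alpha>. 0) \<and>
    (\<forall>\<alpha> \<tau>. size \<alpha> = k \<longrightarrow> even (k + card \<tau>) \<or> \<alpha> = {#} \<and> \<tau> = UNIV \<or> upper \<alpha> \<tau> \<longrightarrow> ext_coeff (c \<alpha>) \<tau> = v \<alpha> \<tau>)"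
proof -
  obtain e where e: "\<And>\<alpha>. Suc (size \<alpha>) \<noteq> k \<Longrightarrow> e \<alpha> = 0"
    "\<And>\<alpha> \<tau>. size \<alpha> = k \<Longrightarrow> upper \<alpha> \<tau> \<Longrightarrow> wedge_diff (\<lambda>\<beta>. ext_coeff (e \<beta>)) \<alpha> \<tau> = v \<alpha> \<tau>"
    using wedge_diff_solve[of k v] by blast
  let ?D = "wedge_diff (\<lambda>\<beta>. ext_coeff (e \<beta>))"
  define w where "w \<alpha> \<tau> = (if size \<alpha> \<noteq> k then 0 else if even (k + card \<tau>) \<or> \<alpha> = {#} \<and> \<tau> = UNIV then v \<alpha> \<tau>
    else ?D \<alpha> \<tau>)" for \<alpha> \<tau>
  define c where "c \<alpha> = Exterior (w \<alpha>)" for \<alpha>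
  have c: "ext_coeff (c \<alpha>) = w \<alpha>" for \<alpha> by (simp add: c_def Exterior_inverse)
  have c0: "c \<alpha> = 0" if "size \<alpha> \<noteq> k" for \<alpha>
    using that by (intro exterior_eqI) (simp add: c w_def zero_exterior.rep_eq)
  have "ext_coeff (koszul_diff c \<alpha>) \<tau> = 0" for \<alpha> \<tau>
  proof (cases "size \<alpha> = Suc k \<and> odd (size \<alpha> + card \<tau>)")
    case True
    have "w (\<alpha> - {#i#}) (\<tau> - {i}) = ?D (\<alpha> - {#i#}) (\<tau> - {i})" if i: "i \<in># \<alpha>" "i \<in> \<tau>" for i
    proof -
      have "size (\<alpha> - {#i#}) = k" using i(1) True size_Suc_Diff1[of i \<alpha>] by simp
      moreover have "Suc (card (\<tau> - {i})) = card \<tau>" using i(2) by (intro card_Suc_Diff1) auto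
      then have "odd (k + card (\<tau> - {i}))" using True by (auto simp flip: \<open>Suc (card (\<tau> - {i})) = card \<tau>\<close>)
      ultimately show ?thesis by (auto simp: w_def)
    qed
    then have "wedge_diff w \<alpha> \<tau> = wedge_diff ?D \<alpha> \<tau>" unfolding wedge_diff_def[of _ \<alpha>] by (intro sum.cong) auto
    moreover have "wedge_diff ?D \<alpha> \<tau> = 0"
    proof (cases k)
      case 0
      then have "e = (\<lambda>\<alpha>. 0)" using e(1) by auto
      then show ?thesis by (simp add: wedge_diff_def zero_exterior.rep_eq)
    next
      case (Suc j)
      have "koszul_diff (koszul_diff e) = (\<lambda>\<alpha>. 0)"
        by (rule koszul_diff_koszul_diff[of j]) (use e(1) Suc in auto)
      then have "ext_coeff (koszul_diff (koszul_diff e) \<alpha>) \<tau> = 0" by (simp add: zero_exterior.rep_eq)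
      then have "2 * wedge_diff (\<lambda>\<beta>. ext_coeff (koszul_diff e \<beta>)) \<alpha> \<tau> = 0"
        using True two_neq_0 by (subst (asm) ext_coeff_koszul_diff) (auto split: if_splits)
      also have "wedge_diff (\<lambda>\<beta>. ext_coeff (koszul_diff e \<beta>)) \<alpha> \<tau> = 2 * wedge_diff ?D \<alpha> \<tau>"
        unfolding wedge_diff_def[of _ \<alpha>] sum_distrib_left
      proof (intro sum.cong refl)
        fix i assume i: "i \<in> set_mset \<alpha> \<inter> \<tau>"
        have 1: "Suc (size (\<alpha> - {#i#})) = size \<alpha>" using i by (simp add: size_Suc_Diff1)
        have 2: "Suc (card (\<tau> - {i})) = card \<tau>" using i by (intro card_Suc_Diff1) auto
        have "odd (size (\<alpha> - {#i#}) + card (\<tau> - {i}))"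
          using conjunct2[OF True] unfolding 1[symmetric] 2[symmetric] by simp
        then show "shuffle_sign {i} (\<tau> - {i}) * ext_coeff (koszul_diff e (\<alpha> - {#i#})) (\<tau> - {i}) =
            2 * (shuffle_sign {i} (\<tau> - {i}) * ?D (\<alpha> - {#i#}) (\<tau> - {i}))"
          by (simp only: ext_coeff_koszul_diff if_True not_False_eq_True) (simp add: mult_ac)
      qed
      finally have "2 * (2 * wedge_diff ?D \<alpha> \<tau>) = 0" .
      then show ?thesis using two_neq_0 by (simp only: mult_eq_0_iff simp_thms)
    qed
    ultimately show ?thesis by (simp add: ext_coeff_koszul_diff c)
  next
    case False
    then consider "size \<alpha> \<noteq> Suc k" | "even (size \<alpha> + card \<tau>)" by blast
    then show ?thesis
    proof cases
      case 1
      with koszul_diff_off_degree[of k c \<alpha>] c0 show ?thesis by (simp add: zero_exterior.rep_eq)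
    qed (simp add: ext_coeff_koszul_diff)
  qed
  then have "koszul_diff c = (\<lambda>\<alpha>. 0)" by (intro ext exterior_eqI) (simp add: zero_exterior.rep_eq)
  moreover have "ext_coeff (c \<alpha>) \<tau> = v \<alpha> \<tau>" if "size \<alpha> = k" "even (k + card \<tau>) \<or> \<alpha> = {#} \<and> \<tau> = UNIV \<or> upper \<alpha> \<tau>" for \<alpha> \<tau>
    using that e(2) by (auto simp: c w_def)
  ultimately show ?thesis using c0 by (intro exI[of _ c]) auto
qed

lemma koszul_coboundary_iff:
  fixes c :: "'n::{finite,linorder} multiset \<Rightarrow> ('r::idom, 'n) exterior"
  assumes two_neq_0: "(2 :: 'r) \<noteq> 0" and c: "\<And>\<alpha>. size \<alpha> \<noteq> k \<Longrightarrow> c \<alpha> = 0" "koszul_diff c = (\<lambda>\<alpha>. 0)"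
  shows "(\<exists>e. (\<forall>\<alpha>. Suc (size \<alpha>) \<noteq> k \<longrightarrow> e \<alpha> = 0) \<and> c = koszul_diff e) \<longleftrightarrow>
    (\<forall>\<alpha> \<tau>. size \<alpha> = k \<longrightarrow> even (k + card \<tau>) \<or> \<alpha> = {#} \<and> \<tau> = UNIV \<longrightarrow> ext_coeff (c \<alpha>) \<tau> = 0) \<and>
    (\<forall>\<alpha> \<tau>. size \<alpha> = k \<longrightarrow> odd (k + card \<tau>) \<longrightarrow> upper \<alpha> \<tau> \<longrightarrow> 2 dvd ext_coeff (c \<alpha>) \<tau>)"
    (is "?L \<longleftrightarrow> ?R")
proof
  assume ?L
  then obtain e where "c = koszul_diff e" by blast
  then show ?R by (auto simp: ext_coeff_koszul_diff wedge_diff_def[of _ "{#}"])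
next
  assume R: ?R
  define v where "v \<alpha> \<tau> = (SOME y. ext_coeff (c \<alpha>) \<tau> = 2 * y)" for \<alpha> \<tau>
  obtain e where e: "\<And>\<alpha>. Suc (size \<alpha>) \<noteq> k \<Longrightarrow> e \<alpha> = 0"
    "\<And>\<alpha> \<tau>. size \<alpha> = k \<Longrightarrow> upper \<alpha> \<tau> \<Longrightarrow> wedge_diff (\<lambda>\<beta>. ext_coeff (e \<beta>)) \<alpha> \<tau> = v \<alpha> \<tau>"
    using wedge_diff_solve[of k v] by blast
  define d where "d \<alpha> = c \<alpha> - koszul_diff e \<alpha>" for \<alpha>
  have e_off: "koszul_diff e \<alpha> = 0" if "size \<alpha> \<noteq> k" for \<alpha>
    unfolding koszul_diff_def using that e(1) by (intro sum.neutral) (auto dest!: multi_member_split)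
  have "koszul_diff (koszul_diff e) = (\<lambda>\<alpha>. 0)"
  proof (cases k)
    case 0
    then have "e = (\<lambda>\<alpha>. 0)" using e(1) by auto
    then show ?thesis by (simp only: koszul_diff_zero)
  next
    case (Suc j)
    then show ?thesis using e(1) by (intro koszul_diff_koszul_diff[of j]) auto
  qed
  moreover have "koszul_diff d \<alpha> = koszul_diff c \<alpha> - koszul_diff (koszul_diff e) \<alpha>" for \<alpha>
    unfolding koszul_diff_def[of d] koszul_diff_def[of c] koszul_diff_def[of "koszul_diff e"] sum_subtractf[symmetric]
    by (intro sum.cong refl) (simp add: d_def algebra_simps)
  ultimately have d: "koszul_diff d = (\<lambda>\<alpha>. 0)" using c(2) by (intro ext) simp
  have coeff: "ext_coeff (d \<alpha>) \<tau> = ext_coeff (c \<alpha>) \<tau> - ext_coeff (koszul_diff e \<alpha>) \<tau>" for \<alpha> \<tau>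
    by (simp add: d_def minus_exterior.rep_eq)
  have off: "ext_coeff (d \<alpha>) \<tau> = 0" if "size \<alpha> \<noteq> k" for \<alpha> \<tau>
    using that by (simp add: d_def c(1) e_off zero_exterior.rep_eq)
  have "ext_coeff (d \<alpha>) \<tau> = 0" for \<alpha> \<tau>
  proof (cases "odd (size \<alpha> + card \<tau>)")
    case True
    show ?thesis
    proof (rule koszul_cocycle_odd_eq_0[OF two_neq_0 d _ _ True])
      show "ext_coeff (d {#}) UNIV = 0"
        using R off[of "{#}" UNIV] by (cases "k = 0") (auto simp: coeff ext_coeff_koszul_diff wedge_diff_def)
    next
      fix \<beta> :: "'n multiset" and \<rho> assume up: "upper \<beta> \<rho>" "odd (size \<beta> + card \<rho>)"
      show "ext_coeff (d \<beta>) \<rho> = 0"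
      proof (cases "size \<beta> = k")
        case True
        with R up have "2 dvd ext_coeff (c \<beta>) \<rho>" by blast
        then have "ext_coeff (c \<beta>) \<rho> = 2 * v \<beta> \<rho>" unfolding v_def by (rule someI_ex[OF dvdE]) blast
        with True up e(2) show ?thesis by (simp add: coeff ext_coeff_koszul_diff)
      qed (rule off)
    qed
  next
    case False
    then show ?thesis
      using R off by (cases "size \<alpha> = k") (auto simp: coeff ext_coeff_koszul_diff)
  qed
  then have "d \<alpha> = 0" for \<alpha> by (intro exterior_eqI) (simp add: zero_exterior.rep_eq)
  then have "c = koszul_diff e" by (intro ext) (simp add: d_def)
  with e(1) show ?L by blast
qed

section \<open>Counting\<close>

definition pairs :: "nat \<Rightarrow> ('n multiset \<times> 'n::{finite,linorder} set) set" where
  "pairs k = multisets_of_size UNIV k \<times> UNIV"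

definition free_pairs :: "nat \<Rightarrow> ('n multiset \<times> 'n::{finite,linorder} set) set" where
  "free_pairs k = {(\<alpha>, \<tau>) \<in> pairs k. even (k + card \<tau>) \<or> \<alpha> = {#} \<and> \<tau> = UNIV}"

definition torsion_pairs :: "nat \<Rightarrow> ('n multiset \<times> 'n::{finite,linorder} set) set" where
  "torsion_pairs k = {(\<alpha>, \<tau>) \<in> pairs k. odd (k + card \<tau>) \<and> upper \<alpha> \<tau>}"

lemma finite_pairs: "finite (pairs k :: ('n multiset \<times> 'n::{finite,linorder} set) set)"
  by (simp add: pairs_def finite_multisets_of_size)

lemma finite_free_torsion_pairs:
  "finite (free_pairs k :: ('n multiset \<times> 'n::{finite,linorder} set) set)"
  "finite (torsion_pairs k :: ('n multiset \<times> 'n::{finite,linorder} set) set)"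
  by (rule finite_subset[OF _ finite_pairs[of k]]; auto simp: free_pairs_def torsion_pairs_def)+

lemma pairs_iff: "(\<alpha>, \<tau>) \<in> pairs k \<longleftrightarrow> size \<alpha> = k"
  by (simp add: pairs_def multisets_of_size_def)

context
  fixes n :: nat
  assumes n: "n = card (UNIV :: 'n::{finite,linorder} set)"
begin

lemma n_pos: "0 < n"
  by (simp add: n card_gt_0_iff)

lemma card_subsets: "card (UNIV :: 'n set set) = 2 ^ n"
  using card_Pow[of "UNIV :: 'n set"] by (simp add: n)

lemma card_pairs: "card (pairs k :: ('n multiset \<times> 'n set) set) = 2 ^ n * ((n + k - 1) choose k)"
  using card_subsets by (simp add: pairs_def card_cartesian_product card_multisets_of_size n mult.commute)

lemma card_even_odd_subsets:
  "card {\<tau> :: 'n set. even (card \<tau>)} = 2 ^ (n - 1)" "card {\<tau> :: 'n set. odd (card \<tau>)} = 2 ^ (n - 1)"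
proof -
  have eq: "card {\<tau> :: 'n set. even (card \<tau>)} = card {\<tau> :: 'n set. odd (card \<tau>)}"
    using card_subsupersets_even_odd[of "UNIV :: 'n set" "{}"] by auto
  have "{\<tau> :: 'n set. even (card \<tau>)} \<union> {\<tau>. odd (card \<tau>)} = UNIV" by auto
  moreover have "card ({\<tau> :: 'n set. even (card \<tau>)} \<union> {\<tau>. odd (card \<tau>)}) =
      card {\<tau> :: 'n set. even (card \<tau>)} + card {\<tau> :: 'n set. odd (card \<tau>)}"
    by (intro card_Un_disjoint) auto
  ultimately have "card {\<tau> :: 'n set. even (card \<tau>)} + card {\<tau> :: 'n set. odd (card \<tau>)} = 2 ^ n"
    using card_subsets by simp
  also have "(2 :: nat) ^ n = 2 * 2 ^ (n - 1)" using n_pos by (cases n) auto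
  finally show "card {\<tau> :: 'n set. even (card \<tau>)} = 2 ^ (n - 1)" "card {\<tau> :: 'n set. odd (card \<tau>)} = 2 ^ (n - 1)"
    using eq by simp_all
qed

lemma card_parity_subsets: "card {\<tau> :: 'n set. even (k + card \<tau>) = b} = 2 ^ (n - 1)"
proof -
  have "{\<tau> :: 'n set. even (k + card \<tau>) = b} = {\<tau>. even (card \<tau>)} \<or>
      {\<tau> :: 'n set. even (k + card \<tau>) = b} = {\<tau>. odd (card \<tau>)}"
    by (cases "even k"; cases b) simp_all
  then show ?thesis using card_even_odd_subsets by auto
qed

lemma card_parity_pairs:
  "card {(\<alpha>, \<tau>) \<in> (pairs k :: ('n multiset \<times> 'n set) set). even (k + card \<tau>) = b} = 2 ^ (n - 1) * ((n + k - 1) choose k)"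
proof -
  have "{(\<alpha>, \<tau>) \<in> (pairs k :: ('n multiset \<times> 'n set) set). even (k + card \<tau>) = b} =
      multisets_of_size UNIV k \<times> {\<tau>. even (k + card \<tau>) = b}"
    by (auto simp: pairs_def)
  then show ?thesis
    by (simp only: card_cartesian_product card_parity_subsets) (simp add: card_multisets_of_size n mult.commute)
qed

lemma card_free_pairs:
  "card (free_pairs k :: ('n multiset \<times> 'n set) set) =
    2 ^ (n - 1) * ((n + k - 1) choose k) + (if k = 0 \<and> odd n then 1 else 0)"
proof -
  let ?E = "{(\<alpha>, \<tau>) \<in> (pairs k :: ('n multiset \<times> 'n set) set). even (k + card \<tau>) = True}"
  have "finite ?E" by (rule finite_subset[OF _ finite_pairs[of k]]) auto
  moreover have "(free_pairs k :: ('n multiset \<times> 'n set) set) = ?E \<union> (if k = 0 \<and> odd n then {({#}, UNIV)} else {})"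
    by (auto simp: free_pairs_def pairs_iff n)
  moreover have "?E \<inter> (if k = 0 \<and> odd n then {({#}, UNIV)} else {}) = {}"
    by (auto simp: n)
  ultimately have "card (free_pairs k :: ('n multiset \<times> 'n set) set) = card ?E + (if k = 0 \<and> odd n then 1 else 0)"
    by (simp add: card_Un_disjoint)
  then show ?thesis by (simp only: card_parity_pairs)
qed

lemma card_torsion_pairs_Suc:
  "card (torsion_pairs (Suc k) :: ('n multiset \<times> 'n set) set) + card (torsion_pairs k :: ('n multiset \<times> 'n set) set) +
    (if k = 0 \<and> odd n then 1 else 0) = 2 ^ (n - 1) * ((n + k - 1) choose k)"
proof -
  define S where "S = {(\<alpha>, \<tau>) \<in> (pairs k :: ('n multiset \<times> 'n set) set). odd (k + card \<tau>) \<and> lower \<alpha> \<tau>}"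
  have fin: "finite S" unfolding S_def by (rule finite_subset[OF _ finite_pairs[of k]]) auto
  have "bij_betw (\<lambda>(\<alpha>, \<tau>). (add_mset (pivot \<alpha> \<tau>) \<alpha>, insert (pivot \<alpha> \<tau>) \<tau>)) S (torsion_pairs (Suc k))"
  proof (rule bij_betwI[where g = "\<lambda>(\<alpha>, \<tau>). (\<alpha> - {#pivot \<alpha> \<tau>#}, \<tau> - {pivot \<alpha> \<tau>})"])
    show "(\<lambda>(\<alpha>, \<tau>). (add_mset (pivot \<alpha> \<tau>) \<alpha>, insert (pivot \<alpha> \<tau>) \<tau>)) \<in> S \<rightarrow> torsion_pairs (Suc k)"
      by (auto simp: S_def torsion_pairs_def pairs_iff lower_to_upper(1)) (auto simp: lower_def card_insert_if)
    show "(\<lambda>(\<alpha>, \<tau>). (\<alpha> - {#pivot \<alpha> \<tau>#}, \<tau> - {pivot \<alpha> \<tau>})) \<in> torsion_pairs (Suc k) \<rightarrow> S"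
    proof
      fix p :: "'n multiset \<times> 'n set" assume "p \<in> torsion_pairs (Suc k)"
      then obtain \<alpha> \<tau> where p: "p = (\<alpha>, \<tau>)" "size \<alpha> = Suc k" "odd (Suc k + card \<tau>)" "upper \<alpha> \<tau>"
        by (cases p) (auto simp: torsion_pairs_def pairs_iff)
      note m = upper_pivot[OF p(4)]
      have "Suc (card (\<tau> - {pivot \<alpha> \<tau>})) = card \<tau>" using m by (intro card_Suc_Diff1) auto
      then have "odd (k + card (\<tau> - {pivot \<alpha> \<tau>}))" using p(3) by (metis add_Suc add_Suc_right even_Suc)
      moreover have "size (\<alpha> - {#pivot \<alpha> \<tau>#}) = k" using size_Suc_Diff1[OF m(1)] p(2) by simp
      ultimately show "(case p of (\<alpha>, \<tau>) \<Rightarrow> (\<alpha> - {#pivot \<alpha> \<tau>#}, \<tau> - {pivot \<alpha> \<tau>})) \<in> S"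
        using upper_to_lower(1)[OF p(4)] by (simp add: S_def p(1) pairs_iff)
    qed
    show "(case case p of (\<alpha>, \<tau>) \<Rightarrow> (add_mset (pivot \<alpha> \<tau>) \<alpha>, insert (pivot \<alpha> \<tau>) \<tau>) of
        (\<alpha>, \<tau>) \<Rightarrow> (\<alpha> - {#pivot \<alpha> \<tau>#}, \<tau> - {pivot \<alpha> \<tau>})) = p" if "p \<in> S" for p
      using that by (auto simp: S_def lower_to_upper(2)) (auto simp: lower_def)
    show "(case case p of (\<alpha>, \<tau>) \<Rightarrow> (\<alpha> - {#pivot \<alpha> \<tau>#}, \<tau> - {pivot \<alpha> \<tau>}) of
        (\<alpha>, \<tau>) \<Rightarrow> (add_mset (pivot \<alpha> \<tau>) \<alpha>, insert (pivot \<alpha> \<tau>) \<tau>)) = p" if "p \<in> torsion_pairs (Suc k)" for p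
      using that by (auto simp: torsion_pairs_def upper_to_lower(2) upper_pivot insert_absorb)
  qed
  then have S: "card S = card (torsion_pairs (Suc k) :: ('n multiset \<times> 'n set) set)" by (rule bij_betw_same_card)
  let ?O = "{(\<alpha>, \<tau>) \<in> (pairs k :: ('n multiset \<times> 'n set) set). even (k + card \<tau>) = False}"
  let ?T = "if k = 0 \<and> odd n then {({#}, UNIV)} else {} :: ('n multiset \<times> 'n set) set"
  have "p \<in> ?O \<longleftrightarrow> p \<in> (S \<union> torsion_pairs k) \<union> ?T" for p
    using pivot_cases[of "fst p" "snd p"] by (cases p) (auto simp: S_def torsion_pairs_def pairs_iff n)
  then have "?O = (S \<union> torsion_pairs k) \<union> ?T" by blast
  moreover have "card ((S \<union> torsion_pairs k) \<union> ?T) = card (S \<union> torsion_pairs k) + card ?T"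
    using fin finite_free_torsion_pairs(2)[of k]
    by (intro card_Un_disjoint) (auto simp: S_def torsion_pairs_def lower_def upper_def)
  moreover have "card (S \<union> torsion_pairs k) = card S + card (torsion_pairs k :: ('n multiset \<times> 'n set) set)"
    using fin finite_free_torsion_pairs(2)[of k]
    by (intro card_Un_disjoint) (auto simp: S_def torsion_pairs_def lower_def upper_def)
  ultimately have "card ?O = card S + card (torsion_pairs k :: ('n multiset \<times> 'n set) set) + (if k = 0 \<and> odd n then 1 else 0)"
    by simp
  with S show ?thesis by (simp only: card_parity_pairs)
qed

lemma card_torsion_pairs:
  "int (card (torsion_pairs k :: ('n multiset \<times> 'n set) set)) =
    2 ^ (n - 1) * (\<Sum>i<k. (- 1) ^ (k - 1 - i) * int ((n + i - 1) choose i)) + (if odd n \<and> k \<ge> 1 then (- 1) ^ k else 0)"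
proof (induction k)
  case 0
  have "(torsion_pairs 0 :: ('n multiset \<times> 'n set) set) = {}"
    using upper_pivot(1) by (fastforce simp: torsion_pairs_def pairs_iff)
  then show ?case by simp
next
  case (Suc k)
  have "int (card (torsion_pairs (Suc k) :: ('n multiset \<times> 'n set) set)) =
      2 ^ (n - 1) * int ((n + k - 1) choose k) - int (card (torsion_pairs k :: ('n multiset \<times> 'n set) set)) -
      (if k = 0 \<and> odd n then 1 else 0)"
    using arg_cong[OF card_torsion_pairs_Suc[of k], of int] by (auto split: if_splits)
  moreover have "(\<Sum>i<k. (- 1) ^ (k - i) * int ((n + i - 1) choose i)) = - (\<Sum>i<k. (- 1) ^ (k - 1 - i) * int ((n + i - 1) choose i))"
    unfolding sum_negf[symmetric]
  proof (intro sum.cong refl)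
    fix i assume "i \<in> {..<k}"
    then have "k - i = Suc (k - 1 - i)" by auto
    then show "(- 1) ^ (k - i) * int ((n + i - 1) choose i) = - ((- 1) ^ (k - 1 - i) * int ((n + i - 1) choose i))"
      by (simp only: power_Suc)
  qed
  ultimately show ?case
    unfolding Suc.IH by (cases "k = 0") (auto simp: algebra_simps)
qed

end

section \<open>Hochschild cohomology in coordinates\<close>

definition coord :: "nat \<Rightarrow> ('r::comm_ring_1, 'n::{finite,linorder}) cochain \<Rightarrow> 'n multiset \<times> 'n set \<Rightarrow> 'r" where
  "coord k f p = ext_coeff (symbol k f (fst p)) (snd p)"

lemma coord_add: "coord k (\<lambda>t. f t + g t) p = coord k f p + coord k g p"
  by (simp add: coord_def symbol_linear plus_exterior.rep_eq)

lemma coord_scale: "coord k (\<lambda>t. ext_scale r (f t)) p = r * coord k f p"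
  by (simp add: coord_def symbol_linear ext_scale.rep_eq)

lemma coord_0: "coord k (\<lambda>t. 0) p = 0"
  using coord_scale[of k 0 "\<lambda>t. 0" p] by simp

lemma coord_diff: "coord k (\<lambda>t. f t - g t) p = coord k f p - coord k g p"
  using coord_add[of k "\<lambda>t. f t - g t" g p] by simp

lemma cocycles_closed:
  assumes "f \<in> cocycles k"
  shows "(\<lambda>t. ext_scale r (f t)) \<in> cocycles k"
    and "g \<in> cocycles k \<Longrightarrow> (\<lambda>t. f t + g t) \<in> cocycles k"
    and "g \<in> cocycles k \<Longrightarrow> (\<lambda>t. f t - g t) \<in> cocycles k"
proof -
  have iff: "h \<in> cocycles k \<longleftrightarrow> h \<in> cochains k \<and> (\<forall>t\<in>bar_module (Suc k). h (bar_differential t) = 0)"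
    for h :: "('a, 'b) cochain"
    by (auto simp: cocycles_def coboundary_def fun_eq_iff)
  have scale: "(\<lambda>t. ext_scale r (f t)) \<in> cocycles k" if "f \<in> cocycles k" for r and f :: "('a, 'b) cochain"
    using that unfolding iff
    by (auto simp: cochains_iff ext.scale_right_distrib mult.commute ext_scale_mult_left ext_scale_mult_right)
  have add: "(\<lambda>t. f t + g t) \<in> cocycles k" if "f \<in> cocycles k" "g \<in> cocycles k" for f g :: "('a, 'b) cochain"
    using that unfolding iff
    by (auto simp: cochains_iff ext.scale_right_distrib distrib_left distrib_right)
  show "(\<lambda>t. ext_scale r (f t)) \<in> cocycles k" by (rule scale) (rule assms)
  show "(\<lambda>t. f t + g t) \<in> cocycles k" if "g \<in> cocycles k" by (rule add) (rule assms that)+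
  show "(\<lambda>t. f t - g t) \<in> cocycles k" if "g \<in> cocycles k"
    using add[OF assms scale[OF that, of "- 1"]] by simp
qed

lemma cocycle_of_coords:
  fixes v :: "'n::{finite,linorder} multiset \<times> 'n set \<Rightarrow> 'r::idom"
  assumes "(2 :: 'r) \<noteq> 0"
  shows "\<exists>f\<in>cocycles k. \<forall>p\<in>free_pairs k \<union> torsion_pairs k. coord k f p = v p"
proof -
  obtain c where c: "\<And>\<alpha>. size \<alpha> \<noteq> k \<Longrightarrow> c \<alpha> = 0" "koszul_diff c = (\<lambda>\<alpha>. 0)"
    "\<And>\<alpha> \<tau>. size \<alpha> = k \<Longrightarrow> even (k + card \<tau>) \<or> \<alpha> = {#} \<and> \<tau> = UNIV \<or> upper \<alpha> \<tau> \<Longrightarrow> ext_coeff (c \<alpha>) \<tau> = v (\<alpha>, \<tau>)"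
    using koszul_cocycle_exists[OF assms, of k "\<lambda>\<alpha> \<tau>. v (\<alpha>, \<tau>)"] by blast
  obtain f where "f \<in> cocycles k" "symbol k f = c" using symbol_surj[of k c] c(1,2) by blast
  with c(3) show ?thesis
    by (intro bexI[of _ f]) (auto simp: coord_def free_pairs_def torsion_pairs_def pairs_iff)
qed

lemma coboundaries_iff_coord:
  fixes f :: "('r::idom, 'n::{finite,linorder}) cochain"
  assumes "(2 :: 'r) \<noteq> 0" and f: "f \<in> cocycles k"
  shows "f \<in> coboundaries k \<longleftrightarrow>
    (\<forall>p\<in>free_pairs k. coord k f p = 0) \<and> (\<forall>p\<in>torsion_pairs k. 2 dvd coord k f p)"
proof -
  have "f \<in> coboundaries k \<longleftrightarrow>
      (\<forall>\<alpha> \<tau>. size \<alpha> = k \<longrightarrow> even (k + card \<tau>) \<or> \<alpha> = {#} \<and> \<tau> = UNIV \<longrightarrow> ext_coeff (symbol k f \<alpha>) \<tau> = 0) \<and>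
      (\<forall>\<alpha> \<tau>. size \<alpha> = k \<longrightarrow> odd (k + card \<tau>) \<longrightarrow> upper \<alpha> \<tau> \<longrightarrow> 2 dvd ext_coeff (symbol k f \<alpha>) \<tau>)"
    unfolding coboundaries_iff_symbol[OF f]
    by (rule koszul_coboundary_iff[OF assms(1)]) (simp_all only: symbol_off_degree symbol_cocycle[OF f] not_False_eq_True)
  then show ?thesis by (auto simp: coord_def free_pairs_def torsion_pairs_def pairs_iff)
qed

lemma koszul_diff_char_2:
  assumes "(2 :: 'r::comm_ring_1) = 0"
  shows "koszul_diff (c :: 'n::{finite,linorder} multiset \<Rightarrow> ('r, 'n) exterior) = (\<lambda>\<alpha>. 0)"
  using assms by (intro ext exterior_eqI) (simp add: ext_coeff_koszul_diff zero_exterior.rep_eq)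

lemma cocycle_of_coords_char_2:
  fixes v :: "'n::{finite,linorder} multiset \<times> 'n set \<Rightarrow> 'r::comm_ring_1"
  assumes "(2 :: 'r) = 0"
  shows "\<exists>f\<in>cocycles k. \<forall>p\<in>pairs k. coord k f p = v p"
proof -
  define c where "c \<alpha> = (if size \<alpha> = k then Exterior (\<lambda>\<tau>. v (\<alpha>, \<tau>)) else 0)" for \<alpha>
  obtain f where "f \<in> cocycles k" "symbol k f = c"
    using symbol_surj[of k c] koszul_diff_char_2[OF assms] by (auto simp: c_def)
  then show ?thesis
    by (intro bexI[of _ f]) (auto simp: coord_def pairs_iff c_def Exterior_inverse)
qed

lemma coboundaries_iff_coord_char_2:
  fixes f :: "('r::comm_ring_1, 'n::{finite,linorder}) cochain"
  assumes "(2 :: 'r) = 0" and f: "f \<in> cocycles k"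
  shows "f \<in> coboundaries k \<longleftrightarrow> (\<forall>p\<in>pairs k. coord k f p = 0)"
proof -
  have "f \<in> coboundaries k \<longleftrightarrow> symbol k f = (\<lambda>\<alpha>. 0)"
    unfolding coboundaries_iff_symbol[OF f] koszul_diff_char_2[OF assms(1)] by auto
  also have "\<dots> \<longleftrightarrow> (\<forall>p\<in>pairs k. coord k f p = 0)"
  proof
    assume R: "\<forall>p\<in>pairs k. coord k f p = 0"
    have "symbol k f \<alpha> = 0" for \<alpha>
    proof (cases "size \<alpha> = k")
      case True
      then have "ext_coeff (symbol k f \<alpha>) \<tau> = 0" for \<tau>
        using bspec[OF R, of "(\<alpha>, \<tau>)"] by (simp add: coord_def pairs_iff)
      then show ?thesis by (intro exterior_eqI) (simp add: zero_exterior.rep_eq)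
    qed (rule symbol_off_degree)
    then show "symbol k f = (\<lambda>\<alpha>. 0)" by (intro ext)
  qed (simp add: coord_def zero_exterior.rep_eq)
  finally show ?thesis .
qed

text \<open>
  A surjective homomorphism \<open>\<theta>\<close> from the cocycles whose kernel consists of the coboundaries
  identifies the classes with its fibres.
\<close>

lemma HH_fibres:
  fixes \<theta> :: "('r::comm_ring_1, 'n::{finite,linorder}) cochain \<Rightarrow> 'p"
  assumes kernel: "\<forall>f\<in>cocycles k. \<forall>g\<in>cocycles k. \<theta> f = \<theta> g \<longleftrightarrow> (\<lambda>t. f t - g t) \<in> coboundaries k"
    and surj: "\<theta> ` cocycles k = P"
    and add: "\<And>f g. \<theta> (\<lambda>t. f t + g t) = comb (\<theta> f) (\<theta> g)"
  defines "fibre \<equiv> \<lambda>v. {f \<in> cocycles k. \<theta> f = v}"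
  shows "carrier (HH k) = fibre ` P" "inj_on fibre P" "\<zero>\<^bsub>HH k\<^esub> = fibre (\<theta> (\<lambda>t. 0))"
    and "\<And>v w. v \<in> P \<Longrightarrow> w \<in> P \<Longrightarrow> fibre v \<oplus>\<^bsub>HH k\<^esub> fibre w = fibre (comb v w)"
    and "\<And>r v. (\<And>f. \<theta> (\<lambda>t. ext_scale r (f t)) = scale (\<theta> f)) \<Longrightarrow> v \<in> P \<Longrightarrow>
      r \<odot>\<^bsub>HH k\<^esub> fibre v = fibre (scale v)"
proof -
  have ker: "\<theta> f = \<theta> g \<longleftrightarrow> (\<lambda>t. f t - g t) \<in> coboundaries k" if "f \<in> cocycles k" "g \<in> cocycles k" for f g
    using kernel that by blast
  have coset: "coboundaries k +>\<^bsub>cocycle_module k\<^esub> f = fibre (\<theta> f)" if f: "f \<in> cocycles k" for f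
  proof (intro equalityI subsetI)
    fix g assume "g \<in> coboundaries k +>\<^bsub>cocycle_module k\<^esub> f"
    then obtain h where h: "h \<in> coboundaries k" "g = (\<lambda>t. h t + f t)"
      by (auto simp: a_r_coset_def r_coset_def cocycle_module_def)
    then have g: "g \<in> cocycles k"
      using coboundaries_subset_cocycles f by (auto intro: cocycles_closed)
    then have "\<theta> g = \<theta> f" using ker[OF g f] h by simp
    with g show "g \<in> fibre (\<theta> f)" by (simp add: fibre_def)
  next
    fix g assume "g \<in> fibre (\<theta> f)"
    then have "(\<lambda>t. g t - f t) \<in> coboundaries k" using ker f by (auto simp: fibre_def)
    then show "g \<in> coboundaries k +>\<^bsub>cocycle_module k\<^esub> f"
      by (force simp: a_r_coset_def r_coset_def cocycle_module_def)
  qed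
  have preimage: "\<exists>f\<in>cocycles k. \<theta> f = v" if "v \<in> P" for v using that surj by auto
  show "carrier (HH k) = fibre ` P"
  proof -
    have "carrier (HH k) = (\<lambda>f. coboundaries k +>\<^bsub>cocycle_module k\<^esub> f) ` cocycles k"
      by (auto simp: HH_def quotient_module_def A_RCOSETS_def RCOSETS_def a_r_coset_def cocycle_module_def)
    also have "\<dots> = (\<lambda>f. fibre (\<theta> f)) ` cocycles k" by (intro image_cong refl coset)
    finally show ?thesis by (simp add: image_image flip: surj)
  qed
  show "inj_on fibre P"
    using preimage by (fastforce simp: inj_on_def fibre_def)
  show "\<zero>\<^bsub>HH k\<^esub> = fibre (\<theta> (\<lambda>t. 0))"
  proof -
    have "f \<in> coboundaries k \<longleftrightarrow> f \<in> fibre (\<theta> (\<lambda>t. 0))" for f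
      using ker[OF _ zero_in_cocycles, of f] coboundaries_subset_cocycles[of k] by (auto simp: fibre_def)
    then show ?thesis by (simp add: HH_def quotient_module_def set_eq_iff)
  qed
  show "fibre v \<oplus>\<^bsub>HH k\<^esub> fibre w = fibre (comb v w)" if "v \<in> P" "w \<in> P" for v w
  proof (intro equalityI subsetI)
    fix h assume "h \<in> fibre v \<oplus>\<^bsub>HH k\<^esub> fibre w"
    then show "h \<in> fibre (comb v w)"
      by (auto simp: HH_def quotient_module_def set_add_def set_mult_def cocycle_module_def fibre_def
          add intro: cocycles_closed)
  next
    fix h assume h: "h \<in> fibre (comb v w)"
    obtain f where f: "f \<in> cocycles k" "\<theta> f = v" using preimage \<open>v \<in> P\<close> by blast
    obtain g where g: "g \<in> cocycles k" "\<theta> g = w" using preimage \<open>w \<in> P\<close> by blast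
    have hc: "h \<in> cocycles k" and "\<theta> h = \<theta> (\<lambda>t. f t + g t)" using h f g by (auto simp: fibre_def add)
    then have "(\<lambda>t. h t - (f t + g t)) \<in> coboundaries k"
      using ker[OF hc cocycles_closed(2)[OF f(1) g(1)]] by simp
    then have "\<theta> (\<lambda>t. h t - g t) = \<theta> f"
      using ker[OF cocycles_closed(3)[OF hc g(1)] f(1)] by (simp add: algebra_simps)
    then have "(\<lambda>t. h t - g t) \<in> fibre v" using cocycles_closed(3)[OF hc g(1)] f by (simp add: fibre_def)
    moreover have "g \<in> fibre w" using g by (simp add: fibre_def)
    ultimately show "h \<in> fibre v \<oplus>\<^bsub>HH k\<^esub> fibre w"
      by (force simp: HH_def quotient_module_def set_add_def set_mult_def cocycle_module_def)
  qed
  show "r \<odot>\<^bsub>HH k\<^esub> fibre v = fibre (scale v)"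
    if scale: "\<And>f. \<theta> (\<lambda>t. ext_scale r (f t)) = scale (\<theta> f)" and "v \<in> P" for r v
  proof -
    have "r \<odot>\<^bsub>HH k\<^esub> fibre v = (\<Union>f\<in>fibre v. coboundaries k +>\<^bsub>cocycle_module k\<^esub> (\<lambda>t. ext_scale r (f t)))"
      by (simp add: HH_def quotient_module_def cocycle_module_def)
    also have "\<dots> = (\<Union>f\<in>fibre v. fibre (scale v))"
    proof (intro SUP_cong refl)
      fix f assume "f \<in> fibre v"
      then have "f \<in> cocycles k" "\<theta> f = v" by (simp_all add: fibre_def)
      then show "coboundaries k +>\<^bsub>cocycle_module k\<^esub> (\<lambda>t. ext_scale r (f t)) = fibre (scale v)"
        using coset[OF cocycles_closed(1)] scale by simp
    qed
    also have "\<dots> = fibre (scale v)"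
      using preimage[OF \<open>v \<in> P\<close>] by (auto simp: fibre_def)
    finally show ?thesis .
  qed
qed

lemma vectorspace_transport:
  fixes V :: "('f::field, 'm) module" and F :: "'f vec \<Rightarrow> 'm"
  assumes "carrier V = F ` carrier_vec m" "inj_on F (carrier_vec m)" "\<zero>\<^bsub>V\<^esub> = F (0\<^sub>v m)"
    and "\<And>v w. v \<in> carrier_vec m \<Longrightarrow> w \<in> carrier_vec m \<Longrightarrow> F v \<oplus>\<^bsub>V\<^esub> F w = F (v + w)"
    and "\<And>r v. v \<in> carrier_vec m \<Longrightarrow> r \<odot>\<^bsub>V\<^esub> F v = F (r \<cdot>\<^sub>v v)"
  shows "vectorspace class_ring V" "vectorspace.fin_dim class_ring V" "vectorspace.dim class_ring V = m"
proof -
  show vs: "vectorspace class_ring V"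
  proof (rule vs_criteria)
    show "\<forall>v\<in>carrier V. \<exists>w\<in>carrier V. v \<oplus>\<^bsub>V\<^esub> w = \<zero>\<^bsub>V\<^esub>"
    proof
      fix v assume "v \<in> carrier V"
      then obtain x where x: "x \<in> carrier_vec m" "v = F x" using assms(1) by auto
      then have "v \<oplus>\<^bsub>V\<^esub> F (- x) = \<zero>\<^bsub>V\<^esub>" by (simp add: assms)
      with x show "\<exists>w\<in>carrier V. v \<oplus>\<^bsub>V\<^esub> w = \<zero>\<^bsub>V\<^esub>" using assms(1) by auto
    qed
  qed (auto simp: assms class_field comm_add_vec assoc_add_vec smult_smult_assoc add_smult_distrib_vec
      smult_add_distrib_vec class_ring_simps)
  interpret vec_space "TYPE('f)" m .
  interpret W: vectorspace class_ring V by (rule vs)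
  have hom: "F \<in> LinearCombinations.module_hom class_ring (module_vec TYPE('f) m) V"
    unfolding LinearCombinations.module_hom_def using assms by (auto simp: module_vec_simps)
  interpret L: linear_map class_ring "module_vec TYPE('f) m" V F
    by (intro linear_map.intro mod_hom.intro mod_hom_axioms.intro hom vec_vs vs vec_module) (use vs in \<open>simp add: vectorspace_def\<close>)
  have surj: "F ` carrier (module_vec TYPE('f) m) = carrier V" by (simp add: assms(1) module_vec_simps)
  show "vectorspace.fin_dim class_ring V" by (rule L.rank_nullity_main(2)[OF fin_dim surj])
  show "vectorspace.dim class_ring V = m"
  proof (rule antisym)
    have "vectorspace.dim class_ring (V\<lparr>carrier := L.imT\<rparr>) + vectorspace.dim class_ring (module_vec TYPE('f) m\<lparr>carrier := L.kerT\<rparr>) = dim"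
      by (rule L.rank_nullity[OF fin_dim])
    then show "W.dim \<le> m" using L.surj_imp_imT_carrier[OF surj] by (simp add: dim_is_n)
  next
    define G where "G = inv_into (carrier_vec m) F"
    have G: "G (F v) = v" if "v \<in> carrier_vec m" for v
      using assms(2) that by (simp add: G_def)
    have homG: "G \<in> LinearCombinations.module_hom class_ring V (module_vec TYPE('f) m)"
      unfolding LinearCombinations.module_hom_def using assms by (auto simp: module_vec_simps G)
    interpret M: linear_map class_ring V "module_vec TYPE('f) m" G
      by (intro linear_map.intro mod_hom.intro mod_hom_axioms.intro homG vec_vs vs vec_module) (use vs in \<open>simp add: vectorspace_def\<close>)
    have "G ` carrier V = carrier (module_vec TYPE('f) m)"
      by (auto simp: assms(1) module_vec_simps image_image G)
    then have "module_vec TYPE('f) m\<lparr>carrier := M.imT\<rparr> = module_vec TYPE('f) m"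
      by (simp only: M.surj_imp_imT_carrier) simp
    moreover have "vectorspace.dim class_ring (module_vec TYPE('f) m\<lparr>carrier := M.imT\<rparr>) +
        vectorspace.dim class_ring (V\<lparr>carrier := M.kerT\<rparr>) = W.dim"
      by (rule M.rank_nullity[OF L.rank_nullity_main(2)[OF fin_dim surj]])
    ultimately have "dim + vectorspace.dim class_ring (V\<lparr>carrier := M.kerT\<rparr>) = W.dim"
      by (simp only:)
    then show "m \<le> W.dim" by (simp add: dim_is_n)
  qed
qed

lemma HH_vectorspace:
  fixes J :: "('n::{finite,linorder} multiset \<times> 'n set) set"
  assumes "finite J"
    and exists: "\<And>v. \<exists>f :: ('f::field, 'n) cochain \<in> cocycles k. \<forall>p\<in>J. coord k f p = v p"
    and ker: "\<forall>f :: ('f, 'n) cochain \<in> cocycles k. f \<in> coboundaries k \<longleftrightarrow> (\<forall>p\<in>J. coord k f p = 0)"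
  shows "vectorspace class_ring (HH k :: ('f, ('f, 'n) cochain set) module)"
    "vectorspace.fin_dim class_ring (HH k :: ('f, ('f, 'n) cochain set) module)"
    "vectorspace.dim class_ring (HH k :: ('f, ('f, 'n) cochain set) module) = card J"
proof -
  obtain e where e: "bij_betw e {..<card J} J"
    using ex_bij_betw_nat_finite[OF assms(1)] by (auto simp: atLeast0LessThan)
  define \<theta> :: "('f, 'n) cochain \<Rightarrow> 'f vec" where "\<theta> f = vec (card J) (\<lambda>i. coord k f (e i))" for f
  define fibre where "fibre v = {f \<in> cocycles k. \<theta> f = v}" for v
  have eq: "\<theta> f = \<theta> g \<longleftrightarrow> (\<forall>p\<in>J. coord k f p = coord k g p)" for f g
  proof -
    have "\<theta> f = \<theta> g \<longleftrightarrow> (\<forall>i\<in>{..<card J}. coord k f (e i) = coord k g (e i))"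
      by (auto simp: \<theta>_def vec_eq_iff)
    also have "\<dots> \<longleftrightarrow> (\<forall>p\<in>e ` {..<card J}. coord k f p = coord k g p)" by blast
    finally show ?thesis unfolding bij_betw_imp_surj_on[OF e] .
  qed
  have \<theta>: "\<theta> (\<lambda>t. f t + g t) = \<theta> f + \<theta> g" "\<theta> (\<lambda>t. ext_scale r (f t)) = r \<cdot>\<^sub>v \<theta> f" for f g r
    by (auto simp: \<theta>_def coord_add coord_scale)
  have zero: "\<theta> (\<lambda>t. 0) = 0\<^sub>v (card J)"
    by (auto simp: \<theta>_def coord_0)
  have surj: "\<theta> ` cocycles k = carrier_vec (card J)"
  proof
    show "carrier_vec (card J) \<subseteq> \<theta> ` cocycles k"
    proof
      fix v :: "'f vec" assume v: "v \<in> carrier_vec (card J)"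
      obtain f where f: "f \<in> cocycles k" "\<And>p. p \<in> J \<Longrightarrow> coord k f p = v $ inv_into {..<card J} e p"
        using exists[of "\<lambda>p. v $ inv_into {..<card J} e p"] by blast
      have "coord k f (e i) = v $ i" if "i < card J" for i
      proof -
        have "e i \<in> J" using e that by (auto simp: bij_betw_def)
        then show ?thesis using f(2)[of "e i"] bij_betw_inv_into_left[OF e, of i] that by simp
      qed
      then have "\<theta> f = v" using v by (intro eq_vecI) (auto simp: \<theta>_def)
      with f show "v \<in> \<theta> ` cocycles k" by blast
    qed
  qed (auto simp: \<theta>_def)
  have kernel: "\<forall>f\<in>cocycles k. \<forall>g\<in>cocycles k. \<theta> f = \<theta> g \<longleftrightarrow> (\<lambda>t. f t - g t) \<in> coboundaries k"
  proof (intro ballI)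
    fix f g :: "('f, 'n) cochain" assume "f \<in> cocycles k" "g \<in> cocycles k"
    from cocycles_closed(3)[OF this] show "\<theta> f = \<theta> g \<longleftrightarrow> (\<lambda>t. f t - g t) \<in> coboundaries k"
      using ker by (simp add: eq coord_diff)
  qed
  note fibres = HH_fibres[where \<theta> = \<theta> and comb = "(+)", OF kernel surj \<theta>(1), folded fibre_def]
  have "carrier (HH k) = fibre ` carrier_vec (card J)" "inj_on fibre (carrier_vec (card J))"
    "\<zero>\<^bsub>HH k\<^esub> = fibre (0\<^sub>v (card J))"
    "\<And>v w. v \<in> carrier_vec (card J) \<Longrightarrow> w \<in> carrier_vec (card J) \<Longrightarrow> fibre v \<oplus>\<^bsub>HH k\<^esub> fibre w = fibre (v + w)"
    "\<And>r v. v \<in> carrier_vec (card J) \<Longrightarrow> r \<odot>\<^bsub>HH k\<^esub> fibre v = fibre (r \<cdot>\<^sub>v v)"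
    using fibres(1-4) fibres(5)[OF \<theta>(2)] zero by simp_all
  note transport = vectorspace_transport[OF this]
  show "vectorspace class_ring (HH k :: ('f, ('f, 'n) cochain set) module)"
    "vectorspace.fin_dim class_ring (HH k :: ('f, ('f, 'n) cochain set) module)"
    "vectorspace.dim class_ring (HH k :: ('f, ('f, 'n) cochain set) module) = card J"
    by (rule transport; assumption)+
qed

lemma HH_int:
  "add_monoid (HH k :: (int, (int, 'n::{finite,linorder}) cochain set) module) \<cong>
    product_group {..<card (free_pairs k :: ('n multiset \<times> 'n set) set)} (\<lambda>_. integer_group) \<times>\<times>
    product_group {..<card (torsion_pairs k :: ('n multiset \<times> 'n set) set)} (\<lambda>_. integer_mod_group 2)"
proof -
  let ?J = "free_pairs k :: ('n multiset \<times> 'n set) set" and ?K = "torsion_pairs k :: ('n multiset \<times> 'n set) set"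
  let ?A = "product_group {..<card ?J} (\<lambda>_. integer_group)"
  let ?B = "product_group {..<card ?K} (\<lambda>_. integer_mod_group 2)"
  obtain a where a: "bij_betw a {..<card ?J} ?J"
    using ex_bij_betw_nat_finite[OF finite_free_torsion_pairs(1)] by (auto simp: atLeast0LessThan)
  obtain b where b: "bij_betw b {..<card ?K} ?K"
    using ex_bij_betw_nat_finite[OF finite_free_torsion_pairs(2)] by (auto simp: atLeast0LessThan)
  define \<theta> :: "(int, 'n) cochain \<Rightarrow> (nat \<Rightarrow> int) \<times> (nat \<Rightarrow> int)" where
    "\<theta> f = (\<lambda>i\<in>{..<card ?J}. coord k f (a i), \<lambda>i\<in>{..<card ?K}. coord k f (b i) mod 2)" for f
  define fibre where "fibre v = {f \<in> cocycles k. \<theta> f = v}" for v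
  have eq: "\<theta> f = \<theta> g \<longleftrightarrow> (\<forall>p\<in>?J. coord k f p = coord k g p) \<and> (\<forall>p\<in>?K. 2 dvd coord k f p - coord k g p)" for f g
  proof -
    have "\<theta> f = \<theta> g \<longleftrightarrow> (\<forall>i\<in>{..<card ?J}. coord k f (a i) = coord k g (a i)) \<and>
        (\<forall>i\<in>{..<card ?K}. 2 dvd coord k f (b i) - coord k g (b i))"
      by (auto simp: \<theta>_def restrict_def fun_eq_iff mod_eq_dvd_iff)
    also have "\<dots> \<longleftrightarrow> (\<forall>p\<in>a ` {..<card ?J}. coord k f p = coord k g p) \<and>
        (\<forall>p\<in>b ` {..<card ?K}. 2 dvd coord k f p - coord k g p)" by blast
    finally show ?thesis unfolding bij_betw_imp_surj_on[OF a] bij_betw_imp_surj_on[OF b] .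
  qed
  have add: "\<theta> (\<lambda>t. f t + g t) = \<theta> f \<otimes>\<^bsub>?A \<times>\<times> ?B\<^esub> \<theta> g" for f g
    by (auto simp: \<theta>_def coord_add mod_add_eq fun_eq_iff)
  have surj: "\<theta> ` cocycles k = carrier (?A \<times>\<times> ?B)"
  proof
    show "carrier (?A \<times>\<times> ?B) \<subseteq> \<theta> ` cocycles k"
    proof
      fix v assume v: "v \<in> carrier (?A \<times>\<times> ?B)"
      define w where "w p = (if p \<in> ?J then fst v (inv_into {..<card ?J} a p) else snd v (inv_into {..<card ?K} b p))" for p
      obtain f where f: "f \<in> cocycles k" "\<And>p. p \<in> ?J \<union> ?K \<Longrightarrow> coord k f p = w p"
        using cocycle_of_coords[where k = k and v = w] by auto
      have "coord k f (a i) = fst v i" if "i < card ?J" for i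
      proof -
        have "a i \<in> ?J" using a that by (auto simp: bij_betw_def)
        then show ?thesis using f(2)[of "a i"] bij_betw_inv_into_left[OF a, of i] that by (simp add: w_def)
      qed
      moreover have "coord k f (b i) = snd v i" if "i < card ?K" for i
      proof -
        have "b i \<in> ?K" using b that by (auto simp: bij_betw_def)
        moreover from this have "b i \<notin> ?J" by (auto simp: free_pairs_def torsion_pairs_def upper_def)
        ultimately show ?thesis
          using f(2)[of "b i"] bij_betw_inv_into_left[OF b, of i] that by (simp add: w_def)
      qed
      moreover have "snd v i mod 2 = snd v i" if "i < card ?K" for i
        using v that by (auto simp: carrier_integer_mod_group PiE_def Pi_def)
      ultimately have "\<theta> f = v"
        using v by (cases v) (auto simp: \<theta>_def fun_eq_iff PiE_def extensional_def)
      with f(1) show "v \<in> \<theta> ` cocycles k" by blast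
    qed
  qed (auto simp: \<theta>_def carrier_integer_mod_group split: if_splits)
  have kernel: "\<forall>f\<in>cocycles k. \<forall>g\<in>cocycles k. \<theta> f = \<theta> g \<longleftrightarrow> (\<lambda>t. f t - g t) \<in> coboundaries k"
  proof (intro ballI)
    fix f g :: "(int, 'n) cochain" assume "f \<in> cocycles k" "g \<in> cocycles k"
    from cocycles_closed(3)[OF this] show "\<theta> f = \<theta> g \<longleftrightarrow> (\<lambda>t. f t - g t) \<in> coboundaries k"
      by (simp add: coboundaries_iff_coord eq coord_diff)
  qed
  note fibres = HH_fibres[where \<theta> = \<theta> and comb = "(\<otimes>\<^bsub>?A \<times>\<times> ?B\<^esub>)", OF kernel surj add, folded fibre_def]
  have "fibre \<in> iso (?A \<times>\<times> ?B) (add_monoid (HH k))"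
    unfolding iso_def hom_def bij_betw_def using fibres(1,2,4) by (auto simp del: carrier_DirProd mult_DirProd')
  then have "?A \<times>\<times> ?B \<cong> add_monoid (HH k :: (int, (int, 'n) cochain set) module)"
    unfolding is_iso_def by blast
  moreover have "group (?A \<times>\<times> ?B)" by (intro DirProd_group) simp_all
  ultimately show ?thesis by (rule group.iso_sym[rotated])
qed

theorem theorem4:
  fixes n k :: nat
  assumes n: "n = card (UNIV :: 'n::{finite,linorder} set)"
  shows
    "(\<exists>F T :: nat.
       F = 2 ^ (n - 1) * ((n + k - 1) choose k) + (if k = 0 \<and> odd n then 1 else 0) \<and>
       int T = 2 ^ (n - 1) * (\<Sum>i<k. (- 1) ^ (k - 1 - i) * int ((n + i - 1) choose i))
               + (if odd n \<and> k \<ge> 1 then (- 1) ^ k else 0) \<and>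
       add_monoid (HH k :: (int, (int, 'n) cochain set) module)
         \<cong> product_group {..<F} (\<lambda>_. integer_group) \<times>\<times> product_group {..<T} (\<lambda>_. integer_mod_group 2))
     \<and>
     vectorspace class_ring (HH k :: ('f::field, ('f, 'n) cochain set) module) \<and>
     vectorspace.fin_dim class_ring (HH k :: ('f, ('f, 'n) cochain set) module) \<and>
     vectorspace.dim class_ring (HH k :: ('f, ('f, 'n) cochain set) module) =
       (if CHAR('f) = 2 then 2 ^ n * ((n + k - 1) choose k)
        else if k \<ge> 1 \<or> even n then 2 ^ (n - 1) * ((n + k - 1) choose k)
        else 2 ^ (n - 1) + 1)"
proof (intro conjI)
  show "\<exists>F T :: nat.
       F = 2 ^ (n - 1) * ((n + k - 1) choose k) + (if k = 0 \<and> odd n then 1 else 0) \<and>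
       int T = 2 ^ (n - 1) * (\<Sum>i<k. (- 1) ^ (k - 1 - i) * int ((n + i - 1) choose i))
               + (if odd n \<and> k \<ge> 1 then (- 1) ^ k else 0) \<and>
       add_monoid (HH k :: (int, (int, 'n) cochain set) module)
         \<cong> product_group {..<F} (\<lambda>_. integer_group) \<times>\<times> product_group {..<T} (\<lambda>_. integer_mod_group 2)"
    using card_free_pairs[OF n, of k] card_torsion_pairs[OF n, of k] HH_int[where ?'n = 'n and k = k] by blast
next
  let ?H = "HH k :: ('f, ('f, 'n) cochain set) module"
  define J :: "('n multiset \<times> 'n set) set" where "J = (if CHAR('f) = 2 then pairs k else free_pairs k)"
  have two: "(2 :: 'f) = 0 \<longleftrightarrow> CHAR('f) = 2"
  proof -
    have "(2 :: 'f) = 0 \<longleftrightarrow> CHAR('f) dvd 2"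
      using of_nat_eq_0_iff_char_dvd[where ?'a = 'f, of 2] by simp
    also have "\<dots> \<longleftrightarrow> CHAR('f) = 2"
      using two_is_prime_nat CHAR_not_1[where ?'a = 'f] by (auto simp: prime_nat_iff)
    finally show ?thesis .
  qed
  have fin: "finite J" by (simp add: J_def finite_pairs finite_free_torsion_pairs)
  have exists: "\<exists>f :: ('f, 'n) cochain \<in> cocycles k. \<forall>p\<in>J. coord k f p = v p" for v
  proof (cases "CHAR('f) = 2")
    case True
    with two show ?thesis unfolding J_def by (simp add: cocycle_of_coords_char_2)
  next
    case False
    with two obtain f :: "('f, 'n) cochain" where "f \<in> cocycles k" "\<forall>p\<in>free_pairs k \<union> torsion_pairs k. coord k f p = v p"
      using cocycle_of_coords[of k v] by blast
    with False show ?thesis by (auto simp: J_def)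
  qed
  have ker: "\<forall>f :: ('f, 'n) cochain \<in> cocycles k. f \<in> coboundaries k \<longleftrightarrow> (\<forall>p\<in>J. coord k f p = 0)"
  proof (intro ballI, cases "CHAR('f) = 2")
    case False
    fix f :: "('f, 'n) cochain" assume f: "f \<in> cocycles k"
    from False have "2 dvd coord k f p" for p
      using two by (simp add: dvd_field_iff)
    with False show "f \<in> coboundaries k \<longleftrightarrow> (\<forall>p\<in>J. coord k f p = 0)"
      using coboundaries_iff_coord[OF _ f] two by (simp add: J_def)
  qed (use coboundaries_iff_coord_char_2 two in \<open>simp add: J_def\<close>)
  note HH = HH_vectorspace[OF fin exists ker]
  show "vectorspace class_ring ?H" "vectorspace.fin_dim class_ring ?H" by (rule HH; assumption)+
  show "vectorspace.dim class_ring ?H =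
       (if CHAR('f) = 2 then 2 ^ n * ((n + k - 1) choose k)
        else if k \<ge> 1 \<or> even n then 2 ^ (n - 1) * ((n + k - 1) choose k)
        else 2 ^ (n - 1) + 1)"
    unfolding HH(3) J_def using card_pairs[OF n, of k] card_free_pairs[OF n, of k] by (cases "k = 0") auto
qed

end
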